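(* Let $\mathfrak{X}$ be a Banach space and let $\mathsf{A} \subseteq \mathcal{B}(\mathfrak{X})$ be precompact and nonempty. Then $$\hat\varrho(\mathsf{A})=\max\{\varrho_\chi(\mathsf{A}),\varrho_r(\mathsf{A})\}$$ and $$\varrho_\chi(\mathsf{A})=\varrho_f(\mathsf{A}).$$
   Context: $\mathcal{B}(\mathfrak{X})$ is the space of bounded linear operators on $\mathfrak{X}$ with the operator norm $\|\cdot\|$; precompact means having compact closure in the operator norm topology. $B_{\mathfrak{X}}$ denotes the unit ball of $\mathfrak{X}$. For $L \in \mathcal{B}(\mathfrak{X})$, the Hausdorff measure of noncompactness $\|L\|_\chi$ is the infimum of all positive reals $\varepsilon$ for which $LB_{\mathfrak{X}}$ admits a finite $\varepsilon$-net, and $\|L\|_f := \inf\{\|L-K\| \colon K \in \mathcal{B}(\mathfrak{X}),\ \mathrm{rank}\,K<\infty\}$. $\rho(L)$ denotes the spectral radius of $L$, $\rho(L)=\lim_{n\to\infty}\|L^n\|^{1/n}$. For a bounded set $\mathsf{A} \subseteq \mathcal{B}(\mathfrak{X})$ and $n \in \mathbb{N}=\{1,2,\ldots\}$, put $\mathsf{A}^n := \{A_{i_n}\cdots A_{i_1} \colon A_{i_j} \in \mathsf{A}\}$ (the set of all products of $n$ elements of $\mathsf{A}$). Define $$\hat\varrho(\mathsf{A}) := \lim_{n \to \infty} \sup_{A \in \mathsf{A}^n} \|A\|^{1/n},\qquad \varrho_\chi(\mathsf{A}) := \lim_{n \to \infty} \sup_{A \in \mathsf{A}^n} \|A\|_\chi^{1/n},$$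 $$\varrho_f(\mathsf{A}) := \lim_{n \to \infty} \sup_{A \in \mathsf{A}^n} \|A\|_f^{1/n},\qquad \varrho_r(\mathsf{A}) := \limsup_{n \to \infty} \sup_{A \in \mathsf{A}^n} \rho(A)^{1/n}.$$ The limits in the definitions of $\hat\varrho$, $\varrho_\chi$, $\varrho_f$ exist by submultiplicativity of $\|\cdot\|$, $\|\cdot\|_\chi$, $\|\cdot\|_f$. *)

theory Defs
  imports "HOL-Analysis.Analysis"
begin

text \<open>
  A Banach space may be real or complex, and the library's class \<open>banach\<close> only records the real
  structure. The scalar field is therefore a type \<open>'k\<close> of sort \<open>{real_normed_field, euclidean_space}\<close>:
  a finite-dimensional real field with multiplicative norm, so, up to isometric isomorphism,
  \<open>'k\<close> is \<open>real\<close> or \<open>complex\<close>. A Banach space over \<open>'k\<close> is a type of class \<open>banach\<close> with a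
  compatible multiplication by scalars from \<open>'k\<close>.
\<close>

locale banach_over = vector_space scaleK
  for scaleK :: "'k::{real_normed_field, euclidean_space} \<Rightarrow> 'a::banach \<Rightarrow> 'a" +
  assumes scale_of_real: "scaleK (of_real r) x = r *\<^sub>R x"
    and norm_scale: "norm (scaleK c x) = norm c * norm x"

lemma banach_over_real: "banach_over (scaleR :: real \<Rightarrow> 'a::banach \<Rightarrow> 'a)"
  by unfold_locales (simp_all add: scaleR_add_right scaleR_add_left)

lemma banach_over_complex: "banach_over ((*) :: complex \<Rightarrow> complex \<Rightarrow> complex)"
  by unfold_locales (simp_all add: algebra_simps norm_mult scaleR_conv_of_real)

text \<open>
  Elements of \<open>'a \<Rightarrow>\<^sub>L 'a\<close> are only real-linear, so \<open>'k\<close>-linearity is imposed; for \<open>scaleK = scaleR\<close>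
  it holds automatically.
\<close>

definition bounded_ops :: "('k \<Rightarrow> 'a \<Rightarrow> 'a) \<Rightarrow> ('a::real_normed_vector \<Rightarrow>\<^sub>L 'a) set" where
  "bounded_ops scaleK = {L. \<forall>c x. blinfun_apply L (scaleK c x) = scaleK c (blinfun_apply L x)}"

lemma bounded_ops_scaleR: "bounded_ops scaleR = UNIV"
  by (simp add: bounded_ops_def blinfun.scaleR_right)

definition finite_rank :: "('k::comm_ring_1 \<Rightarrow> 'a \<Rightarrow> 'a) \<Rightarrow> ('a::real_normed_vector \<Rightarrow>\<^sub>L 'a) \<Rightarrow> bool" where
  "finite_rank scaleK K \<longleftrightarrow> (\<exists>B. finite B \<and> range (blinfun_apply K) \<subseteq> module.span scaleK B)"

definition norm_chi :: "('a::real_normed_vector \<Rightarrow>\<^sub>L 'a) \<Rightarrow> real" where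
  "norm_chi L = Inf {\<epsilon>. 0 < \<epsilon> \<and> (\<exists>F. finite F \<and> blinfun_apply L ` cball 0 1 \<subseteq> (\<Union>y\<in>F. cball y \<epsilon>))}"

definition norm_f :: "('k::comm_ring_1 \<Rightarrow> 'a \<Rightarrow> 'a) \<Rightarrow> ('a::real_normed_vector \<Rightarrow>\<^sub>L 'a) \<Rightarrow> real" where
  "norm_f scaleK L = Inf {norm (L - K) | K. K \<in> bounded_ops scaleK \<and> finite_rank scaleK K}"

definition op_power :: "('a::real_normed_vector \<Rightarrow>\<^sub>L 'a) \<Rightarrow> nat \<Rightarrow> ('a \<Rightarrow>\<^sub>L 'a)" where
  "op_power L n = ((o\<^sub>L) L ^^ n) id_blinfun"

definition spec_radius :: "('a::real_normed_vector \<Rightarrow>\<^sub>L 'a) \<Rightarrow> real" where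
  "spec_radius L = lim (\<lambda>n. root n (norm (op_power L n)))"

primrec op_products :: "('a::real_normed_vector \<Rightarrow>\<^sub>L 'a) set \<Rightarrow> nat \<Rightarrow> ('a \<Rightarrow>\<^sub>L 'a) set" where
  "op_products A 0 = {id_blinfun}"
| "op_products A (Suc n) = {L o\<^sub>L M | L M. L \<in> A \<and> M \<in> op_products A n}"

text \<open>
  The growth rates are taken in the extended reals, where suprema and upper limits are total;
  for bounded nonempty \<open>A\<close> they are finite.
\<close>

definition joint_radius :: "('a::real_normed_vector \<Rightarrow>\<^sub>L 'a) set \<Rightarrow> ereal" where
  "joint_radius A = lim (\<lambda>n. SUP L\<in>op_products A n. ereal (root n (norm L)))"

definition radius_chi :: "('a::real_normed_vector \<Rightarrow>\<^sub>L 'a) set \<Rightarrow> ereal" where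
  "radius_chi A = lim (\<lambda>n. SUP L\<in>op_products A n. ereal (root n (norm_chi L)))"

definition radius_f :: "('k::comm_ring_1 \<Rightarrow> 'a \<Rightarrow> 'a) \<Rightarrow> ('a::real_normed_vector \<Rightarrow>\<^sub>L 'a) set \<Rightarrow> ereal" where
  "radius_f scaleK A = lim (\<lambda>n. SUP L\<in>op_products A n. ereal (root n (norm_f scaleK L)))"

definition radius_r :: "('a::real_normed_vector \<Rightarrow>\<^sub>L 'a) set \<Rightarrow> ereal" where
  "radius_r A = limsup (\<lambda>n. SUP L\<in>op_products A n. ereal (root n (spec_radius L)))"

end

theory Submission
  imports Defs "Jordan_Normal_Form.Determinant"
begin

text \<open>
  Rescale so that \<open>joint_radius A = 1\<close> and suppose \<open>radius_chi A < 1\<close>. Measure \<open>j\<close>-dimensional volumes by the product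
  of the distances of each vector to the span of its predecessors; the largest \<open>j\<close>-volume growth of an operator is
  submultiplicative. Since \<open>radius_chi A < 1\<close>, the growth rate of \<open>j\<close>-volumes is less than 1 for large \<open>j\<close>, while for
  \<open>j = 1\<close> it is 1. Let \<open>q + 1\<close> be the least \<open>j\<close> with rate less than 1. Along a long product that almost preserves some
  \<open>q\<close>-volume, the images \<open>E\<^sub>i\<close> of the corresponding \<open>q\<close>-dimensional subspace are expanded at rate almost 1, and the
  decay of \<open>(q + 1)\<close>-volumes makes the products contract exponentially modulo \<open>E\<^sub>i\<close>: a dominated splitting. By the Pliss
  lemma this holds with uniform constants at most times, and by compactness two such \<open>E\<^sub>i\<close>, \<open>E\<^sub>j\<close> are close to each
  other. The product from time \<open>i\<close> to time \<open>j\<close> maps a cone around \<open>E\<^sub>i\<close> into itself without contracting it much, so its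
  spectral radius is not exponentially small. This replaces the multiplicative ergodic theorem.

  For \<open>radius_chi A = radius_f A\<close>: if the elements of \<open>A\<^sup>k\<close> map the unit ball into the \<open>d\<close>-neighbourhood of a fixed
  finite set of size \<open>N\<close>, then a product of \<open>n\<close> of them maps it into the \<open>d\<^sup>n\<close>-neighbourhood of a subspace of
  dimension at most \<open>n N\<close>, onto which there is a projection of norm at most \<open>2 n N\<close> by Auerbach's lemma; this factor
  is subexponential.
\<close>

section \<open>Submultiplicative growth rates\<close>

text \<open>The obstacle is that a general norm offers neither orthogonality nor an invariant
  complement of the expanded subspaces: volumes depend on the order of the vectors, infima need not
  be attained, and the contracted directions must be found for each length separately. All this
  costs bounded factors only, which exponential rates do not see. The rates form a chain. Factors
  have norm at most e^\<epsilon>, so q-volumes grow by at most e^\<sigma> per step, \<sigma> =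
  q\<epsilon>. Good times allow a loss of 4\<sigma> per step, so that forward and backward good
  times each fill about four fifths of the orbit. Passing from volumes to single vectors costs
  another \<sigma>, which gives rate 5\<sigma> on E_i against contraction at rate \<gamma> -
  4\<sigma> modulo E_i; 10\<sigma> < \<gamma> ensures domination, and 6\<sigma> absorbs the
  constants at the end. Since \<epsilon> is chosen after q and \<gamma>, \<sigma> is as small as
  desired. The E_i are nearly compact because the unit ball of E_j lies in the image, under r
  factors, of a ball of radius O(e^(5\<sigma>r)), while \<open>norm_chi\<close> decays faster than
  e^(-5\<sigma>r). Spans and volumes are real in this half; the scalar field enters with finite rank
  operators.\<close>

lemma submultiplicative_root_tendsto:
  fixes a :: "nat \<Rightarrow> real"
  assumes nonneg: "\<And>n. 0 \<le> a n"
    and sub: "\<And>m n. a (m + n) \<le> a m * a n"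
  shows "(\<lambda>n. root n (a n)) \<longlonglongrightarrow> (INF n\<in>{1..}. root n (a n))"
proof -
  define l where "l = (INF n\<in>{1..}. root n (a n))"
  have bdd: "bdd_below ((\<lambda>n. root n (a n)) ` {1..})"
    by (rule bdd_belowI[of _ 0]) (auto simp: nonneg)
  have low: "l \<le> root n (a n)" if "n \<ge> 1" for n
    unfolding l_def using bdd that by (intro cINF_lower) auto
  have l0: "0 \<le> l"
    unfolding l_def by (rule cINF_greatest) (auto simp: nonneg)
  have "(\<lambda>n. root n (a n)) \<longlonglongrightarrow> l"
  proof (rule order_tendstoI)
    fix y assume "y < l"
    then show "\<forall>\<^sub>F n in sequentially. y < root n (a n)"
      using low by (intro eventually_sequentiallyI[of 1]) (auto intro: less_le_trans)
  next
    fix y assume "l < y"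
    then obtain t where t: "l < t" "t < y" using dense by blast
    then have t0: "t > 0" using l0 by linarith
    have "\<exists>m\<in>{1..}. root m (a m) < t"
      using t(1) bdd unfolding l_def by (subst (asm) cINF_less_iff) auto
    then obtain m where m: "m \<ge> 1" "root m (a m) < t" by auto
    have "a m = root m (a m) ^ m"
      using m nonneg by simp
    also have "\<dots> \<le> t ^ m"
      using m nonneg by (intro power_mono) auto
    finally have am: "a m \<le> t ^ m" .
    \<comment> \<open>Fekete's argument; roots instead of logarithms admit the value 0.
      \<open>K\<close> majorises all remainders modulo \<open>m\<close> at once, and its summand 1
      makes it positive, so that its roots tend to 1.\<close>
    define K where "K = 1 + (\<Sum>r<m. a r / t ^ r)"
    have K: "K \<ge> 1" unfolding K_def using nonneg t0 by (auto intro!: sum_nonneg)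
    have ar: "a r \<le> K * t ^ r" if "r < m" for r
    proof -
      have "a r / t ^ r \<le> (\<Sum>r<m. a r / t ^ r)"
        using that nonneg t0 by (intro member_le_sum) auto
      then have "a r / t ^ r \<le> K" unfolding K_def by linarith
      then show ?thesis using t0 by (simp add: field_simps)
    qed
    have blk: "a (m * p + r) \<le> K * t ^ (m * p + r)" if "r < m" for p r
    proof (induction p)
      case 0
      then show ?case using ar[OF that] by simp
    next
      case (Suc p)
      have "a (m * Suc p + r) \<le> a m * a (m * p + r)"
        using sub[of m "m * p + r"] by (simp add: algebra_simps)
      also have "\<dots> \<le> t ^ m * (K * t ^ (m * p + r))"
        using am Suc nonneg t0 by (intro mult_mono) auto
      finally show ?case by (simp add: power_add algebra_simps)
    qed
    have an: "a n \<le> K * t ^ n" for n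
      using blk[of "n mod m" "n div m"] m by simp
    have "(\<lambda>n. root n K * t) \<longlonglongrightarrow> 1 * t"
      using K by (intro tendsto_mult LIMSEQ_root_const tendsto_const) auto
    then have ev: "\<forall>\<^sub>F n in sequentially. root n K * t < y"
      using t by (intro order_tendstoD(2)[where y="t"]) auto
    show "\<forall>\<^sub>F n in sequentially. root n (a n) < y"
      using ev eventually_gt_at_top[of "0::nat"]
    proof eventually_elim
      case (elim n)
      have "root n (a n) \<le> root n (K * t ^ n)"
        using an elim by simp
      also have "\<dots> = root n K * t"
        using elim t0 by (simp add: real_root_mult real_root_power_cancel)
      finally show ?case using elim by simp
    qed
  qed
  then show ?thesis unfolding l_def .
qed

section \<open>Products of operators\<close>

lemma id_blinfun_compose [simp]: "id_blinfun o\<^sub>L L = L" "L o\<^sub>L id_blinfun = L"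
  by (auto intro!: blinfun_eqI)

lemma blinfun_compose_assoc: "(L o\<^sub>L M) o\<^sub>L N = L o\<^sub>L (M o\<^sub>L N)"
  by (auto intro!: blinfun_eqI)

lemma op_products_append:
  "op_products A (m + n) = {L o\<^sub>L M | L M. L \<in> op_products A m \<and> M \<in> op_products A n}"
proof (induction m)
  case 0
  then show ?case by auto
next
  case (Suc m)
  show ?case
  proof (intro equalityI subsetI)
    fix X assume "X \<in> op_products A (Suc m + n)"
    then obtain L L1 M where "X = L o\<^sub>L (L1 o\<^sub>L M)" "L \<in> A" "L1 \<in> op_products A m" "M \<in> op_products A n"
      using Suc by auto
    moreover have "L o\<^sub>L (L1 o\<^sub>L M) = (L o\<^sub>L L1) o\<^sub>L M"
      by (simp add: blinfun_compose_assoc)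
    ultimately show "X \<in> {L o\<^sub>L M | L M. L \<in> op_products A (Suc m) \<and> M \<in> op_products A n}"
      by auto
  next
    fix X assume "X \<in> {L o\<^sub>L M | L M. L \<in> op_products A (Suc m) \<and> M \<in> op_products A n}"
    then obtain L L1 M where "X = L o\<^sub>L (L1 o\<^sub>L M)" "L \<in> A" "L1 \<in> op_products A m" "M \<in> op_products A n"
      by (auto simp: blinfun_compose_assoc)
    then show "X \<in> op_products A (Suc m + n)"
      using Suc by auto
  qed
qed

lemma op_products_nonempty: "A \<noteq> {} \<Longrightarrow> op_products A n \<noteq> {}"
  by (induction n) auto

lemma op_products_op_products: "op_products (op_products A m) n = op_products A (m * n)"
proof (induction n)
  case (Suc n)
  have "op_products A (m * Suc n) = op_products A (m + m * n)" by simp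
  then show ?case using Suc unfolding op_products_append by simp
qed simp

lemma op_products_scaleR:
  "op_products ((\<lambda>L. c *\<^sub>R L) ` A) n = (\<lambda>L. c ^ n *\<^sub>R L) ` op_products A n"
proof (induction n)
  case (Suc n)
  then show ?case
    by (force simp: mult.commute
        bounded_bilinear.scaleR_left[OF bounded_bilinear_blinfun_compose]
        bounded_bilinear.scaleR_right[OF bounded_bilinear_blinfun_compose])
qed simp

lemma op_products_norm_le:
  assumes "\<And>L. L \<in> A \<Longrightarrow> norm L \<le> M" "0 \<le> M" "L \<in> op_products A n"
  shows "norm L \<le> M ^ n"
  using assms(3)
proof (induction n arbitrary: L)
  case 0
  then show ?case by (simp add: norm_blinfun_id_le)
next
  case (Suc n)
  then obtain L1 L2 where L: "L = L1 o\<^sub>L L2" "L1 \<in> A" "L2 \<in> op_products A n" by auto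
  have "norm L \<le> norm L1 * norm L2" using L norm_blinfun_compose by blast
  also have "\<dots> \<le> M * M ^ n" using L Suc.IH assms by (intro mult_mono) auto
  finally show ?case by simp
qed

section \<open>Spectral radius\<close>

lemma op_power_Suc: "op_power L (Suc n) = L o\<^sub>L op_power L n"
  by (simp add: op_power_def)

lemma op_power_in_products: "op_power L n \<in> op_products {L} n"
  by (induction n) (auto simp: op_power_Suc, simp add: op_power_def)

lemma op_products_singleton: "op_products {L} n = {op_power L n}"
  by (induction n) (auto simp: op_power_Suc, auto simp add: op_power_def)

lemma spec_radius_tendsto: "(\<lambda>n. root n (norm (op_power L n))) \<longlonglongrightarrow> spec_radius L"
proof -
  have "op_power L (m + n) = op_power L m o\<^sub>L op_power L n" for m n
    using op_products_append[of "{L}" m n] unfolding op_products_singleton by auto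
  then have "norm (op_power L (m + n)) \<le> norm (op_power L m) * norm (op_power L n)" for m n
    using norm_blinfun_compose by metis
  then have "(\<lambda>n. root n (norm (op_power L n))) \<longlonglongrightarrow> (INF n\<in>{1..}. root n (norm (op_power L n)))"
    by (intro submultiplicative_root_tendsto) auto
  then show ?thesis unfolding spec_radius_def by (metis limI)
qed

lemma spec_radius_nonneg: "0 \<le> spec_radius L"
  using spec_radius_tendsto by (rule LIMSEQ_le_const) (auto simp: real_root_ge_zero)

lemma norm_op_power_le: "norm (op_power L n) \<le> norm L ^ n"
  using op_power_in_products by (rule op_products_norm_le[rotated 2]) auto

lemma spec_radius_le_norm: "spec_radius L \<le> norm L"
proof (rule LIMSEQ_le_const2[OF spec_radius_tendsto])
  show "\<exists>N. \<forall>n\<ge>N. root n (norm (op_power L n)) \<le> norm L"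
  proof (intro exI[of _ 1] allI impI)
    fix n :: nat assume n: "1 \<le> n"
    then have "root n (norm (op_power L n)) \<le> root n (norm L ^ n)"
      by (simp add: norm_op_power_le)
    then show "root n (norm (op_power L n)) \<le> norm L"
      using n by (simp add: real_root_power_cancel)
  qed
qed

lemma spec_radius_ge:
  assumes "0 < c" "0 \<le> t" "\<And>n. c * t ^ n \<le> norm (op_power L n)"
  shows "t \<le> spec_radius L"
proof (rule LIMSEQ_le)
  show "(\<lambda>n. root n c * t) \<longlonglongrightarrow> t"
    using tendsto_mult[OF LIMSEQ_root_const[OF assms(1)] tendsto_const[of t]] by simp
  show "\<exists>N. \<forall>n\<ge>N. root n c * t \<le> root n (norm (op_power L n))"
  proof (intro exI[of _ 1] allI impI)
    fix n :: nat assume n: "1 \<le> n"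
    then have "root n c * t = root n (c * t ^ n)"
      using assms by (simp add: real_root_mult real_root_power_cancel)
    also have "\<dots> \<le> root n (norm (op_power L n))"
      using n assms by simp
    finally show "root n c * t \<le> root n (norm (op_power L n))" .
  qed
qed (rule spec_radius_tendsto)

lemma op_power_scaleR: "op_power (c *\<^sub>R L) n = c ^ n *\<^sub>R op_power L n"
proof -
  have "{op_power (c *\<^sub>R L) n} = op_products ((\<lambda>L. c *\<^sub>R L) ` {L}) n"
    using op_products_singleton[of "c *\<^sub>R L" n] by simp
  then show ?thesis
    unfolding op_products_scaleR op_products_singleton by simp
qed

lemma spec_radius_scaleR:
  assumes "0 \<le> c"
  shows "spec_radius (c *\<^sub>R L) = c * spec_radius L"
proof (rule LIMSEQ_unique)
  show "(\<lambda>n. root n (norm (op_power (c *\<^sub>R L) n))) \<longlonglongrightarrow> spec_radius (c *\<^sub>R L)"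
    by (rule spec_radius_tendsto)
  have "(\<lambda>n. c * root n (norm (op_power L n))) \<longlonglongrightarrow> c * spec_radius L"
    by (intro tendsto_mult spec_radius_tendsto tendsto_const)
  moreover have "\<forall>\<^sub>F n in sequentially. c * root n (norm (op_power L n)) = root n (norm (op_power (c *\<^sub>R L) n))"
    using eventually_gt_at_top[of "0::nat"]
    by eventually_elim (use assms in \<open>simp add: op_power_scaleR real_root_mult real_root_power_cancel\<close>)
  ultimately show "(\<lambda>n. root n (norm (op_power (c *\<^sub>R L) n))) \<longlonglongrightarrow> c * spec_radius L"
    by (rule Lim_transform_eventually)
qed

text \<open>Serves \<open>norm\<close>, \<open>norm_chi\<close> and \<open>norm_f\<close> alike. The
  hypotheses speak of products of \<open>A\<close> only, because \<open>norm_f\<close> is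
  submultiplicative only on operators linear over the scalar field. The upper bound holds
  eventually, the lower one for every \<open>n \<ge> 1\<close>, since the limit is an
  infimum.\<close>

lemma submultiplicative_growth:
  fixes A :: "('a::real_normed_vector \<Rightarrow>\<^sub>L 'a) set" and \<nu> :: "('a \<Rightarrow>\<^sub>L 'a) \<Rightarrow> real"
  assumes ne: "A \<noteq> {}" and bnd: "bounded A"
    and nonneg: "\<And>n L. L \<in> op_products A n \<Longrightarrow> 0 \<le> \<nu> L"
    and le_norm: "\<And>n L. L \<in> op_products A n \<Longrightarrow> \<nu> L \<le> norm L"
    and sub: "\<And>m n L M. L \<in> op_products A m \<Longrightarrow> M \<in> op_products A n \<Longrightarrow> \<nu> (L o\<^sub>L M) \<le> \<nu> L * \<nu> M"
  obtains R where "0 \<le> R"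
    and "(\<lambda>n. SUP L\<in>op_products A n. ereal (root n (\<nu> L))) \<longlonglongrightarrow> ereal R"
    and "\<And>t. R < t \<Longrightarrow> \<forall>\<^sub>F n in sequentially. \<forall>L\<in>op_products A n. \<nu> L < t ^ n"
    and "\<And>t n. 0 \<le> t \<Longrightarrow> t < R \<Longrightarrow> n \<ge> 1 \<Longrightarrow> \<exists>L\<in>op_products A n. t ^ n < \<nu> L"
proof -
  obtain M where M: "M > 0" "\<And>L. L \<in> A \<Longrightarrow> norm L \<le> M"
    using bnd bounded_pos by blast
  have up: "\<nu> L \<le> M ^ n" if "L \<in> op_products A n" for L n
    using op_products_norm_le[of A M L n] M le_norm[OF that] that by force
  define s where "s n = (SUP L\<in>op_products A n. \<nu> L)" for n
  have bdd: "bdd_above (\<nu> ` op_products A n)" for n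
    using up by (intro bdd_aboveI2)
  have s_up: "\<nu> L \<le> s n" if "L \<in> op_products A n" for L n
    unfolding s_def using bdd that by (intro cSUP_upper) auto
  have s_le: "s n \<le> z" if "\<And>L. L \<in> op_products A n \<Longrightarrow> \<nu> L \<le> z" for n z
    unfolding s_def using op_products_nonempty[OF ne] that by (intro cSUP_least) auto
  have s0: "0 \<le> s n" for n
  proof -
    obtain L where "L \<in> op_products A n" using op_products_nonempty[OF ne] by blast
    then show ?thesis using s_up nonneg order_trans by blast
  qed
  have s_sub: "s (m + n) \<le> s m * s n" for m n
  proof (rule s_le)
    fix X assume "X \<in> op_products A (m + n)"
    then obtain L K where X: "X = L o\<^sub>L K" "L \<in> op_products A m" "K \<in> op_products A n"
      unfolding op_products_append by auto
    have "\<nu> X \<le> \<nu> L * \<nu> K" using X sub by auto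
    also have "\<dots> \<le> s m * s n" using X s_up nonneg s0 by (intro mult_mono) auto
    finally show "\<nu> X \<le> s m * s n" .
  qed
  define R where "R = (INF n\<in>{1..}. root n (s n))"
  have lim: "(\<lambda>n. root n (s n)) \<longlonglongrightarrow> R"
    unfolding R_def using s0 s_sub by (rule submultiplicative_root_tendsto)
  have R_le: "R \<le> root n (s n)" if "n \<ge> 1" for n
    unfolding R_def using that s0
    by (intro cINF_lower bdd_belowI[of _ 0]) auto
  have sup: "(SUP L\<in>op_products A n. ereal (root n (\<nu> L))) = ereal (root n (s n))" if n: "n \<ge> 1" for n
  proof (rule SUP_eqI)
    fix L assume "L \<in> op_products A n"
    then show "ereal (root n (\<nu> L)) \<le> ereal (root n (s n))" using s_up n by simp
  next
    fix y assume y: "\<And>L. L \<in> op_products A n \<Longrightarrow> ereal (root n (\<nu> L)) \<le> y"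
    obtain L0 where L0: "L0 \<in> op_products A n" using op_products_nonempty[OF ne] by blast
    show "ereal (root n (s n)) \<le> y"
    proof (cases y)
      case (real z)
      have z0: "0 \<le> z" using y[OF L0] nonneg[OF L0] real
        by (metis ereal_less_eq(3) order_trans real_root_ge_zero)
      have "s n \<le> z ^ n"
      proof (rule s_le)
        fix L assume L: "L \<in> op_products A n"
        then have "root n (\<nu> L) \<le> z" using y real by auto
        then have "root n (\<nu> L) ^ n \<le> z ^ n"
          using nonneg[OF L] by (intro power_mono) (auto simp: real_root_ge_zero)
        then show "\<nu> L \<le> z ^ n" using nonneg[OF L] n by simp
      qed
      then have "root n (s n) \<le> root n (z ^ n)" using n by simp
      then show ?thesis using real n z0 by (simp add: real_root_power_cancel)
    next
      case MInf
      then show ?thesis using y[OF L0] by simp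
    qed simp
  qed
  show ?thesis
  proof (rule that)
    show "0 \<le> R" using lim by (rule LIMSEQ_le_const) (auto simp: s0 real_root_ge_zero)
    have "(\<lambda>n. ereal (root n (s n))) \<longlonglongrightarrow> ereal R" using lim by simp
    then show "(\<lambda>n. SUP L\<in>op_products A n. ereal (root n (\<nu> L))) \<longlonglongrightarrow> ereal R"
      by (rule Lim_transform_eventually)
        (use sup in \<open>auto intro!: eventually_sequentiallyI[of 1]\<close>)
  next
    fix t assume "R < t"
    then have "\<forall>\<^sub>F n in sequentially. root n (s n) < t"
      using lim by (rule order_tendstoD(2)[rotated])
    then show "\<forall>\<^sub>F n in sequentially. \<forall>L\<in>op_products A n. \<nu> L < t ^ n"
      using eventually_gt_at_top[of "0::nat"]
    proof eventually_elim
      case (elim n)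
      have "s n = root n (s n) ^ n" using elim s0 by simp
      also have "\<dots> < t ^ n" using elim s0 by (intro power_strict_mono) auto
      finally show ?case using s_up by (meson le_less_trans)
    qed
  next
    fix t and n :: nat assume t: "0 \<le> t" "t < R" and n: "n \<ge> 1"
    have "t ^ n < root n (s n) ^ n"
      using t n R_le[OF n] by (intro power_strict_mono) auto
    then have "t ^ n < s n" using n s0 by simp
    then show "\<exists>L\<in>op_products A n. t ^ n < \<nu> L"
      unfolding s_def using bdd op_products_nonempty[OF ne] by (subst (asm) less_cSUP_iff) auto
  qed
qed

section \<open>The measure of noncompactness\<close>

lemma norm_chi_le:
  assumes "0 < t" "finite F" "blinfun_apply L ` cball 0 1 \<subseteq> (\<Union>y\<in>F. cball y t)"
  shows "norm_chi L \<le> t"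
  unfolding norm_chi_def using assms by (intro cInf_lower bdd_belowI[of _ 0]) auto

lemma norm_chi_set_nonempty:
  "norm L + 1 \<in> {\<epsilon>. 0 < \<epsilon> \<and> (\<exists>F. finite F \<and> blinfun_apply L ` cball 0 1 \<subseteq> (\<Union>y\<in>F. cball y \<epsilon>))}"
proof -
  have "norm (blinfun_apply L x) \<le> norm L + 1" if "norm x \<le> 1" for x
  proof -
    have "norm (blinfun_apply L x) \<le> norm L * norm x" by (rule norm_blinfun)
    also have "\<dots> \<le> norm L * 1" using that by (intro mult_left_mono) auto
    finally show ?thesis by simp
  qed
  then have "blinfun_apply L ` cball 0 1 \<subseteq> (\<Union>y\<in>{0}. cball y (norm L + 1))" by auto
  moreover have "0 < norm L + 1" by (smt (verit) norm_ge_zero)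
  ultimately show ?thesis by blast
qed

lemma norm_chi_lessD:
  assumes "norm_chi L < t"
  obtains F where "finite F" "blinfun_apply L ` cball 0 1 \<subseteq> (\<Union>y\<in>F. cball y t)" "0 < t"
proof -
  obtain e F where e: "0 < e" "e < t" "finite F" "blinfun_apply L ` cball 0 1 \<subseteq> (\<Union>y\<in>F. cball y e)"
    using assms norm_chi_set_nonempty[of L] unfolding norm_chi_def
    by (subst (asm) cInf_less_iff) (auto intro: bdd_belowI[of _ 0])
  have "cball y e \<subseteq> cball y t" for y :: 'a using e by (intro subset_cball) auto
  then have "blinfun_apply L ` cball 0 1 \<subseteq> (\<Union>y\<in>F. cball y t)" using e by blast
  with e show ?thesis by (intro that) auto
qed

lemma norm_chi_nonneg: "0 \<le> norm_chi L"
  unfolding norm_chi_def using norm_chi_set_nonempty[of L] by (intro cInf_greatest) auto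

lemma norm_chi_le_norm_add: "norm_chi (L + M) \<le> norm_chi L + norm M"
proof (rule field_le_epsilon)
  fix e :: real assume e: "0 < e"
  then obtain F where F: "finite F" "blinfun_apply L ` cball 0 1 \<subseteq> (\<Union>y\<in>F. cball y (norm_chi L + e))"
    using norm_chi_lessD[of L "norm_chi L + e"] by force
  have "blinfun_apply (L + M) ` cball 0 1 \<subseteq> (\<Union>y\<in>F. cball y (norm_chi L + norm M + e))"
  proof clarsimp
    fix x :: 'a assume x: "norm x \<le> 1"
    then obtain y where y: "y \<in> F" "dist y (blinfun_apply L x) \<le> norm_chi L + e" using F by force
    have "norm (blinfun_apply M x) \<le> norm M"
      using norm_blinfun[of M x] x by (smt (verit) mult_left_le norm_ge_zero)
    moreover have "dist y (blinfun_apply (L + M) x) \<le> dist y (blinfun_apply L x) + norm (blinfun_apply M x)"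
      by (simp add: dist_norm blinfun.add_left) (metis diff_diff_eq norm_triangle_ineq4)
    ultimately show "\<exists>y\<in>F. dist y (blinfun_apply (L + M) x) \<le> norm_chi L + norm M + e"
      using y by (intro bexI[of _ y]) auto
  qed
  then show "norm_chi (L + M) \<le> norm_chi L + norm M + e"
    using F e norm_chi_nonneg[of L] norm_ge_zero[of M] by (intro norm_chi_le) linarith+
qed

lemma norm_chi_0: "norm_chi (0 :: 'a::real_normed_vector \<Rightarrow>\<^sub>L 'a) = 0"
proof (rule antisym)
  show "norm_chi (0 :: 'a \<Rightarrow>\<^sub>L 'a) \<le> 0"
  proof (rule field_le_epsilon)
    fix e :: real assume "0 < e"
    then show "norm_chi (0 :: 'a \<Rightarrow>\<^sub>L 'a) \<le> 0 + e"
      by (intro norm_chi_le[of _ "{0}"]) auto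
  qed
qed (rule norm_chi_nonneg)

lemma norm_chi_le_norm: "norm_chi L \<le> norm L"
  using norm_chi_le_norm_add[of 0 L] by (simp add: norm_chi_0)

lemma net_scale:
  fixes L :: "'a::real_normed_vector \<Rightarrow>\<^sub>L 'b::real_normed_vector"
  assumes F: "blinfun_apply L ` cball 0 1 \<subseteq> (\<Union>y\<in>F. cball y t)" and "0 \<le> c"
  shows "blinfun_apply L ` cball 0 c \<subseteq> (\<Union>y\<in>(\<lambda>y. c *\<^sub>R y) ` F. cball y (c * t))"
proof (cases "c = 0")
  case True
  have "F \<noteq> {}" using F by force
  then show ?thesis using True by (auto simp: blinfun.zero_right)
next
  case False
  then have c: "c > 0" using assms by simp
  show ?thesis
  proof clarsimp
    fix x :: 'a assume "norm x \<le> c"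
    then have "norm (x /\<^sub>R c) \<le> 1" using c by (simp add: divide_simps)
    then obtain y where y: "y \<in> F" "norm (y - blinfun_apply L (x /\<^sub>R c)) \<le> t"
      using F by (force simp: dist_norm)
    have "c *\<^sub>R y - blinfun_apply L x = c *\<^sub>R (y - blinfun_apply L (x /\<^sub>R c))"
      using c by (simp add: blinfun.scaleR_right algebra_simps)
    then have "dist (c *\<^sub>R y) (blinfun_apply L x) \<le> c * t"
      using c y by (simp add: dist_norm)
    then show "\<exists>y\<in>F. dist (c *\<^sub>R y) (blinfun_apply L x) \<le> c * t" using y by blast
  qed
qed

text \<open>If \<open>M\<close> maps the unit ball into balls of radius m about the points y, and
  \<open>L\<close> maps it into balls of radius l about the points z, then
  \<open>L o\<^sub>L M\<close> maps it into balls of radius l m about the points L y + m z.\<close>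

lemma norm_chi_compose: "norm_chi (L o\<^sub>L M) \<le> norm_chi L * norm_chi M"
proof -
  have main: "norm_chi (L o\<^sub>L M) \<le> (norm_chi L + e) * (norm_chi M + e)" if e: "0 < e" for e
  proof -
    define l where "l = norm_chi L + e"
    define m where "m = norm_chi M + e"
    obtain F where F: "finite F" "blinfun_apply M ` cball 0 1 \<subseteq> (\<Union>y\<in>F. cball y m)" and m: "0 < m"
      using norm_chi_lessD[of M m] e unfolding m_def by force
    obtain G where G: "finite G" "blinfun_apply L ` cball 0 1 \<subseteq> (\<Union>y\<in>G. cball y l)" and l: "0 < l"
      using norm_chi_lessD[of L l] e unfolding l_def by force
    define H where "H = (\<lambda>(y, z). blinfun_apply L y + m *\<^sub>R z) ` (F \<times> G)"
    have "blinfun_apply (L o\<^sub>L M) ` cball 0 1 \<subseteq> (\<Union>y\<in>H. cball y (l * m))"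
    proof clarsimp
      fix x :: 'a assume "norm x \<le> 1"
      then obtain y where y: "y \<in> F" "norm (y - blinfun_apply M x) \<le> m" using F by (force simp: dist_norm)
      then have "blinfun_apply M x - y \<in> cball 0 m" by (simp add: norm_minus_commute)
      then obtain z where z: "z \<in> G" "norm (m *\<^sub>R z - blinfun_apply L (blinfun_apply M x - y)) \<le> m * l"
        using net_scale[OF G(2), of m] m by (fastforce simp: dist_norm subset_eq)
      have "dist (blinfun_apply L y + m *\<^sub>R z) (blinfun_apply L (blinfun_apply M x)) \<le> l * m"
        using z by (simp add: dist_norm blinfun.diff_right algebra_simps)
      then show "\<exists>y\<in>H. dist y (blinfun_apply L (blinfun_apply M x)) \<le> l * m"
        using y z unfolding H_def by force
    qed
    then show ?thesis
      unfolding l_def[symmetric] m_def[symmetric] using F G l m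
      by (intro norm_chi_le[of _ H]) (auto simp: H_def)
  qed
  have "((\<lambda>e. (norm_chi L + e) * (norm_chi M + e)) \<longlongrightarrow> (norm_chi L + 0) * (norm_chi M + 0)) (at_right 0)"
    by (intro tendsto_intros)
  then have "norm_chi (L o\<^sub>L M) \<le> (norm_chi L + 0) * (norm_chi M + 0)"
    by (rule tendsto_lowerbound) (use main in \<open>auto simp: eventually_at_filter\<close>)
  then show ?thesis by simp
qed

section \<open>Uniform nets for precompact sets of operators\<close>

lemma compact_op_products: "compact K \<Longrightarrow> compact (op_products K n)"
proof (induction n)
  case (Suc n)
  have "op_products K (Suc n) = (\<lambda>(L, M). L o\<^sub>L M) ` (K \<times> op_products K n)"
    by auto
  moreover have "continuous_on (K \<times> op_products K n) (\<lambda>(L, M). L o\<^sub>L M)"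
    unfolding split_beta by (intro bounded_bilinear.continuous_on[OF bounded_bilinear_blinfun_compose] continuous_intros)
  ultimately show ?case
    using Suc by (auto intro!: compact_continuous_image compact_Times)
qed simp

lemma op_products_mono: "A \<subseteq> B \<Longrightarrow> op_products A n \<subseteq> op_products B n"
  by (induction n) auto

lemma precompact_op_products: "compact (closure A) \<Longrightarrow> compact (closure (op_products A n))"
  by (metis closure_minimal closure_subset compact_Int_closed compact_imp_closed
      compact_op_products inf.absorb_iff2 op_products_mono closed_closure)

text \<open>Turns precompactness into a net common to all operators: cover by balls of radius
  \<open>u - t\<close> with finitely many centres in \<open>S\<close>, where the bound on
  \<open>norm_chi\<close> is available, and unite the nets of the centres.\<close>

lemma precompact_uniform_net:
  fixes S :: "('a::real_normed_vector \<Rightarrow>\<^sub>L 'a) set"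
  assumes S: "compact (closure S)" and chi: "\<And>L. L \<in> S \<Longrightarrow> norm_chi L < t" and "t < u"
  obtains F where "finite F" "\<And>L. L \<in> S \<Longrightarrow> blinfun_apply L ` cball 0 1 \<subseteq> (\<Union>y\<in>F. cball y u)"
proof -
  have "closure S \<subseteq> (\<Union>L\<in>S. ball L (u - t))"
  proof
    fix M assume "M \<in> closure S"
    then obtain L where "L \<in> S" "dist L M < u - t"
      using closure_approachable \<open>t < u\<close> by (metis diff_gt_0_iff_gt)
    then show "M \<in> (\<Union>L\<in>S. ball L (u - t))" by auto
  qed
  then obtain C where C: "C \<subseteq> S" "finite C" "closure S \<subseteq> (\<Union>L\<in>C. ball L (u - t))"
    using compactE_image[OF S, of S "\<lambda>L. ball L (u - t)"] by auto
  have "\<exists>F. finite F \<and> blinfun_apply L ` cball 0 1 \<subseteq> (\<Union>y\<in>F. cball y t)" if "L \<in> S" for L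
    using chi[OF that] norm_chi_lessD by metis
  then obtain N where N: "\<And>L. L \<in> S \<Longrightarrow> finite (N L)"
      "\<And>L. L \<in> S \<Longrightarrow> blinfun_apply L ` cball 0 1 \<subseteq> (\<Union>y\<in>N L. cball y t)"
    by metis
  show ?thesis
  proof (rule that)
    show "finite (\<Union>(N ` C))" using C N by auto
    fix L assume "L \<in> S"
    then have "L \<in> (\<Union>M\<in>C. ball M (u - t))"
      using C(3) closure_subset[of S] by blast
    then obtain M where M: "M \<in> C" "dist M L < u - t" by auto
    show "blinfun_apply L ` cball 0 1 \<subseteq> (\<Union>y\<in>\<Union>(N ` C). cball y u)"
    proof clarsimp
      fix x :: 'a assume x: "norm x \<le> 1"
      then obtain y where y: "y \<in> N M" "dist y (blinfun_apply M x) \<le> t"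
        using N(2)[of M] M C by (fastforce simp: subset_eq)
      have "dist (blinfun_apply M x) (blinfun_apply L x) = norm (blinfun_apply (M - L) x)"
        by (simp add: dist_norm blinfun.diff_left)
      also have "\<dots> \<le> norm (M - L) * norm x" by (rule norm_blinfun)
      also have "\<dots> \<le> norm (M - L) * 1" using x by (intro mult_left_mono) auto
      finally have "dist (blinfun_apply M x) (blinfun_apply L x) \<le> u - t"
        using M by (simp add: dist_norm)
      then have "dist y (blinfun_apply L x) \<le> u" using y
        by (smt (verit) dist_triangle)
      then show "\<exists>L'\<in>C. \<exists>y\<in>N L'. dist y (blinfun_apply L x) \<le> u" using M y by blast
    qed
  qed
qed

section \<open>Volumes in normed spaces\<close>

lemma infdist_lessD:
  assumes "infdist x S < t" "S \<noteq> {}"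
  obtains w where "w \<in> S" "dist x w < t"
  using assms unfolding infdist_notempty[OF assms(2)]
  by (subst (asm) cINF_less_iff) auto

lemma infdist_subspace_add:
  fixes W :: "'a::real_normed_vector set"
  assumes "subspace W"
  shows "infdist (x + y) W \<le> infdist x W + infdist y W"
proof (rule field_le_epsilon)
  fix e :: real assume e: "0 < e"
  have ne: "W \<noteq> {}" using assms subspace_0 by blast
  obtain u where u: "u \<in> W" "dist x u < infdist x W + e/2"
    using infdist_lessD[OF _ ne, of x "infdist x W + e/2"] e by auto
  obtain v where v: "v \<in> W" "dist y v < infdist y W + e/2"
    using infdist_lessD[OF _ ne, of y "infdist y W + e/2"] e by auto
  have "infdist (x + y) W \<le> dist (x + y) (u + v)"
    using u v assms by (intro infdist_le subspace_add)
  also have "\<dots> \<le> dist x u + dist y v"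
    by (rule dist_triangle_add)
  finally show "infdist (x + y) W \<le> infdist x W + infdist y W + e" using u v by simp
qed

lemma infdist_subspace_le_norm:
  fixes W :: "'a::real_normed_vector set"
  assumes "subspace W"
  shows "infdist x W \<le> norm x"
  using infdist_le[OF subspace_0[OF assms], of x] by simp

lemma infdist_blinfun_le:
  fixes L :: "'a::real_normed_vector \<Rightarrow>\<^sub>L 'b::real_normed_vector"
  assumes "S \<noteq> {}"
  shows "infdist (blinfun_apply L x) (blinfun_apply L ` S) \<le> norm L * infdist x S"
proof (rule field_le_epsilon)
  fix e :: real assume e: "0 < e"
  have p: "norm L + 1 > 0" by (smt (verit) norm_ge_zero)
  obtain w where w: "w \<in> S" "dist x w < infdist x S + e / (norm L + 1)"
    using infdist_lessD[OF _ assms, of x "infdist x S + e / (norm L + 1)"] e p by auto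
  have "infdist (blinfun_apply L x) (blinfun_apply L ` S) \<le> dist (blinfun_apply L x) (blinfun_apply L w)"
    using w by (intro infdist_le) auto
  also have "\<dots> \<le> norm L * dist x w"
    by (simp add: dist_norm flip: blinfun.diff_right) (rule norm_blinfun)
  also have "\<dots> \<le> norm L * (infdist x S + e / (norm L + 1))"
    using w by (intro mult_left_mono) auto
  also have "\<dots> \<le> norm L * infdist x S + e"
    using e p by (simp add: field_simps)
  finally show "infdist (blinfun_apply L x) (blinfun_apply L ` S) \<le> norm L * infdist x S + e" .
qed

lemma infdist_subspace_scaleR:
  fixes W :: "'a::real_normed_vector set"
  assumes W: "subspace W"
  shows "infdist (c *\<^sub>R x) W = \<bar>c\<bar> * infdist x W"
proof -
  have le: "infdist (d *\<^sub>R y) W \<le> \<bar>d\<bar> * infdist y W" for d y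
  proof -
    have ne: "W \<noteq> {}" using assms subspace_0 by blast
    have "infdist (d *\<^sub>R y) W \<le> infdist (d *\<^sub>R y) ((\<lambda>w. d *\<^sub>R w) ` W)"
      using W ne by (intro infdist_mono) (auto simp: subspace_scale)
    also have "\<dots> = infdist (blinfun_apply (d *\<^sub>R id_blinfun) y) (blinfun_apply (d *\<^sub>R id_blinfun) ` W)"
      by (simp add: blinfun.scaleR_left)
    also have "\<dots> \<le> norm (d *\<^sub>R id_blinfun :: 'a \<Rightarrow>\<^sub>L 'a) * infdist y W"
      by (rule infdist_blinfun_le[OF ne])
    also have "\<dots> \<le> \<bar>d\<bar> * infdist y W"
      using norm_blinfun_id_le[where 'a='a] infdist_nonneg
      by (intro mult_right_mono) (auto simp: mult_left_le)
    finally show ?thesis .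
  qed
  show ?thesis
  proof (cases "c = 0")
    case True
    then show ?thesis using subspace_0[OF W] by simp
  next
    case False
    have "infdist x W \<le> \<bar>1 / c\<bar> * infdist (c *\<^sub>R x) W"
      using le[of "1 / c" "c *\<^sub>R x"] False by simp
    then have "\<bar>c\<bar> * infdist x W \<le> infdist (c *\<^sub>R x) W"
      using False by (simp add: field_simps abs_divide)
    with le[of c x] show ?thesis by simp
  qed
qed

lemma infdist_subspace_add_mem:
  fixes W :: "'a::real_normed_vector set"
  assumes W: "subspace W" and "w \<in> W"
  shows "infdist (x + w) W = infdist x W"
proof (rule antisym)
  show "infdist (x + w) W \<le> infdist x W"
    using infdist_subspace_add[OF W, of x w] assms by simp
  show "infdist x W \<le> infdist (x + w) W"
    using infdist_subspace_add[OF W, of "x + w" "-w"] subspace_neg[OF W] assms by simp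
qed

lemma infdist_span_insert_le:
  "infdist x (span (insert b S)) \<le> infdist (x - c *\<^sub>R b) (span S)" for x :: "'a::real_normed_vector"
proof -
  have "infdist x (span (insert b S)) = infdist (x - c *\<^sub>R b + c *\<^sub>R b) (span (insert b S))" by simp
  also have "\<dots> = infdist (x - c *\<^sub>R b) (span (insert b S))"
    by (rule infdist_subspace_add_mem) (auto simp: span_base span_scale)
  also have "\<dots> \<le> infdist (x - c *\<^sub>R b) (span S)"
    using span_0 by (intro infdist_mono span_mono) blast+
  finally show ?thesis .
qed

lemma infdist_span_insert_lessD:
  fixes x :: "'a::real_normed_vector"
  assumes "infdist x (span (insert b S)) < t"
  obtains c where "infdist (x - c *\<^sub>R b) (span S) < t"
proof -
  have "span (insert b S) \<noteq> {}" using span_0 by blast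
  from infdist_lessD[OF assms this] obtain w where w: "w \<in> span (insert b S)" "dist x w < t" .
  then obtain c where c: "w - c *\<^sub>R b \<in> span S" using span_breakdown_eq by blast
  have "infdist (x - c *\<^sub>R b) (span S) \<le> dist (x - c *\<^sub>R b) (w - c *\<^sub>R b)"
    using c by (rule infdist_le)
  also have "\<dots> = dist x w" by (simp add: dist_norm)
  finally show ?thesis using w by (intro that[of c]) auto
qed

text \<open>Base times height, built up from the last entry of the list. In Euclidean space this is
  the usual volume; for a general norm it depends on the order, by a factor of at most 2 per
  transposition of neighbours.\<close>

primrec flag_volume :: "'a::real_normed_vector list \<Rightarrow> real" where
  "flag_volume [] = 1"
| "flag_volume (v # vs) = infdist v (span (set vs)) * flag_volume vs"

lemma flag_volume_nonneg: "0 \<le> flag_volume vs"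
  by (induction vs) (auto simp: infdist_nonneg)

lemma span_map_blinfun: "span (set (map (blinfun_apply L) vs)) = blinfun_apply L ` span (set vs)"
  using linear_span_image[of "blinfun_apply L" "set vs"] by (simp add: bounded_linear.linear[OF blinfun.bounded_linear_right])

lemma infdist_map_le:
  "infdist (blinfun_apply L v) (span (set (map (blinfun_apply L) vs))) \<le> norm L * infdist v (span (set vs))"
  unfolding span_map_blinfun using span_0 by (intro infdist_blinfun_le) blast

lemma flag_volume_map_le: "flag_volume (map (blinfun_apply L) vs) \<le> norm L ^ length vs * flag_volume vs"
proof (induction vs)
  case (Cons v vs)
  have "flag_volume (map (blinfun_apply L) (v # vs)) \<le> (norm L * infdist v (span (set vs))) * (norm L ^ length vs * flag_volume vs)"
    using Cons infdist_map_le[of L v vs] by (auto intro!: mult_mono simp: flag_volume_nonneg infdist_nonneg)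
  then show ?case by (simp add: algebra_simps)
qed simp

text \<open>Work with the quotient seminorm \<open>p\<close>. If \<open>p a\<close> is at most twice
  the distance from \<open>a\<close> to the line of \<open>b\<close>, use
  \<open>ba \<le> p b\<close>. Otherwise a good approximation s b of \<open>a\<close> has
  \<open>p a \<le> 2 \<bar>s\<bar> p b\<close>, and dividing a - s b by s shows that a / s
  approximates \<open>b\<close> with an error smaller by the factor \<bar>s\<bar>; the two factors
  \<bar>s\<bar> cancel.\<close>

lemma flag_volume_swap: "flag_volume (b # a # vs) \<le> 2 * flag_volume (a # b # vs)"
proof -
  define S where "S = set vs"
  define p where "p x = infdist x (span S)" for x
  define ba where "ba = infdist b (span (insert a S))"
  define ab where "ab = infdist a (span (insert b S))"
  have p0: "0 \<le> p x" for x by (simp add: p_def infdist_nonneg)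
  have ba: "ba \<le> p (b - c *\<^sub>R a)" for c
    unfolding ba_def p_def by (rule infdist_span_insert_le)
  have key: "p a * ba \<le> 2 * p b * t" if t: "ab < t" for t
  proof -
    have t0: "0 < t" using t infdist_nonneg[of a "span (insert b S)"] unfolding ab_def by linarith
    obtain s where s: "p (a - s *\<^sub>R b) < t"
      using infdist_span_insert_lessD[of a b S t] t unfolding ab_def p_def by auto
    show ?thesis
    proof (cases "p a \<le> 2 * t")
      case True
      have "p a * ba \<le> (2 * t) * p b"
        using True ba[of 0] t0 p0 by (intro mult_mono) (auto simp: ba_def infdist_nonneg)
      then show ?thesis by (simp add: algebra_simps)
    next
      case False
      have "p a \<le> p (a - s *\<^sub>R b) + p (s *\<^sub>R b)"
        using infdist_subspace_add[OF subspace_span[of S], of "a - s *\<^sub>R b" "s *\<^sub>R b"] unfolding p_def by simp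
      also have "p (s *\<^sub>R b) = \<bar>s\<bar> * p b"
        unfolding p_def by (rule infdist_subspace_scaleR) simp
      finally have pa: "p a \<le> 2 * \<bar>s\<bar> * p b" using s False by simp
      have s0: "s \<noteq> 0" using pa False t0 by auto
      have "b - (1 / s) *\<^sub>R a = (- 1 / s) *\<^sub>R (a - s *\<^sub>R b)"
        using s0 by (simp add: algebra_simps)
      then have "p (b - (1 / s) *\<^sub>R a) = \<bar>- 1 / s\<bar> * p (a - s *\<^sub>R b)"
        unfolding p_def by (simp only: infdist_subspace_scaleR[OF subspace_span])
      also have "\<dots> \<le> \<bar>- 1 / s\<bar> * t" using s by (intro mult_left_mono) auto
      finally have "ba \<le> t / \<bar>s\<bar>" using ba[of "1 / s"] by simp
      then have "p a * ba \<le> (2 * \<bar>s\<bar> * p b) * (t / \<bar>s\<bar>)"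
        using pa p0 by (intro mult_mono) (auto simp: ba_def infdist_nonneg)
      then show ?thesis using s0 by simp
    qed
  qed
  have "p a * ba \<le> 2 * p b * ab"
  proof (rule tendsto_lowerbound)
    show "((\<lambda>t. 2 * p b * t) \<longlongrightarrow> 2 * p b * ab) (at_right ab)" by (intro tendsto_intros)
    show "\<forall>\<^sub>F t in at_right ab. p a * ba \<le> 2 * p b * t"
      using key by (auto simp: eventually_at_filter)
  qed simp
  then have "(p a * ba) * flag_volume vs \<le> (2 * p b * ab) * flag_volume vs"
    by (intro mult_right_mono flag_volume_nonneg)
  then show ?thesis by (simp add: p_def ab_def ba_def S_def algebra_simps)
qed

text \<open>The outer factors see the inner list only through its span.\<close>

lemma flag_volume_append_mono:
  assumes "span (set as) = span (set bs)" "flag_volume as \<le> c * flag_volume bs"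
  shows "flag_volume (xs @ as) \<le> c * flag_volume (xs @ bs)"
proof (induction xs)
  case Nil
  then show ?case using assms by simp
next
  case (Cons x xs)
  have "span (set (xs @ as)) = span (set (xs @ bs))"
    using assms(1) by (simp add: span_Un)
  then have "flag_volume ((x # xs) @ as) \<le> infdist x (span (set (xs @ bs))) * (c * flag_volume (xs @ bs))"
    using Cons by (auto intro!: mult_left_mono simp: infdist_nonneg)
  then show ?case by (simp add: algebra_simps)
qed

lemma flag_volume_move_in: "flag_volume (x # ys) \<le> 2 ^ length ys * flag_volume (ys @ [x])"
proof (induction ys)
  case (Cons y ys)
  have "flag_volume ([y] @ x # ys) \<le> 2 ^ length ys * flag_volume ([y] @ ys @ [x])"
    using Cons by (intro flag_volume_append_mono) (auto simp: insert_commute)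
  then show ?case using flag_volume_swap[of x y ys] by simp
qed simp

lemma flag_volume_move_out: "flag_volume (ys @ [x]) \<le> 2 ^ length ys * flag_volume (x # ys)"
proof (induction ys)
  case (Cons y ys)
  have "flag_volume ([y] @ ys @ [x]) \<le> 2 ^ length ys * flag_volume ([y] @ x # ys)"
    using Cons by (intro flag_volume_append_mono) (auto simp: insert_commute)
  also have "\<dots> \<le> 2 ^ length ys * (2 * flag_volume (x # y # ys))"
    using flag_volume_swap[of y x ys] by (intro mult_left_mono) auto
  finally show ?case by simp
qed simp

text \<open>The innermost vector contributes its norm, before and after applying \<open>L\<close>;
  each of the other factors grows by at most \<open>norm L\<close>.\<close>

lemma flag_volume_map_append1:
  "norm x * flag_volume (map (blinfun_apply L) (zs @ [x])) \<le> norm L ^ length zs * norm (blinfun_apply L x) * flag_volume (zs @ [x])"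
proof (induction zs)
  case (Cons z zs)
  have "norm x * flag_volume (map (blinfun_apply L) ((z # zs) @ [x]))
      = infdist (blinfun_apply L z) (span (set (map (blinfun_apply L) (zs @ [x])))) * (norm x * flag_volume (map (blinfun_apply L) (zs @ [x])))"
    by simp
  also have "\<dots> \<le> (norm L * infdist z (span (set (zs @ [x])))) * (norm L ^ length zs * norm (blinfun_apply L x) * flag_volume (zs @ [x]))"
    by (rule mult_mono[OF infdist_map_le Cons]) (auto simp: flag_volume_nonneg infdist_nonneg)
  finally show ?case by (simp add: algebra_simps)
qed simp

text \<open>Leading term of \<open>x\<close>: \<open>y\<close> is the first entry with nonzero
  coefficient, hence the entry for which \<open>x\<close> can be exchanged.\<close>

lemma in_span_list_cases:
  assumes "x \<in> span (set vs)" "x \<noteq> 0"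
  obtains xs y ys c w where "vs = xs @ y # ys" "c \<noteq> 0" "w \<in> span (set ys)" "x = c *\<^sub>R y + w"
  using assms
proof (induction vs arbitrary: thesis)
  case (Cons v vs)
  obtain c where c: "x - c *\<^sub>R v \<in> span (set vs)"
    using Cons.prems(2) span_breakdown_eq[of x v "set vs"] by auto
  show ?case
  proof (cases "c = 0")
    case False
    then show ?thesis using c by (intro Cons.prems(1)[of "[]" v vs c "x - c *\<^sub>R v"]) auto
  next
    case True
    then have "x \<in> span (set vs)" using c by simp
    then obtain xs y ys c w where "vs = xs @ y # ys" "c \<noteq> 0" "w \<in> span (set ys)" "x = c *\<^sub>R y + w"
      using Cons.IH Cons.prems(3) by blast
    then show ?thesis by (intro Cons.prems(1)[of "v # xs" y ys c w]) auto
  qed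
qed auto

text \<open>Adding a combination of later entries changes neither the distance to their span nor the
  span seen by the earlier entries; only the scaling by \<open>c\<close> is felt.\<close>

lemma flag_volume_replace:
  assumes c: "c \<noteq> 0" and w: "w \<in> span (set ys)"
  shows "flag_volume (xs @ (c *\<^sub>R y + w) # ys) = \<bar>c\<bar> * flag_volume (xs @ y # ys)"
proof -
  define x where "x = c *\<^sub>R y + w"
  have x: "x \<in> span (insert y (set ys))"
    unfolding x_def using w span_mono[of "set ys" "insert y (set ys)"]
    by (intro span_add span_scale) (auto intro: span_base)
  have "y = (1 / c) *\<^sub>R (x - w)" using c by (simp add: x_def)
  moreover have "(1 / c) *\<^sub>R (x - w) \<in> span (insert x (set ys))"
    using w span_mono[of "set ys" "insert x (set ys)"]
    by (intro span_scale span_diff) (auto intro: span_base)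
  ultimately have y: "y \<in> span (insert x (set ys))" by simp
  have sp: "span (set (x # ys)) = span (set (y # ys))"
    unfolding list.set using x y span_mono[of "set ys" "insert _ (set ys)"]
    by (intro subset_antisym span_minimal) (auto intro: span_base)
  have "infdist x (span (set ys)) = \<bar>c\<bar> * infdist y (span (set ys))"
    unfolding x_def using w by (simp add: infdist_subspace_add_mem infdist_subspace_scaleR)
  then have v: "flag_volume (x # ys) = \<bar>c\<bar> * flag_volume (y # ys)" by simp
  have "flag_volume (xs @ x # ys) \<le> \<bar>c\<bar> * flag_volume (xs @ y # ys)"
    using sp v by (intro flag_volume_append_mono) auto
  moreover have "flag_volume (xs @ y # ys) \<le> (1 / \<bar>c\<bar>) * flag_volume (xs @ x # ys)"
    using sp v c by (intro flag_volume_append_mono) auto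
  then have "\<bar>c\<bar> * flag_volume (xs @ y # ys) \<le> flag_volume (xs @ x # ys)"
    using c by (simp add: field_simps)
  ultimately show ?thesis unfolding x_def by simp
qed

text \<open>A volume ratio bounds the minimal expansion on the spanned subspace: exchange some \<open>v\<^sub>i\<close> for \<open>x\<close> and
  move \<open>x\<close> to the innermost position, each transposition costing a factor of at most 2.\<close>

lemma flag_volume_ratio_le_expansion:
  assumes x: "x \<in> span (set vs)"
  shows "norm x * flag_volume (map (blinfun_apply L) vs)
    \<le> 4 ^ length vs * norm L ^ (length vs - 1) * norm (blinfun_apply L x) * flag_volume vs"
proof (cases "x = 0")
  case True
  then show ?thesis by (simp add: flag_volume_nonneg)
next
  case False
  with x obtain xs y ys c w where vs: "vs = xs @ y # ys" and c: "c \<noteq> 0"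
    and w: "w \<in> span (set ys)" and x: "x = c *\<^sub>R y + w"
    by (rule in_span_list_cases)
  let ?L = "blinfun_apply L"
  have "?L w \<in> span (set (map ?L ys))" unfolding span_map_blinfun using w by blast
  moreover have "?L x = c *\<^sub>R ?L y + ?L w" by (simp add: x blinfun.add_right blinfun.scaleR_right)
  ultimately have 1: "flag_volume (map ?L xs @ ?L x # map ?L ys) = \<bar>c\<bar> * flag_volume (map ?L vs)"
    using c by (simp add: vs flag_volume_replace)
  have "flag_volume (map ?L xs @ ?L x # map ?L ys) \<le> 2 ^ length ys * flag_volume (map ?L xs @ map ?L ys @ [?L x])"
    using flag_volume_move_in[of "?L x" "map ?L ys"] by (intro flag_volume_append_mono) auto
  then have 2: "\<bar>c\<bar> * flag_volume (map ?L vs) \<le> 2 ^ length ys * flag_volume (map ?L ((xs @ ys) @ [x]))"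
    unfolding 1 by simp
  have "flag_volume (xs @ ys @ [x]) \<le> 2 ^ length ys * flag_volume (xs @ x # ys)"
    by (intro flag_volume_append_mono flag_volume_move_out) auto
  also have "flag_volume (xs @ x # ys) = \<bar>c\<bar> * flag_volume vs"
    unfolding x vs by (rule flag_volume_replace[OF c w])
  finally have 3: "flag_volume ((xs @ ys) @ [x]) \<le> 2 ^ length ys * (\<bar>c\<bar> * flag_volume vs)" by simp
  \<comment> \<open>The base 4 is 2 * 2: \<open>x\<close> is moved to the innermost position once on
    the side of the images and once on the side of the original vectors.\<close>
  have "\<bar>c\<bar> * (norm x * flag_volume (map ?L vs)) = norm x * (\<bar>c\<bar> * flag_volume (map ?L vs))" by simp
  also have "\<dots> \<le> norm x * (2 ^ length ys * flag_volume (map ?L ((xs @ ys) @ [x])))"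
    using 2 by (rule mult_left_mono) simp
  also have "\<dots> = 2 ^ length ys * (norm x * flag_volume (map ?L ((xs @ ys) @ [x])))" by simp
  also have "\<dots> \<le> 2 ^ length ys * (norm L ^ length (xs @ ys) * norm (?L x) * flag_volume ((xs @ ys) @ [x]))"
    by (rule mult_left_mono[OF flag_volume_map_append1]) simp
  also have "\<dots> \<le> 2 ^ length ys * (norm L ^ length (xs @ ys) * norm (?L x) * (2 ^ length ys * (\<bar>c\<bar> * flag_volume vs)))"
    using 3 by (intro mult_left_mono) auto
  also have "\<dots> = \<bar>c\<bar> * (4 ^ length ys * (norm L ^ length (xs @ ys) * norm (?L x) * flag_volume vs))"
    by (simp add: algebra_simps flip: power_mult_distrib)
  finally have "norm x * flag_volume (map ?L vs) \<le> 4 ^ length ys * (norm L ^ length (xs @ ys) * norm (?L x) * flag_volume vs)"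
    using c by simp
  also have "\<dots> \<le> 4 ^ length vs * (norm L ^ length (xs @ ys) * norm (?L x) * flag_volume vs)"
    by (intro mult_right_mono power_increasing) (auto simp: vs flag_volume_nonneg)
  finally show ?thesis by (simp add: vs algebra_simps)
qed

text \<open>Rescale the successive differences to the unit ball. If the image of one of them falls into a ball of
  the net already visited, its distance to the previous images is small; so all but \<open>card F\<close> of the factors
  of the volume contract.\<close>

lemma flag_volume_map_le_net:
  fixes L :: "'a::real_normed_vector \<Rightarrow>\<^sub>L 'a"
  assumes net: "blinfun_apply L ` cball 0 1 \<subseteq> (\<Union>y\<in>F. cball y (1/8))" and F: "finite F"
    and M: "norm L \<le> M" "1 \<le> M"
  shows "flag_volume (map (blinfun_apply L) vs) \<le> (2 * M) ^ card F * (1/2) ^ length vs * flag_volume vs"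
proof -
  let ?L = "blinfun_apply L"
  \<comment> \<open>\<open>G\<close> is the set of net points visited so far, each recorded with a
    point of the span whose image is near it. A vector that visits a new net point has its factor
    bounded by \<open>M\<close> only, all others contract by 1/2; so each member of \<open>G\<close>
    costs 2 M compared with full contraction.\<close>
  have "\<exists>G\<subseteq>F. flag_volume (map ?L vs) * (1/2) ^ card G \<le> M ^ card G * (1/2) ^ length vs * flag_volume vs
      \<and> (\<forall>y\<in>G. \<exists>u\<in>span (set vs). dist y (?L u) \<le> 1/8)"
  proof (induction vs)
    case Nil
    show ?case by (rule exI[of _ "{}"]) auto
  next
    case (Cons v vs)
    then obtain G where G: "G \<subseteq> F"
      "flag_volume (map ?L vs) * (1/2) ^ card G \<le> M ^ card G * (1/2) ^ length vs * flag_volume vs"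
      "\<And>y. y \<in> G \<Longrightarrow> \<exists>u\<in>span (set vs). dist y (?L u) \<le> 1/8" by blast
    define d where "d = infdist v (span (set vs))"
    define d' where "d' = infdist (?L v) (span (set (map ?L vs)))"
    have d: "0 \<le> d" "0 \<le> d'" by (auto simp: d_def d'_def infdist_nonneg)
    have "d' \<le> norm L * d" unfolding d_def d'_def by (rule infdist_map_le)
    then have dM: "d' \<le> M * d" using M d by (meson mult_right_mono order_trans)
    have mono: "span (set vs) \<subseteq> span (set (v # vs))" by (intro span_mono) auto
    have step: ?case if "d' \<le> d / 2"
    proof (intro exI[of _ G] conjI)
      have "flag_volume (map ?L (v # vs)) * (1/2) ^ card G = d' * (flag_volume (map ?L vs) * (1/2) ^ card G)"
        by (simp add: d'_def)
      also have "\<dots> \<le> d / 2 * (M ^ card G * (1/2) ^ length vs * flag_volume vs)"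
        by (rule mult_mono[OF that G(2)]) (use d in \<open>auto simp: flag_volume_nonneg\<close>)
      finally show "flag_volume (map ?L (v # vs)) * (1/2) ^ card G \<le> M ^ card G * (1/2) ^ length (v # vs) * flag_volume (v # vs)"
        by (simp add: d_def mult_ac)
    qed (use G mono in blast)+
    show ?case
    proof (cases "d = 0")
      case True
      then show ?thesis using dM d by (intro step) auto
    next
      case False
      have "span (set vs) \<noteq> {}" using span_0 by blast
      then obtain w where w: "w \<in> span (set vs)" "dist v w < 2 * d"
        using infdist_lessD[of v "span (set vs)" "2 * d"] False d unfolding d_def by auto
      \<comment> \<open>The slack 2 in \<open>2 * d\<close> makes up for the infimum. Two points in
        the same ball of radius 1/8 are at distance at most 1/4, so a repeated visit gives
        \<open>d' \<le> 2 * d / 4\<close>.\<close>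
      define u where "u = (1 / (2 * d)) *\<^sub>R (v - w)"
      have "norm u \<le> 1" using w False d by (simp add: u_def dist_norm)
      then obtain y where y: "y \<in> F" "dist y (?L u) \<le> 1/8" using net by force
      show ?thesis
      proof (cases "y \<in> G")
        case True
        then obtain u' where u': "u' \<in> span (set vs)" "dist y (?L u') \<le> 1/8" using G by blast
        let ?W = "span (set (map ?L vs))"
        have mem: "?L z \<in> ?W" if "z \<in> span (set vs)" for z unfolding span_map_blinfun using that by blast
        have "v = (2 * d) *\<^sub>R u + w" using False by (simp add: u_def)
        then have "?L v = (2 * d) *\<^sub>R ?L u + ?L w" by (simp add: blinfun.add_right blinfun.scaleR_right)
        then have "d' = 2 * d * infdist (?L u) ?W"
          unfolding d'_def using d mem[OF w(1)] by (simp add: infdist_subspace_add_mem infdist_subspace_scaleR)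
        moreover have "infdist (?L u) ?W \<le> 1/4"
          using infdist_le[OF mem[OF u'(1)], of "?L u"] y u' dist_triangle3[of "?L u" "?L u'" y] by linarith
        then have "2 * d * infdist (?L u) ?W \<le> 2 * d * (1/4)" using d by (intro mult_left_mono) auto
        ultimately show ?thesis by (intro step) simp
      next
        case False
        have fin: "finite G" using G F finite_subset by blast
        have "flag_volume (map ?L (v # vs)) * (1/2) ^ card (insert y G) = d' * (flag_volume (map ?L vs) * (1/2) ^ card G) * (1/2)"
          using fin False by (simp add: d'_def)
        also have "\<dots> \<le> M * d * (M ^ card G * (1/2) ^ length vs * flag_volume vs) * (1/2)"
          by (rule mult_right_mono[OF mult_mono[OF dM G(2)]]) (use d M in \<open>auto simp: flag_volume_nonneg\<close>)
        finally have "flag_volume (map ?L (v # vs)) * (1/2) ^ card (insert y G)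
            \<le> M ^ card (insert y G) * (1/2) ^ length (v # vs) * flag_volume (v # vs)"
          using fin False by (simp add: d_def algebra_simps)
        moreover have "u \<in> span (set (v # vs))"
          unfolding u_def using w mono by (intro span_scale span_diff) (auto intro: span_base)
        moreover from this have "\<forall>y'\<in>insert y G. \<exists>u\<in>span (set (v # vs)). dist y' (?L u) \<le> 1/8"
          using y(2) G(3) mono by (metis insert_iff subsetD)
        ultimately show ?thesis
          using y(1) G(1) by (intro exI[of _ "insert y G"]) blast
      qed
    qed
  qed
  then obtain G where G: "G \<subseteq> F"
      "flag_volume (map ?L vs) * (1/2) ^ card G \<le> M ^ card G * (1/2) ^ length vs * flag_volume vs" by blast
  have "flag_volume (map ?L vs) = 2 ^ card G * (flag_volume (map ?L vs) * (1/2) ^ card G)"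
    by (simp add: power_divide)
  also have "\<dots> \<le> 2 ^ card G * (M ^ card G * (1/2) ^ length vs * flag_volume vs)"
    using G by (intro mult_left_mono) auto
  also have "\<dots> = (2 * M) ^ card G * ((1/2) ^ length vs * flag_volume vs)" by (simp add: power_mult_distrib)
  also have "\<dots> \<le> (2 * M) ^ card F * ((1/2) ^ length vs * flag_volume vs)"
    using M card_mono[OF F G(1)] by (intro mult_right_mono power_increasing) (auto simp: flag_volume_nonneg)
  finally show ?thesis by simp
qed

section \<open>Hyperbolic times and dominated splittings\<close>

text \<open>With \<open>h p = b p + \<tau> p\<close>, the times counted are those where
  \<open>h\<close> is minimal on all of \<open>{p..R}\<close>. Going back from \<open>R\<close>, the
  running minimum of \<open>h\<close> drops only at such times, each time by at most
  \<open>\<sigma> + \<tau>\<close> because \<open>h\<close> rises by no more than that in one step;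
  the total drop is at least \<open>h R - h 0\<close>.\<close>

lemma record_times_card:
  fixes b :: "nat \<Rightarrow> real" and \<sigma> \<tau> :: real
  assumes inc: "\<And>p. p < R \<Longrightarrow> b (Suc p) - b p \<le> \<sigma>" and pos: "0 \<le> \<sigma>" "0 \<le> \<tau>"
  shows "\<tau> * R + (b R - b 0)
    \<le> (\<sigma> + \<tau>) * card {p. p \<le> R \<and> (\<forall>p'\<in>{p..R}. b p - \<tau> * real (p' - p) \<le> b p')}"
proof -
  define h where "h p = b p + \<tau> * real p" for p
  define G where "G p = {i. p \<le> i \<and> i \<le> R \<and> (\<forall>j\<in>{i..R}. h i \<le> h j)}" for p
  have fin: "finite (G p)" for p unfolding G_def by (rule finite_subset[of _ "{..R}"]) auto
  have hinc: "h (Suc p) \<le> h p + (\<sigma> + \<tau>)" if "p < R" for p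
    using inc[OF that] by (simp add: h_def algebra_simps)
  have claim: "\<exists>m\<in>{R - k..R}. (\<forall>j\<in>{R - k..R}. h m \<le> h j) \<and> h R - h m \<le> (\<sigma> + \<tau>) * card (G (R - k))"
    if "k \<le> R" for k using that
  proof (induction k)
    case 0
    then show ?case using pos by auto
  next
    case (Suc k)
    define p where "p = R - Suc k"
    have p: "p < R" "R - k = Suc p" using Suc.prems by (auto simp: p_def)
    obtain m where m: "m \<in> {Suc p..R}" "\<And>j. j \<in> {Suc p..R} \<Longrightarrow> h m \<le> h j"
        "h R - h m \<le> (\<sigma> + \<tau>) * card (G (Suc p))"
      using Suc p by auto
    have sub: "G (Suc p) \<subseteq> G p" unfolding G_def by auto
    show ?case
    proof (cases "h p \<le> h m")
      case True
      have all: "h p \<le> h j" if "j \<in> {p..R}" for j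
        using that True m(2)[of j] by (cases "j = p") fastforce+
      then have "p \<in> G p" using p unfolding G_def by auto
      moreover have "p \<notin> G (Suc p)" unfolding G_def by auto
      ultimately have "card (insert p (G (Suc p))) \<le> card (G p)"
        using sub fin by (intro card_mono) auto
      then have "real (card (G (Suc p))) + 1 \<le> card (G p)"
        using \<open>p \<notin> G (Suc p)\<close> fin by simp
      then have "(\<sigma> + \<tau>) * (real (card (G (Suc p))) + 1) \<le> (\<sigma> + \<tau>) * card (G p)"
        using pos by (intro mult_left_mono) auto
      moreover have "h m \<le> h p + (\<sigma> + \<tau>)"
        using m(2)[of "Suc p"] hinc[OF p(1)] p by auto
      ultimately have "h R - h p \<le> (\<sigma> + \<tau>) * card (G p)"
        using m(3) by (simp add: algebra_simps)
      then show ?thesis unfolding p_def[symmetric] using all p by (intro bexI[of _ p]) auto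
    next
      case False
      have "h m \<le> h j" if "j \<in> {p..R}" for j
        using that False m(2)[of j] by (cases "j = p") fastforce+
      moreover have "(\<sigma> + \<tau>) * card (G (Suc p)) \<le> (\<sigma> + \<tau>) * card (G p)"
        using pos card_mono[OF fin sub] by (intro mult_left_mono) auto
      ultimately show ?thesis unfolding p_def[symmetric] using m p by (intro bexI[of _ m]) auto
    qed
  qed
  obtain m where m: "\<forall>j\<in>{0..R}. h m \<le> h j" "h R - h m \<le> (\<sigma> + \<tau>) * card (G 0)"
    using claim[of R] by auto
  have "h R - h 0 \<le> (\<sigma> + \<tau>) * card (G 0)"
    using m by (meson atLeastAtMost_iff diff_left_mono le0 order_trans)
  moreover have "G 0 = {p. p \<le> R \<and> (\<forall>p'\<in>{p..R}. b p - \<tau> * real (p' - p) \<le> b p')}"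
    unfolding G_def h_def by (auto simp: of_nat_diff algebra_simps)
  ultimately show ?thesis by (simp add: h_def)
qed

text \<open>A version of the Pliss lemma.\<close>

lemma hyperbolic_times:
  fixes b :: "nat \<Rightarrow> real"
  assumes inc: "\<And>p. p < R \<Longrightarrow> b (Suc p) - b p \<le> \<sigma>" and tot: "- c \<le> b R - b 0" and \<sigma>: "0 < \<sigma>"
    and R: "5 * real N + 5 + 2 * c / \<sigma> < 3 * real R"
  shows "N < card {i. i \<le> R \<and> (\<forall>j\<in>{i..R}. b i - 4 * \<sigma> * real (j - i) \<le> b j)
    \<and> (\<forall>j\<le>i. b j - 4 * \<sigma> * real (i - j) \<le> b i)}"
proof -
  define F where "F = {i. i \<le> R \<and> (\<forall>j\<in>{i..R}. b i - 4 * \<sigma> * real (j - i) \<le> b j)}"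
  define B where "B = {i. i \<le> R \<and> (\<forall>j\<le>i. b j - 4 * \<sigma> * real (i - j) \<le> b i)}"
  \<comment> \<open>Reversing time and sign preserves the bound on the increments and turns the
    backward condition into the forward one.\<close>
  define b' where "b' p = - b (R - p)" for p
  have F: "4 * \<sigma> * R - c \<le> (5 * \<sigma>) * card F"
    using record_times_card[where R = R and b = b and \<sigma> = \<sigma> and \<tau> = "4 * \<sigma>"] inc \<sigma> tot unfolding F_def by simp
  define B' where "B' = {p. p \<le> R \<and> (\<forall>p'\<in>{p..R}. b' p - 4 * \<sigma> * real (p' - p) \<le> b' p')}"
  have "b' (Suc p) - b' p \<le> \<sigma>" if "p < R" for p
    using inc[of "R - Suc p"] that by (simp add: b'_def Suc_diff_Suc)
  then have B': "4 * \<sigma> * R - c \<le> (5 * \<sigma>) * card B'"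
    using record_times_card[where R = R and b = b' and \<sigma> = \<sigma> and \<tau> = "4 * \<sigma>"] \<sigma> tot unfolding B'_def by (simp add: b'_def)
  have "B' \<subseteq> (\<lambda>i. R - i) ` B"
  proof
    fix p assume p: "p \<in> B'"
    have "b j - 4 * \<sigma> * real (R - p - j) \<le> b (R - p)" if j: "j \<le> R - p" for j
    proof -
      have "R - j \<in> {p..R}" using j p by (auto simp: B'_def)
      then have "b' p - 4 * \<sigma> * real (R - j - p) \<le> b' (R - j)" using p unfolding B'_def by blast
      moreover have "R - (R - j) = j" using j by auto
      moreover have "R - j - p = R - p - j" by simp
      ultimately show ?thesis by (simp add: b'_def)
    qed
    moreover have "R - p \<le> R" by simp
    ultimately have "R - p \<in> B" unfolding B_def by blast
    moreover have "p = R - (R - p)" using p by (auto simp: B'_def)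
    ultimately show "p \<in> (\<lambda>i. R - i) ` B" by blast
  qed
  moreover have finB: "finite B" unfolding B_def by auto
  ultimately have "card B' \<le> card B" by (meson card_image_le card_mono finite_imageI order_trans)
  then have "(5 * \<sigma>) * real (card B') \<le> (5 * \<sigma>) * card B" using \<sigma> by (intro mult_left_mono) auto
  with B' have B: "4 * \<sigma> * R - c \<le> (5 * \<sigma>) * card B" by linarith
  have finF: "finite F" unfolding F_def by auto
  \<comment> \<open>Each of the two sets has at least 4 R / 5 - c / (5 \<sigma>) elements among
    \<open>Suc R\<close> times, so at least 3 R / 5 - 1 - 2 c / (5 \<sigma>) times are common to
    both. The hypothesis on \<open>R\<close> says that this exceeds \<open>N\<close>.\<close>
  have "card F + card B = card (F \<union> B) + card (F \<inter> B)" by (rule card_Un_Int[OF finF finB])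
  moreover have "card (F \<union> B) \<le> card {..R}" by (intro card_mono) (auto simp: F_def B_def)
  ultimately have "card F + card B \<le> Suc R + card (F \<inter> B)" by simp
  then have "real (card F) + card B \<le> real R + 1 + card (F \<inter> B)" by linarith
  then have "(5 * \<sigma>) * (real (card F) + card B) \<le> (5 * \<sigma>) * (real R + 1 + card (F \<inter> B))"
    using \<sigma> by (intro mult_left_mono) auto
  with F B have "8 * \<sigma> * R - 2 * c \<le> (5 * \<sigma>) * (real R + 1 + card (F \<inter> B))"
    by (simp add: algebra_simps)
  then have "3 * real R - 2 * c / \<sigma> \<le> 5 * (1 + real (card (F \<inter> B)))"
    using \<sigma> by (simp add: field_simps)
  then have "real N < card (F \<inter> B)" using R by simp
  moreover have "F \<inter> B = {i. i \<le> R \<and> (\<forall>j\<in>{i..R}. b i - 4 * \<sigma> * real (j - i) \<le> b j)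
      \<and> (\<forall>j\<le>i. b j - 4 * \<sigma> * real (i - j) \<le> b i)}" unfolding F_def B_def by auto
  ultimately show ?thesis by simp
qed

text \<open>Some fibre of \<open>f\<close> has more than \<open>l\<close> elements; its minimum and
  maximum are then at least \<open>l\<close> apart.\<close>

lemma pigeonhole_spread:
  fixes G :: "nat set"
  assumes G: "finite G" "l * card C < card G" and C: "finite C" "f ` G \<subseteq> C"
  obtains i j where "i \<in> G" "j \<in> G" "i + l \<le> j" "f i = f j"
proof -
  have "\<exists>c\<in>C. l < card {i \<in> G. f i = c}"
  proof (rule ccontr)
    assume "\<not> ?thesis"
    then have le: "card {i \<in> G. f i = c} \<le> l" if "c \<in> C" for c using that by force
    have "G = (\<Union>c\<in>C. {i \<in> G. f i = c})" using C by auto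
    then have "card G \<le> (\<Sum>c\<in>C. card {i \<in> G. f i = c})"
      using card_UN_le[OF C(1), of "\<lambda>c. {i \<in> G. f i = c}"] by simp
    also have "\<dots> \<le> card C * l" using sum_bounded_above[of C _ l] le by simp
    finally show False using G by (simp add: mult.commute)
  qed
  then obtain c where c: "l < card {i \<in> G. f i = c}" by blast
  define H where "H = {i \<in> G. f i = c}"
  have cH: "l < card H" using c unfolding H_def .
  have "H \<noteq> {}" using cH by auto
  moreover have "finite H" using G(1) by (simp add: H_def)
  ultimately have H: "finite H" "H \<noteq> {}" by auto
  have "H \<subseteq> {Min H..Max H}" using H by auto
  then have "card H \<le> card {Min H..Max H}" by (intro card_mono) auto
  then have "Min H + l \<le> Max H" using cH by simp
  moreover have "Min H \<in> H" "Max H \<in> H" using H by auto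
  ultimately show ?thesis by (intro that[of "Min H" "Max H"]) (auto simp: H_def)
qed

text \<open>The vectors contracted by \<open>S l\<close> are complementary to \<open>E\<close> with a bound \<open>K\<close> on the angle that does not
  depend on \<open>l\<close>: the \<open>E\<close>-components obtained for successive \<open>l\<close> differ by a geometric series.\<close>

lemma dominated_splitting:
  fixes S :: "nat \<Rightarrow> ('a::real_normed_vector \<Rightarrow>\<^sub>L 'a)"
  assumes E: "subspace E"
    and S0: "S 0 = id_blinfun" and SSuc: "\<And>l. S (Suc l) = s l o\<^sub>L S l"
    and sM: "\<And>l. norm (s l) \<le> M" "0 \<le> M"
    and exp: "\<And>l x. l \<le> n \<Longrightarrow> x \<in> E \<Longrightarrow> \<kappa> * \<alpha> ^ l * norm x \<le> norm (blinfun_apply (S l) x)"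
    and quot: "\<And>l x. l \<le> n \<Longrightarrow>
      infdist (blinfun_apply (S l) x) (blinfun_apply (S l) ` E) \<le> C * \<beta> ^ l * norm x"
    and pos: "0 < \<kappa>" "0 < \<beta>" "\<beta> < \<alpha>" "\<beta> \<le> 1" "1 \<le> C"
    and K: "2 * C * (M + 1) / (\<kappa> * (\<alpha> - \<beta>)) \<le> K" and l: "l \<le> n"
  shows "\<exists>e\<in>E. norm e \<le> K * norm x \<and> norm (blinfun_apply (S l) (x - e)) \<le> 2 * C * \<beta> ^ l * norm x"
proof (cases "x = 0")
  case True
  then show ?thesis using subspace_0[OF E] by (intro bexI[of _ 0]) auto
next
  case False
  define D where "D = 2 * C * (M + 1) / (\<kappa> * \<alpha>)"
  have D: "0 \<le> D" unfolding D_def using pos sM by auto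
  have ratio: "0 < \<beta> / \<alpha>" "\<beta> / \<alpha> < 1" using pos by auto
  have "\<exists>e\<in>E. norm e \<le> D * (\<Sum>k<l. (\<beta> / \<alpha>) ^ k) * norm x
      \<and> norm (blinfun_apply (S l) (x - e)) \<le> 2 * C * \<beta> ^ l * norm x"
    using l
  proof (induction l)
    case 0
    have "1 * norm x \<le> 2 * C * norm x" using pos by (intro mult_right_mono) auto
    then show ?case using subspace_0[OF E] S0 by (intro bexI[of _ 0]) auto
  next
    case (Suc l)
    then obtain e where e: "e \<in> E" "norm e \<le> D * (\<Sum>k<l. (\<beta> / \<alpha>) ^ k) * norm x"
        "norm (blinfun_apply (S l) (x - e)) \<le> 2 * C * \<beta> ^ l * norm x" by auto
    let ?T = "blinfun_apply (S (Suc l))"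
    \<comment> \<open>The factor 2 leaves room for an infimum that is not attained; the strict
      inequality is why \<open>x = 0\<close> was split off.\<close>
    have "C * \<beta> ^ Suc l * norm x < 2 * C * \<beta> ^ Suc l * norm x"
      using pos False by simp
    then have "infdist (?T x) (?T ` E) < 2 * C * \<beta> ^ Suc l * norm x"
      using quot[OF Suc.prems, of x] by linarith
    then obtain e' where e': "e' \<in> E" "dist (?T x) (?T e') < 2 * C * \<beta> ^ Suc l * norm x"
      using infdist_lessD[of "?T x" "?T ` E"] e(1) by blast
    have T1: "norm (?T (x - e')) \<le> 2 * C * \<beta> ^ Suc l * norm x"
      using e'(2) by (simp add: dist_norm blinfun.diff_right)
    have "norm (?T (x - e)) \<le> norm (s l) * norm (blinfun_apply (S l) (x - e))"
      by (simp add: SSuc norm_blinfun)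
    also have "\<dots> \<le> M * (2 * C * \<beta> ^ l * norm x)"
      using sM e(3) by (intro mult_mono) auto
    finally have T2: "norm (?T (x - e)) \<le> M * (2 * C * \<beta> ^ l * norm x)" .
    \<comment> \<open>Both \<open>x - e\<close> and \<open>x - e'\<close> have small images under
      \<open>?T\<close>, while \<open>?T\<close> expands vectors of \<open>E\<close> at rate
      \<open>\<alpha>\<close>. Hence the correction \<open>e' - e\<close> is of order (\<beta> /
      \<alpha>)^l.\<close>
    have "?T (e' - e) = ?T (x - e) - ?T (x - e')" by (simp add: blinfun.diff_right)
    then have "norm (?T (e' - e)) \<le> norm (?T (x - e)) + norm (?T (x - e'))"
      by (simp add: norm_triangle_ineq4)
    also have "\<dots> \<le> M * (2 * C * \<beta> ^ l * norm x) + 2 * C * \<beta> ^ Suc l * norm x" using T1 T2 by linarith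
    also have "\<dots> = 2 * C * (M + \<beta>) * \<beta> ^ l * norm x" by (simp add: algebra_simps)
    also have "\<dots> \<le> 2 * C * (M + 1) * \<beta> ^ l * norm x"
      using pos by (intro mult_right_mono mult_left_mono) auto
    finally have "\<kappa> * \<alpha> ^ Suc l * norm (e' - e) \<le> 2 * C * (M + 1) * \<beta> ^ l * norm x"
      using exp[OF Suc.prems, of "e' - e"] e(1) e'(1) subspace_diff[OF E] by (meson order_trans)
    then have "norm (e' - e) \<le> 2 * C * (M + 1) * \<beta> ^ l * norm x / (\<kappa> * \<alpha> ^ Suc l)"
      using pos by (simp add: field_simps)
    also have "\<dots> = D * (\<beta> / \<alpha>) ^ l * norm x"
      by (simp add: D_def power_divide)
    finally have "norm e' \<le> norm e + D * (\<beta> / \<alpha>) ^ l * norm x"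
      using norm_triangle_sub[of e' e] by linarith
    also have "\<dots> \<le> D * (\<Sum>k<Suc l. (\<beta> / \<alpha>) ^ k) * norm x"
      using e(2) by (simp add: algebra_simps)
    finally show ?case using e' T1 by blast
  qed
  then obtain e where e: "e \<in> E" "norm e \<le> D * (\<Sum>k<l. (\<beta> / \<alpha>) ^ k) * norm x"
      "norm (blinfun_apply (S l) (x - e)) \<le> 2 * C * \<beta> ^ l * norm x" by blast
  have "(\<Sum>k<l. (\<beta> / \<alpha>) ^ k) \<le> (\<Sum>k. (\<beta> / \<alpha>) ^ k)"
    using ratio by (intro sum_le_suminf summable_geometric) auto
  also have "\<dots> = 1 / (1 - \<beta> / \<alpha>)" using ratio by (intro suminf_geometric) auto
  finally have "D * (\<Sum>k<l. (\<beta> / \<alpha>) ^ k) \<le> D * (1 / (1 - \<beta> / \<alpha>))"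
    using D by (rule mult_left_mono)
  also have "\<dots> = 2 * C * (M + 1) / (\<kappa> * (\<alpha> - \<beta>))"
    using pos by (simp add: D_def field_simps)
  also note K
  finally have "D * (\<Sum>k<l. (\<beta> / \<alpha>) ^ k) * norm x \<le> K * norm x"
    by (rule mult_right_mono) simp
  then show ?thesis using e by (intro bexI[of _ e]) auto
qed

text \<open>The orbit of \<open>z0\<close> keeps the form z + f with z in \<open>E\<close> and f at
  most half as long as z. Besides, the invariant bounds the image \<open>B f\<close> rather than f
  alone: no invariant complement exists, so the deviation from \<open>E\<close> is split afresh at
  every step, its part along \<open>E\<close> being added to z and the rest being contracted at the
  next step.\<close>

lemma spec_radius_ge_cone:
  fixes B :: "'a::real_normed_vector \<Rightarrow>\<^sub>L 'a"
  assumes E: "subspace E" "z0 \<in> E" "z0 \<noteq> 0"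
    and exp: "\<And>z. z \<in> E \<Longrightarrow> \<rho> * norm z \<le> norm (blinfun_apply B z)"
    and ret: "\<And>z. z \<in> E \<Longrightarrow> \<exists>z'\<in>E. norm (blinfun_apply B z - z') \<le> \<eta> * norm (blinfun_apply B z)"
    and split: "\<And>g. \<exists>e\<in>E. norm e \<le> K * norm g \<and> norm (blinfun_apply B (g - e)) \<le> \<theta> * norm g"
    and pos: "0 < \<rho>" "0 \<le> K" "0 \<le> \<theta>" "\<theta> \<le> \<rho> / 4" "0 \<le> \<eta>" "8 * (K + 1) * \<eta> \<le> 1"
  shows "\<rho> / 2 \<le> spec_radius B"
proof -
  let ?B = "blinfun_apply B"
  have step: "\<exists>z'\<in>E. \<exists>f'. ?B (z + f) = z' + f' \<and> norm f' \<le> norm z' / 2 \<and> norm (?B f') \<le> \<eta> * \<rho> * norm z'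
      \<and> \<rho> / 2 * norm z \<le> norm z'"
    if z: "z \<in> E" and f: "norm (?B f) \<le> \<eta> * \<rho> * norm z" for z f
  proof -
    define y where "y = ?B z"
    have y: "\<rho> * norm z \<le> norm y" using exp[OF z] by (simp add: y_def)
    obtain z1 where z1: "z1 \<in> E" "norm (y - z1) \<le> \<eta> * norm y" using ret[OF z] by (auto simp: y_def)
    define g where "g = ?B (z + f) - z1"
    obtain e where e: "e \<in> E" "norm e \<le> K * norm g" "norm (?B (g - e)) \<le> \<theta> * norm g"
      using split by blast
    have "\<eta> * (\<rho> * norm z) \<le> \<eta> * norm y" using y pos by (intro mult_left_mono) auto
    then have f: "norm (?B f) \<le> \<eta> * norm y" using f by simp
    have "g = (y - z1) + ?B f" by (simp add: g_def y_def blinfun.add_right)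
    then have g: "norm g \<le> 2 * \<eta> * norm y" using norm_triangle_ineq[of "y - z1" "?B f"] z1 f by simp
    \<comment> \<open>Together these make \<open>e\<close> and \<open>g - e\<close> at most a
      quarter of \<open>y\<close>, and \<open>z1 + e\<close> at least half of it.\<close>
    have \<eta>: "\<eta> \<le> 1/8" "K * \<eta> \<le> 1/8" "(K + 1) * \<eta> \<le> 1/8"
    proof -
      have "0 \<le> K * \<eta>" using pos by simp
      moreover have "8 * (K * \<eta>) + 8 * \<eta> \<le> 1" using pos by (simp add: algebra_simps)
      ultimately show "\<eta> \<le> 1/8" "K * \<eta> \<le> 1/8" "(K + 1) * \<eta> \<le> 1/8"
        using pos unfolding distrib_right by linarith+
    qed
    have e1: "norm e \<le> norm y / 4"
    proof -
      have "norm e \<le> K * (2 * \<eta> * norm y)" using e(2) g pos by (meson mult_left_mono order_trans)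
      also have "\<dots> = 2 * (K * \<eta>) * norm y" by simp
      also have "\<dots> \<le> 2 * (1/8) * norm y" using \<eta> by (intro mult_right_mono) auto
      finally show ?thesis by simp
    qed
    have f1: "norm (g - e) \<le> norm y / 4"
    proof -
      have "norm (g - e) \<le> norm g + norm e" by (rule norm_triangle_ineq4)
      also have "\<dots> \<le> (K + 1) * norm g" using e(2) by (simp add: algebra_simps)
      also have "\<dots> \<le> (K + 1) * (2 * \<eta> * norm y)" using g pos by (intro mult_left_mono) auto
      also have "\<dots> = 2 * ((K + 1) * \<eta>) * norm y" by simp
      also have "\<dots> \<le> 2 * (1/8) * norm y" using \<eta> by (intro mult_right_mono) auto
      finally show ?thesis by simp
    qed
    have "norm (y - z1) \<le> norm y / 8"
      using z1(2) mult_right_mono[OF \<eta>(1), of "norm y"] by simp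
    moreover have "norm z1 \<le> norm (z1 + e) + norm e" using norm_triangle_ineq4[of "z1 + e" e] by simp
    moreover have "norm y \<le> norm z1 + norm (y - z1)" using norm_triangle_ineq2[of y "y - z1"] by simp
    ultimately have z': "norm y / 2 \<le> norm (z1 + e)"
      using e1 norm_ge_zero[of y] by linarith
    \<comment> \<open>The bound \<rho> / 4 on \<open>\<theta>\<close> reproduces the invariant: one
      factor 1/2 pays for the 2 in the bound on \<open>g\<close>, the other for
      \<open>z1 + e\<close> being possibly only half as long as \<open>y\<close>.\<close>
    have "norm (?B (g - e)) \<le> \<rho> / 4 * (2 * \<eta> * norm y)"
      using e(3) g pos by (meson mult_mono norm_ge_zero order_trans)
    also have "\<dots> = \<eta> * \<rho> * (norm y / 2)" by simp
    also have "\<dots> \<le> \<eta> * \<rho> * norm (z1 + e)" using z' pos by (intro mult_left_mono) auto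
    finally have "norm (?B (g - e)) \<le> \<eta> * \<rho> * norm (z1 + e)" .
    moreover have "?B (z + f) = (z1 + e) + (g - e)" by (simp add: g_def)
    moreover have "z1 + e \<in> E" using z1 e E by (intro subspace_add)
    ultimately show ?thesis using z' y f1 by (intro bexI[of _ "z1 + e"] exI[of _ "g - e"]) auto
  qed
  have orbit: "\<exists>z\<in>E. \<exists>f. blinfun_apply (op_power B n) z0 = z + f \<and> norm f \<le> norm z / 2
      \<and> norm (?B f) \<le> \<eta> * \<rho> * norm z \<and> (\<rho> / 2) ^ n * norm z0 \<le> norm z" for n
  proof (induction n)
    case 0
    show ?case using E pos by (intro bexI[of _ z0] exI[of _ 0]) (auto simp: op_power_def)
  next
    case (Suc n)
    then obtain z f where zf: "z \<in> E" "blinfun_apply (op_power B n) z0 = z + f"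
        "norm (?B f) \<le> \<eta> * \<rho> * norm z" "(\<rho> / 2) ^ n * norm z0 \<le> norm z" by blast
    obtain z' f' where z': "z' \<in> E" "?B (z + f) = z' + f'" "norm f' \<le> norm z' / 2"
        "norm (?B f') \<le> \<eta> * \<rho> * norm z'" "\<rho> / 2 * norm z \<le> norm z'"
      using step[OF zf(1,3)] by blast
    have "\<rho> / 2 * ((\<rho> / 2) ^ n * norm z0) \<le> \<rho> / 2 * norm z" using zf pos by (intro mult_left_mono) auto
    then have "(\<rho> / 2) ^ Suc n * norm z0 \<le> norm z'" using z'(5) by simp
    moreover have "blinfun_apply (op_power B (Suc n)) z0 = z' + f'" using zf z' by (simp add: op_power_Suc)
    ultimately show ?case using z' by blast
  qed
  show ?thesis
  proof (rule spec_radius_ge[of "1/2"])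
    fix n
    obtain z f where zf: "blinfun_apply (op_power B n) z0 = z + f" "norm f \<le> norm z / 2"
        "(\<rho> / 2) ^ n * norm z0 \<le> norm z" using orbit by blast
    have "1/2 * (\<rho> / 2) ^ n * norm z0 \<le> norm (z + f)"
      using zf norm_triangle_ineq2[of z "-f"] by simp
    also have "\<dots> \<le> norm (op_power B n) * norm z0" unfolding zf(1)[symmetric] by (rule norm_blinfun)
    finally show "1/2 * (\<rho> / 2) ^ n \<le> norm (op_power B n)" using E(3) by simp
  qed (use pos in auto)
qed

text \<open>Cocycle notation: \<open>word a i l\<close> leads from time \<open>i\<close> to time
  \<open>i + l\<close>, the latest factor standing on the left. The sequence \<open>a\<close> is
  infinite to avoid index conditions; beyond a given product its values are arbitrary members of
  \<open>A\<close>.\<close>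

primrec word :: "(nat \<Rightarrow> 'a \<Rightarrow>\<^sub>L 'a) \<Rightarrow> nat \<Rightarrow> nat \<Rightarrow> ('a::real_normed_vector \<Rightarrow>\<^sub>L 'a)" where
  "word a i 0 = id_blinfun"
| "word a i (Suc l) = a (i + l) o\<^sub>L word a i l"

lemma word_add: "word a i (l + m) = word a (i + l) m o\<^sub>L word a i l"
  by (induction m) (auto simp: blinfun_compose_assoc add.assoc)

lemma word_in_op_products: "(\<And>k. a k \<in> A) \<Longrightarrow> word a i l \<in> op_products A l"
  by (induction l) auto

lemma word_cong: "(\<And>k. k < i + l \<Longrightarrow> a k = b k) \<Longrightarrow> word a i l = word b i l"
  by (induction l) auto

lemma op_products_word:
  assumes "P \<in> op_products A n" "A \<noteq> {}"
  obtains a where "\<And>k. a k \<in> A" "P = word a 0 n"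
  using assms(1)
proof (induction n arbitrary: P thesis)
  case 0
  obtain L where "L \<in> A" using assms(2) by blast
  then show ?case using 0 by (intro 0(1)[of "\<lambda>_. L"]) auto
next
  case (Suc n)
  then obtain L M where P: "P = L o\<^sub>L M" "L \<in> A" "M \<in> op_products A n" by auto
  then obtain a where a: "\<And>k. a k \<in> A" "M = word a 0 n" using Suc.IH by blast
  have "word (a(n := L)) 0 n = word a 0 n" by (rule word_cong) auto
  then have "P = word (a(n := L)) 0 (Suc n)" using a P by simp
  moreover have "(a(n := L)) k \<in> A" for k using a P by simp
  ultimately show ?case using Suc.prems(1) by blast
qed

lemma cball_net_obtain:
  assumes "blinfun_apply L ` cball 0 c \<subseteq> (\<Union>y\<in>F. cball y \<eta>)" "norm x \<le> c"
  obtains y where "y \<in> F" "dist (blinfun_apply L x) y \<le> \<eta>"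
  using assms by (force simp: dist_commute)

text \<open>Along a long product that preserves \<open>q\<close>-volume, take two hyperbolic times whose \<open>q\<close>-dimensional
  subspaces are close to each other. The intermediate product maps a cone around the first of them into
  itself.\<close>

lemma spec_radius_ge_of_volume_gap:
  fixes A :: "('a::real_normed_vector \<Rightarrow>\<^sub>L 'a) set" and \<epsilon> \<sigma> \<gamma> C :: real
  assumes ne: "A \<noteq> {}" and q: "1 \<le> q" and \<epsilon>: "0 < \<epsilon>" and \<sigma>: "\<sigma> = real q * \<epsilon>"
    and bound: "\<And>L. L \<in> A \<Longrightarrow> norm L \<le> exp \<epsilon>"
    and decay: "\<And>n P vs. P \<in> op_products A n \<Longrightarrow> length vs = Suc q
      \<Longrightarrow> flag_volume (map (blinfun_apply P) vs) \<le> C * exp (- \<gamma> * n) * flag_volume vs"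
    and gap: "1 \<le> C" "10 * \<sigma> < \<gamma>"
    and nondecay: "\<And>n. n \<ge> 1 \<Longrightarrow> \<exists>P\<in>op_products A n. \<exists>vs. length vs = q
      \<and> flag_volume vs / 2 < flag_volume (map (blinfun_apply P) vs)"
    and net: "\<And>c \<eta>. 0 < c \<Longrightarrow> 0 < \<eta> \<Longrightarrow> \<exists>r F. finite F \<and>
      (\<forall>P\<in>op_products A r. blinfun_apply P ` cball 0 (c * exp (5 * \<sigma> * r)) \<subseteq> (\<Union>y\<in>F. cball y \<eta>))"
  shows "\<exists>l\<ge>l0. \<exists>B\<in>op_products A l. exp (- (6 * \<sigma> * l)) \<le> spec_radius B"
proof -
  \<comment> \<open>\<open>\<kappa>\<close> and \<open>\<alpha>\<close> are the constants of
    \<open>min_exp\<close>, \<open>\<beta>\<close> is that of \<open>quot\<close>, \<open>K\<close>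
    is the angle bound of \<open>dominated_splitting\<close>, and \<open>\<eta>\<close> is the
    closeness of subspaces that \<open>spec_radius_ge_cone\<close> demands for this
    \<open>K\<close>.\<close>
  define \<kappa> :: real where "\<kappa> = 1 / 4 ^ q"
  define \<alpha> where "\<alpha> = exp (- (5 * \<sigma>))"
  define \<beta> where "\<beta> = exp (- (\<gamma> - 4 * \<sigma>))"
  define M where "M = exp \<epsilon>"
  define K where "K = 2 * C * (M + 1) / (\<kappa> * (\<alpha> - \<beta>))"
  define \<eta> where "\<eta> = 1 / (8 * (K + 1))"
  have \<sigma>0: "0 < \<sigma>" "\<epsilon> \<le> \<sigma>" using \<sigma> q \<epsilon> by auto
  have \<kappa>: "0 < \<kappa>" by (simp add: \<kappa>_def)
  have \<alpha>\<beta>: "0 < \<alpha>" "0 < \<beta>" "\<beta> < \<alpha>" "\<beta> \<le> 1"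
    using gap \<sigma>0 by (auto simp: \<alpha>_def \<beta>_def)
  have K: "0 \<le> K" unfolding K_def M_def using \<alpha>\<beta> \<kappa> gap by auto
  have \<eta>: "0 < \<eta>" "8 * (K + 1) * \<eta> = 1" using K by (auto simp: \<eta>_def)

  \<comment> \<open>By \<open>min_exp\<close>, 1 / \<kappa> * exp (5 \<sigma> r) will bound the
    preimages in \<open>E (j - r)\<close> of unit vectors of \<open>E j\<close>. Half of
    \<open>\<eta>\<close> is used because two vectors are compared through one net point.\<close>
  have "0 < 1 / \<kappa>" "0 < \<eta> / 2" using \<kappa> \<eta> by auto
  from net[OF this] obtain r F where F: "finite F"
      "\<And>P. P \<in> op_products A r \<Longrightarrow> blinfun_apply P ` cball 0 (1 / \<kappa> * exp (5 * \<sigma> * r)) \<subseteq> (\<Union>y\<in>F. cball y (\<eta> / 2))"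
    by blast
  have "\<forall>\<^sub>F l in sequentially. 2 * C * \<beta> ^ l \<le> \<kappa> * \<alpha> ^ l / 4"
  proof -
    have "(\<lambda>l. (\<beta> / \<alpha>) ^ l) \<longlonglongrightarrow> 0" using \<alpha>\<beta> by (intro LIMSEQ_power_zero) auto
    then have "\<forall>\<^sub>F l in sequentially. (\<beta> / \<alpha>) ^ l < \<kappa> / (8 * C)"
      using \<kappa> gap by (intro order_tendstoD(2)[where y = 0]) auto
    then show ?thesis
    proof eventually_elim
      case (elim l)
      then show ?case using \<alpha>\<beta> gap by (simp add: power_divide field_simps)
    qed
  qed
  moreover have "\<forall>\<^sub>F l in sequentially. exp (- (6 * \<sigma> * real l)) \<le> \<kappa> * \<alpha> ^ l / 2"
  proof -
    have "(\<lambda>l. exp (- \<sigma>) ^ l) \<longlonglongrightarrow> 0" using \<sigma>0 by (intro LIMSEQ_power_zero) auto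
    then have "\<forall>\<^sub>F l in sequentially. exp (- \<sigma>) ^ l < \<kappa> / 2"
      using \<kappa> by (intro order_tendstoD(2)[where y = 0]) auto
    then show ?thesis
    proof eventually_elim
      case (elim l)
      have "exp (- (6 * \<sigma> * real l)) = exp (- \<sigma>) ^ l * \<alpha> ^ l"
        by (simp add: \<alpha>_def flip: exp_of_nat_mult exp_add)
      also have "\<dots> \<le> \<kappa> / 2 * \<alpha> ^ l" using elim \<alpha>\<beta> by (intro mult_right_mono) auto
      finally show ?case by simp
    qed
  qed
  ultimately obtain l1 where l1: "\<And>l. l \<ge> l1 \<Longrightarrow> 2 * C * \<beta> ^ l \<le> \<kappa> * \<alpha> ^ l / 4"
      "\<And>l. l \<ge> l1 \<Longrightarrow> exp (- (6 * \<sigma> * real l)) \<le> \<kappa> * \<alpha> ^ l / 2"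
    unfolding eventually_sequentially by (metis max.bounded_iff le_cases)
  define l2 where "l2 = max l0 l1"
  \<comment> \<open>\<open>r\<close> good times are sacrificed so that \<open>r\<close> factors
    precede the rest; the second summand feeds the pigeonhole over the subsets of \<open>F\<close>,
    with two hits at least \<open>l2\<close> apart.\<close>
  define N where "N = r + l2 * 2 ^ card F"
  obtain R :: nat where R: "R \<ge> 1" "5 * real N + 5 + 2 * ln 2 / \<sigma> < 3 * real R"
  proof -
    obtain R :: nat where "5 * real N + 5 + 2 * ln 2 / \<sigma> < real R" using reals_Archimedean2 by blast
    then show ?thesis by (intro that[of "Suc R"]) auto
  qed

  obtain P vs where P: "P \<in> op_products A R" "length vs = q"
      "flag_volume vs / 2 < flag_volume (map (blinfun_apply P) vs)"
    using nondecay[OF R(1)] by blast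
  obtain a where a: "\<And>k. a k \<in> A" "P = word a 0 R" using op_products_word[OF P(1) ne] by blast
  define T where "T = word a"
  define w where "w i = map (blinfun_apply (T 0 i)) vs" for i
  define E where "E i = span (set (w i))" for i
  have len: "length (w i) = q" for i by (simp add: w_def P)
  have w_add: "w (i + l) = map (blinfun_apply (T i l)) (w i)" for i l
    by (simp add: w_def T_def word_add)
  have E_add: "E (i + l) = blinfun_apply (T i l) ` E i" for i l
    unfolding E_def w_add by (rule span_map_blinfun)
  have T_in: "T i l \<in> op_products A l" for i l unfolding T_def using a(1) by (rule word_in_op_products)
  have normT: "norm (T i l) \<le> exp (\<epsilon> * l)" for i l
    using op_products_norm_le[OF bound _ T_in] by (simp add: mult.commute flip: exp_of_nat_mult)
  have wR: "flag_volume vs / 2 < flag_volume (w R)" using P a by (simp add: w_def T_def)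
  \<comment> \<open>A volume that vanishes once stays zero up to time \<open>R\<close>; its
    logarithm \<open>b\<close> is therefore meaningful on the whole orbit.\<close>
  have pos: "0 < flag_volume (w i)" if "i \<le> R" for i
  proof -
    have "flag_volume (w R) \<le> norm (T i (R - i)) ^ length (w i) * flag_volume (w i)"
      using w_add[of i "R - i"] flag_volume_map_le[of "T i (R - i)" "w i"] that by simp
    moreover have "0 < flag_volume (w R)" using wR flag_volume_nonneg[of vs] by linarith
    ultimately have "flag_volume (w i) \<noteq> 0" by auto
    then show ?thesis using flag_volume_nonneg[of "w i"] by linarith
  qed
  define b where "b i = ln (flag_volume (w i))" for i
  have b: "flag_volume (w i) = exp (b i)" if "i \<le> R" for i using pos[OF that] by (simp add: b_def)
  have inc: "b (Suc p) - b p \<le> \<sigma>" if "p < R" for p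
  proof -
    have "flag_volume (w (Suc p)) \<le> norm (T p 1) ^ q * flag_volume (w p)"
      using w_add[of p 1] flag_volume_map_le[of "T p 1" "w p"] len by simp
    also have "\<dots> \<le> exp \<epsilon> ^ q * flag_volume (w p)"
      using normT[of p 1] by (intro mult_right_mono power_mono flag_volume_nonneg) auto
    finally have "exp (b (Suc p)) \<le> exp (\<sigma> + b p)"
      using that by (simp add: b exp_add \<sigma> exp_of_nat_mult)
    then show ?thesis by simp
  qed
  have tot: "- ln 2 \<le> b R - b 0"
  proof -
    have "w 0 = vs" by (simp add: w_def T_def)
    then have "exp (b 0) < 2 * exp (b R)" using wR b[of 0] b[of R] by simp
    then have "exp (b 0) < exp (ln 2 + b R)" by (simp add: exp_add)
    then show ?thesis by simp
  qed
  define G where "G = {i. i \<le> R \<and> (\<forall>j\<in>{i..R}. b i - 4 * \<sigma> * real (j - i) \<le> b j)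
    \<and> (\<forall>j\<le>i. b j - 4 * \<sigma> * real (i - j) \<le> b i)}"
  have cardG: "N < card G"
    unfolding G_def using inc tot \<sigma>0(1) R(2) by (rule hyperbolic_times)
  define G' where "G' = G - {..<r}"
  have finG: "finite G" unfolding G_def by auto
  have "card G - card {..<r} \<le> card G'" unfolding G'_def by (rule diff_card_le_card_Diff) simp
  then have cardG': "l2 * card (Pow F) < card G'"
    using cardG F(1) by (simp add: N_def card_Pow)

  \<comment> \<open>\<open>flag_volume_ratio_le_expansion\<close> charges the other
    \<open>q - 1\<close> directions with the norm of the product, at most exp (\<sigma> l) in all;
    added to the volume loss 4 \<sigma> l this gives the 5 \<sigma> in
    \<open>\<alpha>\<close>.\<close>
  have min_exp: "\<kappa> * \<alpha> ^ l * norm x \<le> norm (blinfun_apply (T i l) x)"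
    if il: "i + l \<le> R" "b i - 4 * \<sigma> * l \<le> b (i + l)" and x: "x \<in> E i" for i l x
  proof -
    let ?y = "norm (blinfun_apply (T i l) x)"
    have "exp (b i - 4 * \<sigma> * l) \<le> flag_volume (w (i + l))"
      using il by (simp add: b)
    then have "norm x * exp (b i - 4 * \<sigma> * l) \<le> norm x * flag_volume (w (i + l))"
      by (rule mult_left_mono) simp
    also have "\<dots> \<le> 4 ^ q * norm (T i l) ^ (q - 1) * ?y * flag_volume (w i)"
      using flag_volume_ratio_le_expansion[of x "w i" "T i l"] x unfolding E_def w_add len .
    also have "\<dots> \<le> 4 ^ q * exp (\<epsilon> * l) ^ (q - 1) * ?y * flag_volume (w i)"
      using normT by (intro mult_right_mono mult_left_mono power_mono flag_volume_nonneg) auto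
    also have "\<dots> \<le> 4 ^ q * exp (\<sigma> * l) * ?y * flag_volume (w i)"
    proof -
      have "exp (\<epsilon> * l) ^ (q - 1) = exp (real (q - 1) * (\<epsilon> * l))" by (rule exp_of_nat_mult[symmetric])
      also have "\<dots> \<le> exp (\<sigma> * l)"
        unfolding \<sigma> using \<epsilon> by (simp add: mult.assoc mult_right_mono)
      finally show ?thesis by (intro mult_right_mono mult_left_mono flag_volume_nonneg) auto
    qed
    also have "flag_volume (w i) = exp (b i)" using il b by simp
    finally have "norm x * exp (- 4 * \<sigma> * l) * exp (b i) \<le> 4 ^ q * exp (\<sigma> * l) * ?y * exp (b i)"
      by (simp add: exp_diff exp_minus field_simps)
    then have "norm x * exp (- 4 * \<sigma> * l) \<le> 4 ^ q * exp (\<sigma> * l) * ?y" by simp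
    then have "\<kappa> * (exp (- (\<sigma> * l)) * exp (- 4 * \<sigma> * l)) * norm x \<le> ?y"
      by (simp add: \<kappa>_def exp_minus field_simps)
    also have "exp (- (\<sigma> * l)) * exp (- 4 * \<sigma> * l) = \<alpha> ^ l"
      by (simp add: \<alpha>_def flip: exp_of_nat_mult exp_add)
    finally show ?thesis .
  qed
  \<comment> \<open>The distance to \<open>E (i + l)\<close> is a quotient of a (q + 1)-volume by a
    q-volume: the numerator decays at rate \<open>\<gamma>\<close>, the denominator loses at most 4
    \<sigma> per step.\<close>
  have quot: "infdist (blinfun_apply (T i l) x) (E (i + l)) \<le> C * \<beta> ^ l * norm x"
    if il: "i + l \<le> R" "b i - 4 * \<sigma> * l \<le> b (i + l)" for i l x
  proof -
    let ?d = "infdist (blinfun_apply (T i l) x) (E (i + l))"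
    have "?d * flag_volume (w (i + l)) = flag_volume (map (blinfun_apply (T i l)) (x # w i))"
      by (simp add: E_def w_add)
    also have "\<dots> \<le> C * exp (- \<gamma> * l) * flag_volume (x # w i)"
      by (intro decay T_in) (simp add: len)
    also have "flag_volume (x # w i) \<le> norm x * flag_volume (w i)"
      using infdist_subspace_le_norm[OF subspace_span[of "set (w i)"], of x]
      by (auto intro: mult_right_mono simp: flag_volume_nonneg)
    finally have "?d * flag_volume (w (i + l)) \<le> C * exp (- \<gamma> * l) * (norm x * flag_volume (w i))"
      using gap by (auto intro: mult_left_mono)
    moreover have "?d * exp (b i - 4 * \<sigma> * l) \<le> ?d * flag_volume (w (i + l))"
      using il by (intro mult_left_mono) (auto simp: b infdist_nonneg)
    moreover have "flag_volume (w i) = exp (b i)" using il b by simp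
    ultimately have "?d * exp (b i - 4 * \<sigma> * l) \<le> C * exp (- \<gamma> * l) * (norm x * exp (b i))"
      by simp
    then have "?d * exp (- 4 * \<sigma> * l) * exp (b i) \<le> C * exp (- \<gamma> * l) * norm x * exp (b i)"
      by (simp add: exp_diff exp_minus field_simps)
    then have "?d * exp (- 4 * \<sigma> * l) \<le> C * exp (- \<gamma> * l) * norm x" by simp
    then have "?d \<le> C * (exp (- \<gamma> * l) * exp (4 * \<sigma> * l)) * norm x"
      by (simp add: exp_minus field_simps)
    also have "exp (- \<gamma> * l) * exp (4 * \<sigma> * l) = \<beta> ^ l"
      by (simp add: \<beta>_def algebra_simps flip: exp_of_nat_mult exp_add)
    finally show ?thesis .
  qed

  \<comment> \<open>The backward condition at the good time \<open>j\<close> makes the last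
    \<open>r\<close> factors expand \<open>E (j - r)\<close> well enough that the unit ball of
    \<open>E j\<close> comes from a ball of controlled radius, to whose image the net
    applies.\<close>
  have near: "\<exists>y\<in>F. dist x y \<le> \<eta> / 2" if j: "j \<in> G'" and x: "x \<in> E j" "norm x \<le> 1" for j x
  proof -
    have jr: "r \<le> j" "j \<le> R" using j by (auto simp: G'_def G_def)
    have "b (j - r) - 4 * \<sigma> * real (j - (j - r)) \<le> b j"
      using j unfolding G'_def G_def by (metis (no_types, lifting) DiffD1 diff_le_self mem_Collect_eq)
    then have good: "b (j - r) - 4 * \<sigma> * real r \<le> b ((j - r) + r)" using jr by simp
    have "E j = blinfun_apply (T (j - r) r) ` E (j - r)" using E_add[of "j - r" r] jr by simp
    then obtain u where u: "u \<in> E (j - r)" "x = blinfun_apply (T (j - r) r) u" using x by blast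
    have "\<kappa> * \<alpha> ^ r * norm u \<le> norm x"
      unfolding u(2) using good u jr by (intro min_exp) auto
    then have "\<kappa> * \<alpha> ^ r * norm u \<le> 1" using x by linarith
    then have "norm u \<le> 1 / \<kappa> * (1 / \<alpha> ^ r)" using \<kappa> \<alpha>\<beta> by (simp add: field_simps)
    also have "1 / \<alpha> ^ r = exp (5 * \<sigma> * r)"
      by (simp add: \<alpha>_def exp_minus field_simps flip: exp_of_nat_mult)
    finally have "norm u \<le> 1 / \<kappa> * exp (5 * \<sigma> * r)" .
    then show ?thesis
      using cball_net_obtain[OF F(2)[OF T_in]] u(2) by metis
  qed
  \<comment> \<open>The net points met by the unit ball of \<open>E j\<close>. If two times share
    this set, every unit vector of one subspace is within \<open>\<eta>\<close> of the other
    subspace.\<close>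
  define f where "f j = {y \<in> F. \<exists>x\<in>E j. norm x \<le> 1 \<and> dist x y \<le> \<eta> / 2}" for j
  obtain i j where ij: "i \<in> G'" "j \<in> G'" "i + l2 \<le> j" "f i = f j"
    using pigeonhole_spread[of G' l2 "Pow F" f] finG cardG' F(1) by (auto simp: G'_def f_def)
  define l where "l = j - i"
  have l: "j = i + l" "l2 \<le> l" using ij by (auto simp: l_def)
  have jR: "i + l \<le> R" using ij l by (auto simp: G'_def G_def)
  have fwd: "b i - 4 * \<sigma> * real k \<le> b (i + k)" if "k \<le> l" for k
  proof -
    have "i + k \<in> {i..R}" using that jR by auto
    then have "b i - 4 * \<sigma> * real (i + k - i) \<le> b (i + k)"
      using ij(1) unfolding G'_def G_def by blast
    then show ?thesis by simp
  qed
  have subE: "subspace (E k)" for k by (simp add: E_def)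
  define B where "B = T i l"
  have "\<kappa> * \<alpha> ^ l / 2 \<le> spec_radius B"
  proof (rule spec_radius_ge_cone[OF subE])
    show "hd (w i) \<in> E i"
      unfolding E_def using len[of i] q by (intro span_base) (cases "w i"; auto)
    show "hd (w i) \<noteq> 0"
    proof
      assume "hd (w i) = 0"
      then have "flag_volume (w i) = 0"
        using len[of i] q infdist_zero[OF span_0] by (cases "w i") auto
      then show False using pos[of i] jR by simp
    qed
    show "\<kappa> * \<alpha> ^ l * norm z \<le> norm (blinfun_apply B z)" if "z \<in> E i" for z
      unfolding B_def using that fwd[of l] jR by (intro min_exp) auto
    show "\<exists>z'\<in>E i. norm (blinfun_apply B z - z') \<le> \<eta> * norm (blinfun_apply B z)" if "z \<in> E i" for z
    proof (cases "blinfun_apply B z = 0")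
      case True
      then show ?thesis using subspace_0[OF subE] by (intro bexI[of _ 0]) auto
    next
      case False
      define y where "y = blinfun_apply B z"
      define y1 where "y1 = (1 / norm y) *\<^sub>R y"
      have "y \<in> E j" unfolding y_def B_def l E_add using that by blast
      then have y1: "y1 \<in> E j" "norm y1 \<le> 1"
        unfolding y1_def using subspace_scale[OF subE] False by (auto simp: y_def)
      then obtain p where p: "p \<in> F" "dist y1 p \<le> \<eta> / 2" using near ij by blast
      then have "p \<in> f i" using y1 ij(4) unfolding f_def by blast
      then obtain z1 where z1: "z1 \<in> E i" "dist z1 p \<le> \<eta> / 2" unfolding f_def by blast
      have "norm (y1 - z1) \<le> \<eta>"
        using p z1 dist_triangle2[of y1 z1 p] by (simp add: dist_norm)
      then have "norm y * norm (y1 - z1) \<le> norm y * \<eta>" by (rule mult_left_mono) simp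
      moreover have "y - norm y *\<^sub>R z1 = norm y *\<^sub>R (y1 - z1)"
        using False by (simp add: y1_def y_def algebra_simps)
      ultimately have "norm (y - norm y *\<^sub>R z1) \<le> \<eta> * norm y" by (simp add: mult.commute)
      then show ?thesis unfolding y_def using subspace_scale[OF subE z1(1)] by blast
    qed
    show "\<exists>e\<in>E i. norm e \<le> K * norm g \<and> norm (blinfun_apply B (g - e)) \<le> 2 * C * \<beta> ^ l * norm g" for g
      unfolding B_def
    proof (rule dominated_splitting[OF subE, where S = "T i" and s = "\<lambda>k. a (i + k)" and M = M and n = l
          and \<kappa> = \<kappa> and \<alpha> = \<alpha>])
      show "norm (a (i + k)) \<le> M" for k unfolding M_def by (rule bound[OF a(1)])
      show "\<kappa> * \<alpha> ^ k * norm x \<le> norm (blinfun_apply (T i k) x)" if "k \<le> l" "x \<in> E i" for k x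
        using that fwd[of k] jR by (intro min_exp) auto
      show "infdist (blinfun_apply (T i k) x) (blinfun_apply (T i k) ` E i) \<le> C * \<beta> ^ k * norm x"
        if "k \<le> l" for k x
        unfolding E_add[symmetric] using that fwd[of k] jR by (intro quot) auto
    qed (use \<kappa> \<alpha>\<beta> gap in \<open>auto simp: T_def K_def M_def\<close>)
    show "2 * C * \<beta> ^ l \<le> \<kappa> * \<alpha> ^ l / 4" using l1(1) l by (simp add: l2_def)
    show "8 * (K + 1) * \<eta> \<le> 1" using \<eta> by simp
  qed (use \<kappa> \<alpha>\<beta> K gap \<eta> in auto)
  moreover have "exp (- (6 * \<sigma> * real l)) \<le> \<kappa> * \<alpha> ^ l / 2" using l1(2) l by (simp add: l2_def)
  ultimately have "exp (- (6 * \<sigma> * real l)) \<le> spec_radius B" by linarith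
  then show ?thesis using l T_in[of i l] unfolding B_def l2_def by (intro exI[of _ l]) auto
qed

section \<open>The Berger-Wang formula\<close>

lemma norm_chi_scaleR_le: "norm_chi (c *\<^sub>R L) \<le> \<bar>c\<bar> * norm_chi L"
proof -
  have "c *\<^sub>R L = (c *\<^sub>R id_blinfun) o\<^sub>L L" by (auto intro!: blinfun_eqI simp: blinfun.scaleR_left)
  then have "norm_chi (c *\<^sub>R L) \<le> norm_chi (c *\<^sub>R id_blinfun :: 'a \<Rightarrow>\<^sub>L 'a) * norm_chi L"
    by (simp only: norm_chi_compose)
  also have "norm_chi (c *\<^sub>R id_blinfun :: 'a \<Rightarrow>\<^sub>L 'a) \<le> norm (c *\<^sub>R id_blinfun :: 'a \<Rightarrow>\<^sub>L 'a)"
    by (rule norm_chi_le_norm)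
  also have "\<dots> \<le> \<bar>c\<bar>"
    using norm_blinfun_id_le[where 'a='a] by (simp add: mult_left_le)
  finally show ?thesis using norm_chi_nonneg[of L] by (meson mult_right_mono order_trans)
qed

text \<open>Applied to the products of some length, this expresses that the growth rate of j-volumes
  is less than 1. The form without quotients allows vanishing volumes.\<close>

definition volume_halving :: "('a::real_normed_vector \<Rightarrow>\<^sub>L 'a) set \<Rightarrow> nat \<Rightarrow> bool" where
  "volume_halving S j \<longleftrightarrow> (\<forall>P\<in>S. \<forall>vs. length vs = j
    \<longrightarrow> flag_volume (map (blinfun_apply P) vs) \<le> flag_volume vs / 2)"

text \<open>The gap between 1/16 and 1/8 pays for a net common to all of \<open>S\<close>. Its
  cardinality bounds the number of factors that fail to contract, independently of \<open>j\<close>,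
  so the power of 1/2 wins for large \<open>j\<close>.\<close>

lemma volume_halving_exists:
  fixes S :: "('a::real_normed_vector \<Rightarrow>\<^sub>L 'a) set"
  assumes S: "compact (closure S)" and chi: "\<And>L. L \<in> S \<Longrightarrow> norm_chi L < 1/16"
  shows "\<exists>j. volume_halving S j"
proof -
  obtain F where F: "finite F" "\<And>L. L \<in> S \<Longrightarrow> blinfun_apply L ` cball 0 1 \<subseteq> (\<Union>y\<in>F. cball y (1/8))"
    using precompact_uniform_net[OF S chi, of "1/8"] by auto
  have "bounded S" using compact_imp_bounded[OF S] closure_subset by (rule bounded_subset)
  then obtain M' where M': "\<And>L. L \<in> S \<Longrightarrow> norm L \<le> M'" unfolding bounded_iff by auto
  define M where "M = max 1 M'"
  have M: "norm L \<le> M" if "L \<in> S" for L using M'[OF that] by (simp add: M_def)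
  have "(\<lambda>j. (1/2::real) ^ j) \<longlonglongrightarrow> 0" by (intro LIMSEQ_power_zero) auto
  then have "\<forall>\<^sub>F j in sequentially. (1/2::real) ^ j < 1 / (2 * (2 * M) ^ card F)"
    by (rule order_tendstoD) (simp add: M_def)
  then obtain j where "(1/2::real) ^ j < 1 / (2 * (2 * M) ^ card F)"
    by (auto simp: eventually_sequentially)
  then have j: "(2 * M) ^ card F * (1/2) ^ j \<le> 1/2" by (simp add: field_simps M_def)
  have "flag_volume (map (blinfun_apply P) vs) \<le> flag_volume vs / 2" if "P \<in> S" "length vs = j" for P vs
  proof -
    have "flag_volume (map (blinfun_apply P) vs) \<le> (2 * M) ^ card F * (1/2) ^ j * flag_volume vs"
      using flag_volume_map_le_net[OF F(2)[OF that(1)] F(1) M[OF that(1)], of vs] that by (simp add: M_def)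
    also have "\<dots> \<le> 1/2 * flag_volume vs" using j by (intro mult_right_mono flag_volume_nonneg)
    finally show ?thesis by simp
  qed
  then show ?thesis unfolding volume_halving_def by blast
qed

lemma volume_halving_decay:
  fixes A :: "('a::real_normed_vector \<Rightarrow>\<^sub>L 'a) set"
  assumes A: "bounded A" and m: "m \<ge> 1" and half: "volume_halving (op_products A m) j"
  obtains C \<gamma> :: real where "1 \<le> C" "0 < \<gamma>"
    "\<And>n P vs. P \<in> op_products A n \<Longrightarrow> length vs = j
      \<Longrightarrow> flag_volume (map (blinfun_apply P) vs) \<le> C * exp (- \<gamma> * n) * flag_volume vs"
proof -
  obtain M' where M': "\<And>L. L \<in> A \<Longrightarrow> norm L \<le> M'" using A unfolding bounded_iff by auto
  define M where "M = max 1 M'"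
  have M: "1 \<le> M" "\<And>L. L \<in> A \<Longrightarrow> norm L \<le> M" using M' by (auto simp: M_def intro: max.coboundedI2)
  define \<gamma> where "\<gamma> = ln 2 / m"
  \<comment> \<open>\<open>(M ^ m) ^ j\<close> covers the remainder of \<open>n\<close> modulo
    \<open>m\<close>; the factor 2 replaces the exponent \<open>p\<close> by \<open>Suc p\<close>,
    for which \<open>n \<le> m * Suc p\<close>.\<close>
  define C where "C = 2 * (M ^ m) ^ j"
  have iter: "flag_volume (map (blinfun_apply P) vs) \<le> (1/2) ^ p * flag_volume vs"
    if "P \<in> op_products (op_products A m) p" "length vs = j" for P vs p
    using that(1)
  proof (induction p arbitrary: P)
    case (Suc p)
    then obtain L N where P: "P = L o\<^sub>L N" "L \<in> op_products A m" "N \<in> op_products (op_products A m) p" by auto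
    have "map (blinfun_apply P) vs = map (blinfun_apply L) (map (blinfun_apply N) vs)" using P(1) by simp
    then have "flag_volume (map (blinfun_apply P) vs) \<le> flag_volume (map (blinfun_apply N) vs) / 2"
      using half P(2) that(2) unfolding volume_halving_def by (metis length_map)
    also have "\<dots> \<le> (1/2) ^ p * flag_volume vs / 2" using Suc.IH[OF P(3)] by simp
    finally show ?case by simp
  qed simp
  show ?thesis
  proof (rule that)
    have "1 \<le> (M ^ m) ^ j" using M by simp
    then show "1 \<le> C" by (simp add: C_def)
    show "0 < \<gamma>" using m by (simp add: \<gamma>_def)
    fix n P and vs :: "'a list" assume P: "P \<in> op_products A n" and vs: "length vs = j"
    define p where "p = n div m"
    define r where "r = n mod m"
    have n: "n = m * p + r" "r < m" using m by (auto simp: p_def r_def)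
    obtain L N where LN: "P = L o\<^sub>L N" "L \<in> op_products A (m * p)" "N \<in> op_products A r"
      using P unfolding n(1) op_products_append by blast
    have "norm N \<le> M ^ r" using op_products_norm_le[of A M N r] M LN by simp
    also have "\<dots> \<le> M ^ m" using M n by (intro power_increasing) auto
    finally have N: "norm N ^ j \<le> (M ^ m) ^ j" by (intro power_mono) auto
    have "map (blinfun_apply P) vs = map (blinfun_apply L) (map (blinfun_apply N) vs)" by (simp add: LN(1))
    then have "flag_volume (map (blinfun_apply P) vs) \<le> (1/2) ^ p * flag_volume (map (blinfun_apply N) vs)"
      using iter[OF LN(2)[folded op_products_op_products], of "map (blinfun_apply N) vs"] vs
      by (simp only: length_map)
    also have "\<dots> \<le> (1/2) ^ p * (norm N ^ j * flag_volume vs)"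
      using flag_volume_map_le[of N vs] vs by (intro mult_left_mono) auto
    also have "\<dots> \<le> (1/2) ^ p * ((M ^ m) ^ j * flag_volume vs)"
      using N by (intro mult_left_mono mult_right_mono flag_volume_nonneg) auto
    also have "\<dots> = C * ((1/2) ^ Suc p) * flag_volume vs" by (simp add: C_def)
    also have "\<dots> \<le> C * exp (- \<gamma> * n) * flag_volume vs"
    proof -
      have "(1/2) ^ Suc p = exp (- ln 2 :: real) ^ Suc p" by (simp add: exp_minus power_divide field_simps)
      also have "\<dots> = exp (- ln 2 * Suc p)" by (rule exp_of_nat2_mult[symmetric])
      also have "\<dots> \<le> exp (- \<gamma> * n)"
      proof -
        have "n \<le> m * Suc p" using n by simp
        then have "real n \<le> real m * real (Suc p)" by (metis of_nat_le_iff of_nat_mult)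
        then have "\<gamma> * real n \<le> \<gamma> * (real m * real (Suc p))"
          using m by (intro mult_left_mono) (auto simp: \<gamma>_def)
        also have "\<dots> = ln 2 * real (Suc p)" using m by (simp add: \<gamma>_def)
        finally show ?thesis by simp
      qed
      finally show ?thesis using M by (intro mult_right_mono mult_left_mono flag_volume_nonneg) (auto simp: C_def)
    qed
    finally show "flag_volume (map (blinfun_apply P) vs) \<le> C * exp (- \<gamma> * n) * flag_volume vs" .
  qed
qed

text \<open>The hypotheses on norms say that the joint radius is 1, and \<open>\<theta>\<close> lies
  above \<open>radius_chi A\<close>. The arbitrary \<open>n0\<close> is what a bound on a limsup
  needs.\<close>

lemma spec_radius_growth_normalized:
  fixes A :: "('a::real_normed_vector \<Rightarrow>\<^sub>L 'a) set"
  assumes ne: "A \<noteq> {}" and A: "compact (closure A)"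
    and up: "\<And>t. 1 < t \<Longrightarrow> \<forall>\<^sub>F n in sequentially. \<forall>L\<in>op_products A n. norm L < t ^ n"
    and low: "\<And>t n. 0 \<le> t \<Longrightarrow> t < 1 \<Longrightarrow> n \<ge> 1 \<Longrightarrow> \<exists>L\<in>op_products A n. t ^ n < norm L"
    and chi: "0 < \<theta>" "\<theta> < 1" "\<forall>\<^sub>F n in sequentially. \<forall>L\<in>op_products A n. norm_chi L < \<theta> ^ n"
    and s: "0 < s" "s < 1"
  shows "\<exists>n\<ge>n0. \<exists>B\<in>op_products A n. s ^ n \<le> spec_radius B"
proof -
  obtain n1 where n1: "\<And>n L. n \<ge> n1 \<Longrightarrow> L \<in> op_products A n \<Longrightarrow> norm_chi L < \<theta> ^ n"
    using chi(3) unfolding eventually_sequentially by blast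
  define halving where "halving j \<longleftrightarrow> (\<exists>n\<ge>1. volume_halving (op_products A n) j)" for j
  have "\<exists>j. halving j"
  proof -
    have "(\<lambda>n. \<theta> ^ n) \<longlonglongrightarrow> 0" using chi by (intro LIMSEQ_power_zero) auto
    then have "\<forall>\<^sub>F n in sequentially. \<theta> ^ n < 1/16" by (rule order_tendstoD) simp
    then obtain n2 where n2: "\<And>n. n \<ge> n2 \<Longrightarrow> \<theta> ^ n < 1/16" unfolding eventually_sequentially by blast
    define n where "n = n1 + n2 + 1"
    have "norm_chi L < 1/16" if "L \<in> op_products A n" for L
      using n1[OF _ that] n2[of n] by (simp add: n_def)
    then have "\<exists>j. volume_halving (op_products A n) j"
      by (intro volume_halving_exists precompact_op_products A)
    moreover have "n \<ge> 1" by (simp add: n_def)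
    ultimately show ?thesis unfolding halving_def by blast
  qed
  define j where "j = (LEAST j. halving j)"
  have j: "halving j" unfolding j_def using \<open>\<exists>j. halving j\<close> by (rule LeastI_ex)
  have "\<not> halving 0"
    using op_products_nonempty[OF ne] unfolding halving_def volume_halving_def by fastforce
  \<comment> \<open>The 1-volume of a vector is its norm, and joint radius 1 forbids that all
    products of some positive length have norm at most 1/2. So the least halving dimension has the
    form \<open>Suc q\<close> with \<open>1 \<le> q\<close>.\<close>
  moreover have "\<not> halving 1"
  proof
    assume "halving 1"
    then obtain n where n: "n \<ge> 1" "volume_halving (op_products A n) 1" unfolding halving_def by blast
    have "norm L \<le> 1/2" if "L \<in> op_products A n" for L
    proof (rule norm_blinfun_bound)
      fix v :: 'a
      have "length [v] = 1" by simp
      then have "flag_volume (map (blinfun_apply L) [v]) \<le> flag_volume [v] / 2"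
        using n(2) that unfolding volume_halving_def by blast
      then show "norm (blinfun_apply L v) \<le> 1/2 * norm v" by simp
    qed simp
    moreover have "root n (1/2) < 1" using n by simp
    then obtain L where "L \<in> op_products A n" "root n (1/2) ^ n < norm L"
      using low[of "root n (1/2)" n] n(1) by auto
    ultimately show False using n(1) by fastforce
  qed
  ultimately obtain q where q: "j = Suc q" "1 \<le> q"
    using j by (metis One_nat_def Suc_leI not0_implies_Suc zero_less_iff_neq_zero)
  have "\<not> halving q" using q not_less_Least[of q halving] unfolding j_def by simp
  then have nondecay: "\<exists>P\<in>op_products A n. \<exists>vs. length vs = q
      \<and> flag_volume vs / 2 < flag_volume (map (blinfun_apply P) vs)" if "n \<ge> 1" for n
    using that unfolding halving_def volume_halving_def by (meson not_le)
  have bdd: "bounded A" using compact_imp_bounded[OF A] closure_subset by (rule bounded_subset)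
  from j obtain n3 where n3: "n3 \<ge> 1" "volume_halving (op_products A n3) (Suc q)"
    unfolding halving_def q by blast
  obtain C \<gamma> :: real where C: "1 \<le> C" "0 < \<gamma>"
    and decay: "\<And>n P vs. P \<in> op_products A n \<Longrightarrow> length vs = Suc q
      \<Longrightarrow> flag_volume (map (blinfun_apply P) vs) \<le> C * exp (- \<gamma> * n) * flag_volume vs"
    by (rule volume_halving_decay[OF bdd n3]) (rule that)
  \<comment> \<open>Three demands on q \<epsilon>: \<gamma> / 20 yields the gap 10 \<sigma> <
    \<gamma>, - ln s / 6 makes exp (- 6 \<sigma>) dominate the power of \<open>s\<close>, and - ln
    \<theta> / 10 lets the decay of \<open>norm_chi\<close> beat exp (5 \<sigma> r).\<close>
  define \<epsilon> where "\<epsilon> = min (\<gamma> / 20) (min (- ln s / 6) (- ln \<theta> / 10)) / q"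
  have \<epsilon>: "0 < \<epsilon>" using C s chi q by (auto simp: \<epsilon>_def)
  have "real q * \<epsilon> = min (\<gamma> / 20) (min (- ln s / 6) (- ln \<theta> / 10))" using q by (simp add: \<epsilon>_def)
  then have q\<epsilon>: "real q * \<epsilon> \<le> \<gamma> / 20" "real q * \<epsilon> \<le> - ln s / 6" "real q * \<epsilon> \<le> - ln \<theta> / 10"
    by auto
  obtain m0 where m0: "\<And>n L. n \<ge> m0 \<Longrightarrow> L \<in> op_products A n \<Longrightarrow> norm L < exp \<epsilon> ^ n"
    using up[of "exp \<epsilon>"] \<epsilon> unfolding eventually_sequentially by auto
  \<comment> \<open>The bound exp \<epsilon> per factor holds only for long products. So
    \<open>A\<close> is replaced by its \<open>m\<close>-fold products, which multiplies all
    exponential rates by \<open>m\<close>.\<close>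
  define m where "m = Suc m0"
  define \<sigma> where "\<sigma> = real q * (\<epsilon> * m)"
  have "\<exists>l\<ge>n0. \<exists>B\<in>op_products (op_products A m) l. exp (- (6 * \<sigma> * l)) \<le> spec_radius B"
  proof (rule spec_radius_ge_of_volume_gap[where q = q and \<epsilon> = "\<epsilon> * m" and \<gamma> = "\<gamma> * m"])
    show "op_products A m \<noteq> {}" by (rule op_products_nonempty[OF ne])
    show "norm L \<le> exp (\<epsilon> * m)" if "L \<in> op_products A m" for L
      unfolding exp_of_nat2_mult using m0[OF _ that] by (simp add: m_def less_imp_le del: power_Suc)
    show "flag_volume (map (blinfun_apply P) vs) \<le> C * exp (- (\<gamma> * m) * n) * flag_volume vs"
      if "P \<in> op_products (op_products A m) n" "length vs = Suc q" for n P vs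
      using decay[of P "m * n" vs] that unfolding op_products_op_products by (simp add: mult.assoc)
    show "\<exists>P\<in>op_products (op_products A m) n. \<exists>vs. length vs = q
      \<and> flag_volume vs / 2 < flag_volume (map (blinfun_apply P) vs)" if "n \<ge> 1" for n
      unfolding op_products_op_products using that by (intro nondecay) (simp add: m_def)
    have "10 * (real q * \<epsilon>) < \<gamma>" using q\<epsilon>(1) C(2) by linarith
    then have "10 * (real q * \<epsilon>) * real m < \<gamma> * real m"
      by (intro mult_strict_right_mono) (simp_all add: m_def)
    then show "10 * \<sigma> < \<gamma> * m" by (simp add: \<sigma>_def mult.assoc)
    fix c \<eta> :: real assume c: "0 < c" and \<eta>: "0 < \<eta>"
    \<comment> \<open>A ball of radius c exp (5 \<sigma> r) is mapped by \<open>r\<close> blocks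
      into balls of radius 2 c \<omega>^r; \<open>\<omega> < 1\<close> makes this smaller than
      \<open>\<eta>\<close>.\<close>
    define \<omega> where "\<omega> = (exp (5 * (real q * \<epsilon>)) * \<theta>) ^ m"
    have "exp (5 * (real q * \<epsilon>)) \<le> exp (- ln \<theta> / 2)" using q\<epsilon>(3) by simp
    then have "exp (5 * (real q * \<epsilon>)) * \<theta> \<le> exp (- ln \<theta> / 2) * exp (ln \<theta>)"
      using chi by (simp add: mult_right_mono)
    also have "\<dots> = exp (ln \<theta> / 2)" by (simp flip: exp_add)
    also have "\<dots> < 1" using chi by simp
    finally have "\<omega> < 1" unfolding \<omega>_def using chi by (intro power_Suc_less_one[where n=m0, folded m_def]) auto
    moreover have \<omega>: "0 < \<omega>" using chi by (simp add: \<omega>_def)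
    ultimately have "(\<lambda>r. \<omega> ^ r) \<longlonglongrightarrow> 0" by (intro LIMSEQ_power_zero) auto
    then have "\<forall>\<^sub>F r in sequentially. \<omega> ^ r < \<eta> / (2 * c)"
      by (rule order_tendstoD) (use c \<eta> in simp)
    then obtain r where r: "r \<ge> n1" "\<omega> ^ r < \<eta> / (2 * c)"
      unfolding eventually_sequentially by (metis nle_le)
    have mr: "m * r \<ge> n1" using r by (simp add: m_def)
    have \<theta>pos: "0 < \<theta> ^ (m * r)" using chi by simp
    obtain F where F: "finite F" "\<And>L. L \<in> op_products A (m * r)
        \<Longrightarrow> blinfun_apply L ` cball 0 1 \<subseteq> (\<Union>y\<in>F. cball y (2 * \<theta> ^ (m * r)))"
      by (rule precompact_uniform_net[OF precompact_op_products[OF A] n1[OF mr], where u = "2 * \<theta> ^ (m * r)"])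
        (assumption, use \<theta>pos in simp, rule that)
    define d where "d = c * exp (5 * \<sigma> * r)"
    have "exp (5 * \<sigma> * r) * \<theta> ^ (m * r) = \<omega> ^ r"
      by (simp add: \<omega>_def \<sigma>_def power_mult power_mult_distrib exp_of_nat2_mult[symmetric] mult_ac)
    then have "d * (2 * \<theta> ^ (m * r)) = 2 * c * \<omega> ^ r" by (simp add: d_def)
    also have "\<dots> \<le> \<eta>" using r(2) c by (simp add: field_simps)
    finally have d: "d * (2 * \<theta> ^ (m * r)) \<le> \<eta>" .
    have d0: "0 \<le> d" using c by (simp add: d_def)
    show "\<exists>r F. finite F \<and> (\<forall>P\<in>op_products (op_products A m) r.
        blinfun_apply P ` cball 0 (c * exp (5 * \<sigma> * r)) \<subseteq> (\<Union>y\<in>F. cball y \<eta>))"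
    proof (intro exI conjI ballI)
      show "finite ((\<lambda>y. d *\<^sub>R y) ` F)" using F by simp
      fix P assume "P \<in> op_products (op_products A m) r"
      then have "P \<in> op_products A (m * r)" by (simp add: op_products_op_products)
      from net_scale[OF F(2)[OF this] d0]
      have "blinfun_apply P ` cball 0 d \<subseteq> (\<Union>y\<in>(\<lambda>y. d *\<^sub>R y) ` F. cball y (d * (2 * \<theta> ^ (m * r))))" .
      also have "\<dots> \<subseteq> (\<Union>y\<in>(\<lambda>y. d *\<^sub>R y) ` F. cball y \<eta>)"
        using d by (intro UN_mono subset_cball) auto
      finally show "blinfun_apply P ` cball 0 (c * exp (5 * \<sigma> * r)) \<subseteq> (\<Union>y\<in>(\<lambda>y. d *\<^sub>R y) ` F. cball y \<eta>)"
        by (simp add: d_def)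
    qed
  qed (use q \<epsilon> C in \<open>auto simp: \<sigma>_def m_def\<close>)
  then obtain l B where l: "l \<ge> n0" "B \<in> op_products A (m * l)" "exp (- (6 * \<sigma> * l)) \<le> spec_radius B"
    unfolding op_products_op_products by blast
  have "s ^ (m * l) = exp (ln s * (m * l))" unfolding exp_of_nat2_mult using s by simp
  also have "\<dots> \<le> exp (- (6 * \<sigma> * l))"
  proof -
    have "ln s * real (m * l) \<le> - (6 * (real q * \<epsilon>)) * real (m * l)"
      using q\<epsilon>(2) by (intro mult_right_mono) auto
    then show ?thesis by (simp add: \<sigma>_def mult_ac)
  qed
  also note l(3)
  finally have "s ^ (m * l) \<le> spec_radius B" .
  moreover have "n0 \<le> m * l" using l(1) by (simp add: m_def)
  ultimately show ?thesis using l by blast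
qed

section \<open>Growth rates in the extended reals and rescaling\<close>

lemma joint_radius_real:
  fixes A :: "('a::real_normed_vector \<Rightarrow>\<^sub>L 'a) set"
  assumes "A \<noteq> {}" "bounded A"
  obtains R where "0 \<le> R" "joint_radius A = ereal R"
    and "(\<lambda>n. SUP L\<in>op_products A n. ereal (root n (norm L))) \<longlonglongrightarrow> ereal R"
    and "\<And>t. R < t \<Longrightarrow> \<forall>\<^sub>F n in sequentially. \<forall>L\<in>op_products A n. norm L < t ^ n"
    and "\<And>t n. 0 \<le> t \<Longrightarrow> t < R \<Longrightarrow> n \<ge> 1 \<Longrightarrow> \<exists>L\<in>op_products A n. t ^ n < norm L"
proof (rule submultiplicative_growth[where \<nu> = norm, OF assms norm_ge_zero order_refl norm_blinfun_compose])
  fix R assume R: "0 \<le> R" "(\<lambda>n. SUP L\<in>op_products A n. ereal (root n (norm L))) \<longlonglongrightarrow> ereal R"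
    "\<And>t. R < t \<Longrightarrow> \<forall>\<^sub>F n in sequentially. \<forall>L\<in>op_products A n. norm L < t ^ n"
    "\<And>t n. 0 \<le> t \<Longrightarrow> t < R \<Longrightarrow> n \<ge> 1 \<Longrightarrow> \<exists>L\<in>op_products A n. t ^ n < norm L"
  have "joint_radius A = ereal R" unfolding joint_radius_def using R(2) by (rule limI)
  then show thesis using that[OF R(1) _ R(2,3,4)] by simp
qed

lemma radius_chi_real:
  fixes A :: "('a::real_normed_vector \<Rightarrow>\<^sub>L 'a) set"
  assumes "A \<noteq> {}" "bounded A"
  obtains R where "0 \<le> R" "radius_chi A = ereal R"
    and "(\<lambda>n. SUP L\<in>op_products A n. ereal (root n (norm_chi L))) \<longlonglongrightarrow> ereal R"
    and "\<And>t. R < t \<Longrightarrow> \<forall>\<^sub>F n in sequentially. \<forall>L\<in>op_products A n. norm_chi L < t ^ n"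
proof (rule submultiplicative_growth[where \<nu> = norm_chi, OF assms norm_chi_nonneg norm_chi_le_norm norm_chi_compose])
  fix R assume R: "0 \<le> R" "(\<lambda>n. SUP L\<in>op_products A n. ereal (root n (norm_chi L))) \<longlonglongrightarrow> ereal R"
    "\<And>t. R < t \<Longrightarrow> \<forall>\<^sub>F n in sequentially. \<forall>L\<in>op_products A n. norm_chi L < t ^ n"
    "\<And>t n. 0 \<le> t \<Longrightarrow> t < R \<Longrightarrow> n \<ge> 1 \<Longrightarrow> \<exists>L\<in>op_products A n. t ^ n < norm_chi L"
  have "radius_chi A = ereal R" unfolding radius_chi_def using R(2) by (rule limI)
  then show thesis using that[OF R(1) _ R(2,3)] by simp
qed

theorem joint_radius_eq_max:
  fixes A :: "('a::real_normed_vector \<Rightarrow>\<^sub>L 'a) set"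
  assumes ne: "A \<noteq> {}" and A: "compact (closure A)"
  shows "joint_radius A = max (radius_chi A) (radius_r A)"
proof -
  have bdd: "bounded A" using compact_imp_bounded[OF A] closure_subset by (rule bounded_subset)
  obtain R where R: "0 \<le> R" "joint_radius A = ereal R"
    "(\<lambda>n. SUP L\<in>op_products A n. ereal (root n (norm L))) \<longlonglongrightarrow> ereal R"
    "\<And>t. R < t \<Longrightarrow> \<forall>\<^sub>F n in sequentially. \<forall>L\<in>op_products A n. norm L < t ^ n"
    "\<And>t n. 0 \<le> t \<Longrightarrow> t < R \<Longrightarrow> n \<ge> 1 \<Longrightarrow> \<exists>L\<in>op_products A n. t ^ n < norm L"
    by (rule joint_radius_real[OF ne bdd]) (rule that)
  obtain X where X: "0 \<le> X" "radius_chi A = ereal X"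
    "(\<lambda>n. SUP L\<in>op_products A n. ereal (root n (norm_chi L))) \<longlonglongrightarrow> ereal X"
    "\<And>t. X < t \<Longrightarrow> \<forall>\<^sub>F n in sequentially. \<forall>L\<in>op_products A n. norm_chi L < t ^ n"
    by (rule radius_chi_real[OF ne bdd]) (rule that)
  have root_le: "root n x \<le> root n y" if "x \<le> y" for n and x y :: real
    using that by (cases "n = 0") auto
  have "radius_chi A \<le> joint_radius A"
    unfolding X R using X(3) R(3)
    by (rule LIMSEQ_le) (auto intro!: SUP_mono' root_le norm_chi_le_norm)
  moreover have "radius_r A \<le> joint_radius A"
  proof -
    have "radius_r A \<le> limsup (\<lambda>n. SUP L\<in>op_products A n. ereal (root n (norm L)))"
      unfolding radius_r_def
      by (intro Limsup_mono always_eventually allI SUP_mono') (simp add: root_le spec_radius_le_norm)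
    also have "\<dots> = ereal R" using R(3) by (intro lim_imp_Limsup) auto
    finally show ?thesis using R by simp
  qed
  moreover have "\<not> max (radius_chi A) (radius_r A) < joint_radius A"
  proof
    assume "max (radius_chi A) (radius_r A) < joint_radius A"
    then obtain t' where "max (radius_chi A) (radius_r A) < t'" "t' < ereal R"
      unfolding R using dense by blast
    moreover from this obtain t where "t' = ereal t"
      using X by (cases t') auto
    ultimately have t: "X < t" "radius_r A < ereal t" "t < R" using X by auto
    have t0: "0 < t" "0 < R" using X t by auto
    have "\<forall>\<^sub>F n in sequentially. (SUP L\<in>op_products A n. ereal (root n (spec_radius L))) < ereal t"
      using t(2) unfolding radius_r_def by (rule Limsup_lessD)
    then obtain n1 where n1: "\<And>n. n \<ge> n1 \<Longrightarrow> (SUP L\<in>op_products A n. ereal (root n (spec_radius L))) < ereal t"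
      unfolding eventually_sequentially by blast
    \<comment> \<open>\<open>Suc n1\<close> keeps \<open>n\<close> positive, as
      \<open>root 0\<close> is identically 0.\<close>
    have spec: "spec_radius L < t ^ n" if "n \<ge> Suc n1" "L \<in> op_products A n" for n L
    proof -
      have "ereal (root n (spec_radius L)) < ereal t"
        using n1[of n] that by (meson SUP_upper Suc_leD le_less_trans)
      then have "root n (spec_radius L) ^ n < t ^ n"
        using that spec_radius_nonneg by (intro power_strict_mono) (auto simp: real_root_ge_zero)
      then show ?thesis using that(1) spec_radius_nonneg[of L] by simp
    qed
    \<comment> \<open>After rescaling by 1 / R, which is possible as
      \<open>R > t > X \<ge> 0\<close>, c u serves as the bound for \<open>norm_chi\<close> and c t
      as the spectral growth that contradicts \<open>spec\<close>.\<close>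
    obtain u where u: "X < u" "u < t" using t dense by blast
    define c where "c = 1 / R"
    define A' where "A' = (\<lambda>L. c *\<^sub>R L) ` A"
    have c: "0 < c" "c * R = 1" using t0 by (auto simp: c_def)
    have A'n: "op_products A' n = (\<lambda>L. c ^ n *\<^sub>R L) ` op_products A n" for n
      unfolding A'_def by (rule op_products_scaleR)
    have "\<exists>n\<ge>Suc n1. \<exists>B\<in>op_products A' n. (c * t) ^ n \<le> spec_radius B"
    proof (rule spec_radius_growth_normalized)
      show "A' \<noteq> {}" using ne by (simp add: A'_def)
      show "compact (closure A')"
        using compact_scaling[OF A, of c] unfolding A'_def by (simp add: closure_scaleR)
    next
      fix t :: real assume "1 < t"
      then have "R < R * t" using t0 by simp
      from R(4)[OF this]
      show "\<forall>\<^sub>F n in sequentially. \<forall>L\<in>op_products A' n. norm L < t ^ n"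
      proof eventually_elim
        case (elim n)
        have "c ^ n * norm L < t ^ n" if "L \<in> op_products A n" for L
        proof -
          have "c ^ n * norm L < c ^ n * (R * t) ^ n" using elim that c by simp
          also have "\<dots> = (c * R * t) ^ n" by (simp add: power_mult_distrib)
          finally show ?thesis using c by simp
        qed
        then show ?case unfolding A'n using c by simp
      qed
    next
      fix t :: real and n :: nat assume "0 \<le> t" "t < 1" "1 \<le> n"
      then have "0 \<le> R * t" "R * t < R" using t0 by auto
      from R(5)[OF this \<open>1 \<le> n\<close>] obtain L where L: "L \<in> op_products A n" "(R * t) ^ n < norm L" by blast
      have "t ^ n = (c * R * t) ^ n" using c by simp
      also have "\<dots> = c ^ n * (R * t) ^ n" by (simp add: power_mult_distrib)
      also have "\<dots> < c ^ n * norm L" using L c by simp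
      also have "\<dots> = norm (c ^ n *\<^sub>R L)" using c by simp
      finally show "\<exists>L\<in>op_products A' n. t ^ n < norm L" unfolding A'n using L by blast
    next
      show "0 < c * u" using c u X by simp
      show "c * u < 1" using u t t0 by (simp add: c_def)
      show "\<forall>\<^sub>F n in sequentially. \<forall>L\<in>op_products A' n. norm_chi L < (c * u) ^ n"
        using X(4)[OF u(1)]
      proof eventually_elim
        case (elim n)
        have "norm_chi (c ^ n *\<^sub>R L) < (c * u) ^ n" if "L \<in> op_products A n" for L
        proof -
          have "norm_chi (c ^ n *\<^sub>R L) \<le> c ^ n * norm_chi L" using norm_chi_scaleR_le[of "c ^ n" L] c by simp
          also have "\<dots> < c ^ n * u ^ n" using elim that c by simp
          finally show ?thesis by (simp add: power_mult_distrib)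
        qed
        then show ?case unfolding A'n by simp
      qed
    next
      show "0 < c * t" using c t0 by simp
      show "c * t < 1" using t t0 by (simp add: c_def)
    qed
    then obtain n L where n: "n \<ge> Suc n1" "L \<in> op_products A n" "(c * t) ^ n \<le> spec_radius (c ^ n *\<^sub>R L)"
      unfolding A'n by blast
    have "c ^ n * t ^ n \<le> c ^ n * spec_radius L"
      using n(3) c by (simp add: spec_radius_scaleR power_mult_distrib)
    then have "t ^ n \<le> spec_radius L" using c by simp
    with spec[OF n(1,2)] show False by simp
  qed
  ultimately show ?thesis by (intro antisym) (auto simp: not_less)
qed

section \<open>Hahn-Banach and Auerbach\<close>

lemma norm_det_le:
  fixes B :: "'k::real_normed_field Matrix.mat"
  assumes B: "B \<in> carrier_mat n n" and C: "\<And>i j. i < n \<Longrightarrow> j < n \<Longrightarrow> norm (B $$ (i, j)) \<le> C"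
  shows "norm (Determinant.det B) \<le> fact n * C ^ n"
proof -
  have "norm (signof p * (\<Prod>i = 0..<n. B $$ (i, p i))) \<le> C ^ n" if p: "p permutes {0..<n}" for p
  proof -
    have "norm (\<Prod>i = 0..<n. B $$ (i, p i)) = (\<Prod>i = 0..<n. norm (B $$ (i, p i)))" by (rule prod_norm[symmetric])
    also have "\<dots> \<le> (\<Prod>i = 0..<n. C)"
      using permutes_in_image[OF p] by (intro prod_mono) (auto intro!: C)
    finally show ?thesis by (simp add: norm_mult sign_def)
  qed
  then have "norm (Determinant.det B) \<le> (\<Sum>p\<in>{p. p permutes {0..<n}}. C ^ n)"
    unfolding det_def'[OF B] by (intro sum_norm_le) auto
  also have "\<dots> = fact n * C ^ n" by (simp add: card_permutations[of _ n])
  finally show ?thesis .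
qed

text \<open>An Auerbach system up to a factor 2, in coordinates: the vectors \<open>x j\<close> nearly maximise the determinant
  over \<open>U\<close>, so that Cramer's rule bounds the dual coordinates \<open>h\<close> on \<open>U\<close>.\<close>

lemma auerbach_coordinates:
  fixes U :: "(nat \<Rightarrow> 'k::real_normed_field) set"
  assumes bound: "\<And>u i. u \<in> U \<Longrightarrow> i < n \<Longrightarrow> norm (u i) \<le> C"
    and axes: "r \<noteq> 0" "\<And>j. j < n \<Longrightarrow> \<exists>u\<in>U. \<forall>i<n. u i = (if i = j then r else 0)"
  obtains x h where "\<And>j. j < n \<Longrightarrow> x j \<in> U"
    and "\<And>w l. l < n \<Longrightarrow> (\<Sum>j<n. x j l * (\<Sum>m<n. h j m * w m)) = w l"
    and "\<And>u i. u \<in> U \<Longrightarrow> i < n \<Longrightarrow> norm (\<Sum>m<n. h i m * u m) \<le> 2"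
proof -
  define X where "X = {x :: nat \<Rightarrow> nat \<Rightarrow> 'k. \<forall>j<n. x j \<in> U}"
  define M where "M x = Matrix.mat n n (\<lambda>(i, j). x j i)" for x :: "nat \<Rightarrow> nat \<Rightarrow> 'k"
  define V where "V x = norm (Determinant.det (M x))" for x
  have M: "M x \<in> carrier_mat n n" for x by (simp add: M_def)
  have "V x \<le> fact n * C ^ n" if "x \<in> X" for x
    unfolding V_def using that by (intro norm_det_le[OF M]) (auto simp: M_def X_def intro!: bound)
  then have bdd: "bdd_above (V ` X)" by (intro bdd_aboveI2)
  obtain x0 where x0: "\<And>j. j < n \<Longrightarrow> x0 j \<in> U" "\<And>i j. j < n \<Longrightarrow> i < n \<Longrightarrow> x0 j i = (if i = j then r else 0)"
    using axes(2) by metis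
  \<comment> \<open>The points on the axes give a nonzero determinant, so the supremum is positive
    and the later division by \<open>d\<close> is legitimate.\<close>
  have "M x0 = r \<cdot>\<^sub>m 1\<^sub>m n" unfolding M_def by (rule eq_matI) (auto simp: x0)
  then have "V x0 \<noteq> 0" using axes(1) by (simp add: V_def)
  moreover have x0X: "x0 \<in> X" using x0 by (simp add: X_def)
  ultimately have s: "0 < Sup (V ` X)"
    using cSUP_upper[OF x0X bdd] norm_ge_zero unfolding V_def by (metis less_le_trans zero_less_norm_iff norm_eq_zero)
  \<comment> \<open>The supremum need not be attained, so half of it has to do. This is the origin
    of the factor 2 in all Auerbach estimates.\<close>
  then have "\<exists>x\<in>X. Sup (V ` X) / 2 < V x"
    using less_cSUP_iff[of X V "Sup (V ` X) / 2"] bdd x0X by auto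
  then obtain x where x: "x \<in> X" "Sup (V ` X) / 2 < V x" by blast
  define d where "d = Determinant.det (M x)"
  have d: "d \<noteq> 0" using x(2) s by (auto simp: d_def V_def)
  define h where "h j m = adj_mat (M x) $$ (j, m) / d" for j m
  have adj: "adj_mat (M x) \<in> carrier_mat n n" "M x * adj_mat (M x) = d \<cdot>\<^sub>m 1\<^sub>m n"
    using adj_mat[OF M] by (auto simp: d_def)
  have inv: "(\<Sum>j<n. x j l * h j m) = (if l = m then 1 else 0)" if "l < n" "m < n" for l m
  proof -
    have "(M x * adj_mat (M x)) $$ (l, m) = (\<Sum>j<n. x j l * adj_mat (M x) $$ (j, m))"
      using that M[of x] adj(1) by (simp add: scalar_prod_def M_def atLeast0LessThan)
    then have "(\<Sum>j<n. x j l * adj_mat (M x) $$ (j, m)) = (if l = m then d else 0)"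
      unfolding adj(2) using that by (cases "l = m") auto
    then show ?thesis using d by (simp add: h_def flip: sum_divide_distrib)
  qed
  have dual: "(\<Sum>j<n. x j l * (\<Sum>m<n. h j m * w m)) = w l" if "l < n" for w l
  proof -
    have "(\<Sum>j<n. x j l * (\<Sum>m<n. h j m * w m)) = (\<Sum>m<n. (\<Sum>j<n. x j l * h j m) * w m)"
      unfolding sum_distrib_left sum_distrib_right by (subst sum.swap) (simp add: mult.assoc)
    also have "\<dots> = (\<Sum>m<n. (if l = m then 1 else 0) * w m)"
      using that by (intro sum.cong) (auto simp: inv)
    also have "\<dots> = w l" using that by (simp add: if_distrib[where f = "\<lambda>z. z * _"] cong: if_cong)
    finally show ?thesis .
  qed
  have "norm (\<Sum>m<n. h i m * u m) \<le> 2" if u: "u \<in> U" and i: "i < n" for u i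
  proof -
    define c where "c = Matrix.vec n (\<lambda>j. \<Sum>m<n. h j m * u m)"
    have c: "c \<in> carrier_vec n" by (simp add: c_def)
    have "M x *\<^sub>v c = Matrix.vec n u"
    proof (rule eq_vecI)
      fix l assume l: "l < dim_vec (Matrix.vec n u)"
      then show "vec_index (M x *\<^sub>v c) l = vec_index (Matrix.vec n u) l"
        using dual[of l u] by (simp add: M_def c_def scalar_prod_def atLeast0LessThan)
    qed (simp add: M_def)
    moreover have "replace_col (M x) (Matrix.vec n u) i = M (x(i := u))"
      unfolding replace_col_def M_def by (rule eq_matI) auto
    ultimately have "Determinant.det (M (x(i := u))) = vec_index c i * d"
      using cramer_lemma_mat[OF M c i, of x] by (simp add: d_def)
    then have "norm (vec_index c i) * V x = V (x(i := u))"
      by (simp add: V_def d_def norm_mult)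
    also have "\<dots> \<le> Sup (V ` X)" using x u by (intro cSUP_upper bdd) (auto simp: X_def)
    also have "\<dots> \<le> 2 * V x" using x by simp
    finally have "norm (vec_index c i) \<le> 2" using d by (simp add: V_def d_def)
    then show ?thesis using i by (simp add: c_def)
  qed
  then show ?thesis using x dual that unfolding X_def by blast
qed

text \<open>Homogeneity is stated as an inequality for positive scalars, so that checks on infima
  are one-sided; applying it to c and 1 / c gives equality.\<close>

definition sublinear :: "('a::real_vector \<Rightarrow> real) \<Rightarrow> bool" where
  "sublinear p \<longleftrightarrow> (\<forall>x y. p (x + y) \<le> p x + p y) \<and> (\<forall>c>0. \<forall>x. p (c *\<^sub>R x) \<le> c * p x)"

lemma sublinear_add: "sublinear p \<Longrightarrow> p (x + y) \<le> p x + p y"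
  by (simp add: sublinear_def)

lemma sublinear_0:
  assumes "sublinear p"
  shows "p 0 = 0"
proof -
  have "p (c *\<^sub>R 0) \<le> c * p 0" if "0 < c" for c using assms that unfolding sublinear_def by blast
  from this[of 2] this[of "1/2"] show ?thesis by simp
qed

lemma sublinear_scaleR:
  assumes p: "sublinear p" and "0 < c"
  shows "p (c *\<^sub>R x) = c * p x"
proof (rule antisym)
  show "p (c *\<^sub>R x) \<le> c * p x" using assms by (simp add: sublinear_def)
  have "p ((1 / c) *\<^sub>R (c *\<^sub>R x)) \<le> (1 / c) * p (c *\<^sub>R x)"
    using p \<open>0 < c\<close> unfolding sublinear_def by (meson zero_less_divide_1_iff)
  then show "c * p x \<le> p (c *\<^sub>R x)" using \<open>0 < c\<close> by (simp add: field_simps)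
qed

lemma sublinear_minus: "sublinear p \<Longrightarrow> - p (- x) \<le> p x"
  using sublinear_add[of p x "- x"] sublinear_0[of p] by simp

text \<open>The index \<open>k\<close> may depend on both \<open>i\<close> and \<open>j\<close>.
  This covers the three infima used below: over a half-line of translations, over a chain and over a
  subspace.\<close>

lemma sublinear_INF:
  fixes \<Phi> :: "'i \<Rightarrow> 'a::real_vector \<Rightarrow> real"
  assumes ne: "I \<noteq> {}" and bdd: "\<And>x. bdd_below ((\<lambda>i. \<Phi> i x) ` I)"
    and add: "\<And>i j x y. i \<in> I \<Longrightarrow> j \<in> I \<Longrightarrow> \<exists>k\<in>I. \<Phi> k (x + y) \<le> \<Phi> i x + \<Phi> j y"
    and scale: "\<And>i c x. i \<in> I \<Longrightarrow> 0 < c \<Longrightarrow> \<exists>k\<in>I. \<Phi> k (c *\<^sub>R x) \<le> c * \<Phi> i x"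
  shows "sublinear (\<lambda>x. INF i\<in>I. \<Phi> i x)"
  unfolding sublinear_def
proof (intro conjI allI impI)
  have le: "(INF i\<in>I. \<Phi> i x) \<le> \<Phi> k x" if "k \<in> I" for k x
    using bdd that by (rule cINF_lower)
  fix x y
  have "(INF i\<in>I. \<Phi> i (x + y)) - \<Phi> j y \<le> (INF i\<in>I. \<Phi> i x)" if j: "j \<in> I" for j
  proof (rule cINF_greatest[OF ne])
    fix i assume "i \<in> I"
    from add[OF this j] obtain k where "k \<in> I" "\<Phi> k (x + y) \<le> \<Phi> i x + \<Phi> j y" by blast
    with le[of k "x + y"] show "(INF i\<in>I. \<Phi> i (x + y)) - \<Phi> j y \<le> \<Phi> i x" by linarith
  qed
  then have "(INF i\<in>I. \<Phi> i (x + y)) - (INF i\<in>I. \<Phi> i x) \<le> (INF i\<in>I. \<Phi> i y)"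
    by (intro cINF_greatest[OF ne]) (simp add: algebra_simps)
  then show "(INF i\<in>I. \<Phi> i (x + y)) \<le> (INF i\<in>I. \<Phi> i x) + (INF i\<in>I. \<Phi> i y)" by simp
next
  fix c :: real and x assume c: "0 < c"
  have "(INF i\<in>I. \<Phi> i (c *\<^sub>R x)) / c \<le> (INF i\<in>I. \<Phi> i x)"
  proof (rule cINF_greatest[OF ne])
    fix i assume "i \<in> I"
    from scale[OF this c] obtain k where k: "k \<in> I" "\<Phi> k (c *\<^sub>R x) \<le> c * \<Phi> i x" by blast
    have "(INF i\<in>I. \<Phi> i (c *\<^sub>R x)) \<le> \<Phi> k (c *\<^sub>R x)" using bdd k(1) by (rule cINF_lower)
    with k show "(INF i\<in>I. \<Phi> i (c *\<^sub>R x)) / c \<le> \<Phi> i x" using c by (simp add: field_simps)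
  qed
  then show "(INF i\<in>I. \<Phi> i (c *\<^sub>R x)) \<le> c * (INF i\<in>I. \<Phi> i x)" using c by (simp add: field_simps)
qed

text \<open>The infimum over t \<ge> 0 of F (x + t y) - t F y is sublinear and lies below
  \<open>F\<close>, hence equals \<open>F\<close>; taking t = 1 gives superadditivity.\<close>

lemma minimal_sublinear_linear:
  assumes F: "sublinear F" and min: "\<And>r. sublinear r \<Longrightarrow> (\<And>x. r x \<le> F x) \<Longrightarrow> r = F"
  shows "linear F"
proof -
  have super: "F x + F y \<le> F (x + y)" for x y
  proof -
    define \<Phi> where "\<Phi> t x = F (x + t *\<^sub>R y) - t * F y" for t x
    define r where "r x = (INF t\<in>{0..}. \<Phi> t x)" for x
    have low: "- F (- x) \<le> \<Phi> t x" if "0 \<le> t" for t x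
    proof -
      have "F (t *\<^sub>R y) = t * F y" using that sublinear_scaleR[OF F, of t y] sublinear_0[OF F] by (cases "t = 0") auto
      then show ?thesis using sublinear_add[OF F, of "x + t *\<^sub>R y" "- x"] by (simp add: \<Phi>_def)
    qed
    then have bdd: "bdd_below ((\<lambda>t. \<Phi> t x) ` {0..})" for x by (intro bdd_belowI2) auto
    have "sublinear r"
      unfolding r_def
    proof (rule sublinear_INF[OF _ bdd])
      fix s t :: real and x z assume st: "s \<in> {0..}" "t \<in> {0..}"
      have "F ((x + z) + (s + t) *\<^sub>R y) \<le> F (x + s *\<^sub>R y) + F (z + t *\<^sub>R y)"
        using sublinear_add[OF F, of "x + s *\<^sub>R y" "z + t *\<^sub>R y"] by (simp add: algebra_simps)
      then show "\<exists>k\<in>{0..}. \<Phi> k (x + z) \<le> \<Phi> s x + \<Phi> t z"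
        using st by (intro bexI[of _ "s + t"]) (auto simp: \<Phi>_def algebra_simps)
    next
      fix s c :: real and x assume s: "s \<in> {0..}" "0 < c"
      have "F (c *\<^sub>R x + (c * s) *\<^sub>R y) = c * F (x + s *\<^sub>R y)"
        using sublinear_scaleR[OF F s(2), of "x + s *\<^sub>R y"] by (simp add: algebra_simps)
      then show "\<exists>k\<in>{0..}. \<Phi> k (c *\<^sub>R x) \<le> c * \<Phi> s x"
        using s by (intro bexI[of _ "c * s"]) (auto simp: \<Phi>_def algebra_simps)
    qed simp
    moreover have rle: "r x \<le> \<Phi> t x" if "0 \<le> t" for t x
      unfolding r_def using bdd that by (intro cINF_lower) auto
    moreover have "r x \<le> F x" for x using rle[of 0 x] by (simp add: \<Phi>_def)
    ultimately have "r = F" using min by blast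
    then show ?thesis using rle[of 1 x] by (simp add: \<Phi>_def)
  qed
  have add: "F (x + y) = F x + F y" for x y using super sublinear_add[OF F] by (simp add: antisym)
  have neg: "F (- x) = - F x" for x using add[of x "- x"] sublinear_0[OF F] by simp
  have "F (c *\<^sub>R x) = c * F x" for c x
  proof -
    consider "0 < c" | "c = 0" | "0 < - c" by linarith
    then show ?thesis
    proof cases
      case 1
      then show ?thesis by (rule sublinear_scaleR[OF F])
    next
      case 2
      then show ?thesis by (simp add: sublinear_0[OF F])
    next
      case 3
      then have "F (- c *\<^sub>R x) = - c * F x" by (rule sublinear_scaleR[OF F])
      then show ?thesis using neg[of "c *\<^sub>R x"] by simp
    qed
  qed
  with add show ?thesis by (intro linearI) auto
qed

text \<open>Zorn's lemma. Infima of chains stay finite because every sublinear q \<le> p satisfies -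
  p (- x) \<le> q x.\<close>

lemma minimal_sublinear_exists:
  fixes p :: "'a::real_vector \<Rightarrow> real"
  assumes p: "sublinear p"
  obtains F where "sublinear F" "\<And>x. F x \<le> p x" "\<And>r. sublinear r \<Longrightarrow> (\<And>x. r x \<le> F x) \<Longrightarrow> r = F"
proof -
  define S where "S = {q. sublinear q \<and> q \<le> p}"
  have "\<exists>m\<in>S. \<forall>a\<in>S. a \<le> m \<longrightarrow> a = m"
  proof (rule predicate_Zorn)
    show "partial_order_on S (relation_of (\<lambda>a b. b \<le> a) S)"
      by (rule partial_order_on_relation_ofI) auto
  next
    fix C assume C: "C \<in> Chains (relation_of (\<lambda>a b. b \<le> a) S)"
    then have CS: "C \<subseteq> S" and chain: "\<And>q r. q \<in> C \<Longrightarrow> r \<in> C \<Longrightarrow> q \<le> r \<or> r \<le> q"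
      by (auto simp: Chains_def relation_of_def)
    show "\<exists>u\<in>S. \<forall>q\<in>C. u \<le> q"
    proof (cases "C = {}")
      case True
      then show ?thesis using p by (intro bexI[of _ p]) (auto simp: S_def)
    next
      case False
      define u where "u x = (INF q\<in>C. q x)" for x
      have "- p (- x) \<le> q x" if "q \<in> C" for q x
        using CS that sublinear_minus[of q x] by (force simp: S_def le_fun_def intro: order_trans[rotated])
      then have bdd: "bdd_below ((\<lambda>q. q x) ` C)" for x by (intro bdd_belowI2)
      have ule: "u x \<le> q x" if "q \<in> C" for q x unfolding u_def using bdd that by (rule cINF_lower)
      have "sublinear u"
        unfolding u_def
      proof (rule sublinear_INF[OF False bdd])
        fix q r x y assume qr: "q \<in> C" "r \<in> C"
        show "\<exists>k\<in>C. k (x + y) \<le> q x + r y"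
        proof (cases "q \<le> r")
          case True
          have "q (x + y) \<le> q x + q y" using qr CS by (auto simp: S_def intro: sublinear_add)
          then show ?thesis using True qr by (intro bexI[of _ q]) (auto simp: le_fun_def intro: order_trans)
        next
          case False
          then have "r \<le> q" using chain qr by blast
          moreover have "r (x + y) \<le> r x + r y" using qr CS by (auto simp: S_def intro: sublinear_add)
          ultimately show ?thesis using qr by (intro bexI[of _ r]) (auto simp: le_fun_def intro: order_trans)
        qed
      next
        fix q x and c :: real assume "q \<in> C" "0 < c"
        then show "\<exists>k\<in>C. k (c *\<^sub>R x) \<le> c * q x"
          using CS sublinear_scaleR[of q c x] by (intro bexI[of _ q]) (auto simp: S_def)
      qed
      moreover obtain q where "q \<in> C" using False by blast
      then have "u \<le> p" using ule[of q] CS by (auto simp: S_def le_fun_def intro: order_trans)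
      ultimately show ?thesis using ule by (intro bexI[of _ u]) (auto simp: S_def le_fun_def)
    qed
  qed
  then obtain F where F: "F \<in> S" "\<And>a. a \<in> S \<Longrightarrow> a \<le> F \<Longrightarrow> a = F" by blast
  show ?thesis
  proof (rule that)
    show "sublinear F" "F x \<le> p x" for x using F(1) by (auto simp: S_def le_fun_def)
    fix r assume "sublinear r" "\<And>x. r x \<le> F x"
    then show "r = F" using F by (intro F(2)) (auto simp: S_def le_fun_def intro: order_trans)
  qed
qed

text \<open>The functional \<open>p0\<close>, an infimal convolution of \<open>p\<close> with
  \<open>f\<close> on \<open>G\<close>, is sublinear, at most \<open>p\<close>, and at most
  \<open>f\<close> on \<open>G\<close>. A minimal sublinear functional below \<open>p0\<close> is
  linear, and on a subspace F \<le> f forces equality by passing to negatives.\<close>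

theorem hahn_banach_real:
  fixes p :: "'a::real_vector \<Rightarrow> real"
  assumes p: "sublinear p" and G: "subspace G"
    and f: "\<And>x y. x \<in> G \<Longrightarrow> y \<in> G \<Longrightarrow> f (x + y) = f x + f y"
      "\<And>c x. x \<in> G \<Longrightarrow> f (c *\<^sub>R x) = c * f x"
    and le: "\<And>x. x \<in> G \<Longrightarrow> f x \<le> p x"
  obtains F where "linear F" "\<And>x. F x \<le> p x" "\<And>x. x \<in> G \<Longrightarrow> F x = f x"
proof -
  have fneg: "f (- x) = - f x" if "x \<in> G" for x using f(2)[OF that, of "-1"] by simp
  define \<Phi> where "\<Phi> g x = p (x - g) + f g" for g x
  define p0 where "p0 x = (INF g\<in>G. \<Phi> g x)" for x
  have low: "- p (- x) \<le> \<Phi> g x" if "g \<in> G" for g x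
  proof -
    have "f (- g) \<le> p (- g)" using le subspace_neg[OF G that] .
    also have "\<dots> \<le> p (x - g) + p (- x)" using sublinear_add[OF p, of "x - g" "- x"] by simp
    finally show ?thesis using fneg[OF that] by (simp add: \<Phi>_def)
  qed
  then have bdd: "bdd_below ((\<lambda>g. \<Phi> g x) ` G)" for x by (intro bdd_belowI2)
  have "G \<noteq> {}" using subspace_0[OF G] by blast
  have "sublinear p0"
    unfolding p0_def
  proof (rule sublinear_INF[OF \<open>G \<noteq> {}\<close> bdd])
    fix g h x y assume gh: "g \<in> G" "h \<in> G"
    have "p (x + y - (g + h)) \<le> p (x - g) + p (y - h)"
      using sublinear_add[OF p, of "x - g" "y - h"] by (simp add: algebra_simps)
    then show "\<exists>k\<in>G. \<Phi> k (x + y) \<le> \<Phi> g x + \<Phi> h y"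
      using gh f(1)[OF gh] subspace_add[OF G gh] by (intro bexI[of _ "g + h"]) (auto simp: \<Phi>_def)
  next
    fix g x and c :: real assume g: "g \<in> G" and c: "0 < c"
    have "p (c *\<^sub>R x - c *\<^sub>R g) = c * p (x - g)"
      using sublinear_scaleR[OF p c, of "x - g"] by (simp add: algebra_simps)
    then show "\<exists>k\<in>G. \<Phi> k (c *\<^sub>R x) \<le> c * \<Phi> g x"
      using f(2)[OF g] subspace_scale[OF G g] by (intro bexI[of _ "c *\<^sub>R g"]) (auto simp: \<Phi>_def algebra_simps)
  qed
  then obtain F where F: "sublinear F" "\<And>x. F x \<le> p0 x"
      "\<And>r. sublinear r \<Longrightarrow> (\<And>x. r x \<le> F x) \<Longrightarrow> r = F"
    using minimal_sublinear_exists by blast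
  have lin: "linear F" using F(1,3) by (rule minimal_sublinear_linear)
  have p0: "p0 x \<le> \<Phi> g x" if "g \<in> G" for g x unfolding p0_def using bdd that by (rule cINF_lower)
  have f0: "f 0 = 0" using f(2)[OF subspace_0[OF G], of 0] by simp
  have Fp: "F x \<le> p x" for x
    using F(2)[of x] p0[OF subspace_0[OF G], of x] by (simp add: \<Phi>_def f0)
  have Ff: "F g \<le> f g" if "g \<in> G" for g
    using F(2)[of g] p0[OF that, of g] sublinear_0[OF p] by (simp add: \<Phi>_def)
  have "F g = f g" if "g \<in> G" for g
    using Ff[OF that] Ff[OF subspace_neg[OF G that]] fneg[OF that] linear_neg[OF lin, of g] by linarith
  with lin Fp show ?thesis using that by blast
qed

text \<open>On a field as in \<^locale>\<open>banach_over\<close>, multiplication by \<open>c\<close> and by \<open>conjugate c\<close> are adjoint for the inner product.\<close>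

definition conjugate :: "'k::{real_normed_field, euclidean_space} \<Rightarrow> 'k" where
  "conjugate c = (norm c)\<^sup>2 *\<^sub>R inverse c"

text \<open>By polarization: multiplication by \<open>c\<close> scales every norm by
  \<open>norm c\<close>.\<close>

lemma inner_mult_mult:
  fixes c :: "'k::{real_normed_field, euclidean_space}"
  shows "inner (c * x) (c * y) = (norm c)\<^sup>2 * inner x y"
  unfolding dot_norm distrib_left[symmetric] norm_mult power_mult_distrib
  by (simp add: right_diff_distrib)

lemma inner_mult_conjugate:
  fixes c :: "'k::{real_normed_field, euclidean_space}"
  shows "inner (c * x) y = inner x (conjugate c * y)"
proof (cases "c = 0")
  case False
  then show ?thesis using inner_mult_mult[of c x "inverse c * y"]
    by (simp add: conjugate_def mult.assoc[symmetric])
qed (simp add: conjugate_def)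

text \<open>The formula does not show additivity, but adjoints are additive.\<close>

lemma conjugate_add: "conjugate (c + d) = conjugate c + conjugate d"
proof -
  have "inner x (conjugate (c + d)) = inner x (conjugate c + conjugate d)" for x
  proof -
    have "inner x (conjugate (c + d) * 1) = inner ((c + d) * x) 1" by (rule inner_mult_conjugate[symmetric])
    also have "\<dots> = inner (c * x) 1 + inner (d * x) 1" by (simp add: distrib_right inner_add_left)
    also have "\<dots> = inner x (conjugate c * 1 + conjugate d * 1)"
      by (simp only: inner_mult_conjugate inner_add_right)
    finally show ?thesis by simp
  qed
  then show ?thesis using vector_eq_ldot by blast
qed

lemma conjugate_scaleR: "conjugate (r *\<^sub>R c) = r *\<^sub>R conjugate c"
  by (cases "r = 0") (simp_all add: conjugate_def power_mult_distrib inverse_scaleR_distrib power2_eq_square[of r])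

lemma norm_conjugate: "norm (conjugate c) = norm c"
  by (cases "c = 0") (simp_all add: conjugate_def norm_inverse power2_eq_square)

lemma conjugate_conjugate: "conjugate (conjugate c) = c"
  unfolding conjugate_def[of "conjugate c"] norm_conjugate
  by (cases "c = 0") (simp_all add: conjugate_def inverse_scaleR_distrib)

lemma conjugate_mult: "conjugate (c * d) = conjugate c * conjugate d"
  by (simp add: conjugate_def norm_mult power_mult_distrib mult_ac)

lemma conjugate_sum: "conjugate (\<Sum>i\<in>I. f i) = (\<Sum>i\<in>I. conjugate (f i))"
  by (induction I rule: infinite_finite_induct) (simp_all add: conjugate_add, simp_all add: conjugate_def)

context banach_over
begin

lemma scale_scaleR_left: "scaleK (r *\<^sub>R c) x = r *\<^sub>R scaleK c x"
  by (simp add: scaleR_conv_of_real flip: scale_of_real)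

text \<open>The familiar passage from a real functional \<open>\<phi>\<close> to the complex functional
  \<open>x \<mapsto> \<phi> x - \<i> \<phi> (\<i> x)\<close>, for all admissible fields at once.\<close>

lemma functional_of_real_functional:
  fixes \<phi> :: "'a \<Rightarrow> real"
  assumes \<phi>: "linear \<phi>" and bound: "\<And>x. \<phi> x \<le> M * norm x"
  obtains f :: "'a \<Rightarrow> 'k" where "\<And>x y. f (x + y) = f x + f y" "\<And>c x. f (scaleK c x) = c * f x"
    and "\<And>x. norm (f x) \<le> M * norm x" "\<And>x c. inner (f x) c = \<phi> (scaleK (conjugate c) x)"
proof -
  define f where "f x = (\<Sum>b\<in>Basis. \<phi> (scaleK (conjugate b) x) *\<^sub>R b)" for x :: 'a
  have inner: "inner (f x) c = \<phi> (scaleK (conjugate c) x)" for x c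
  proof -
    have "scaleK (conjugate c) x = scaleK (conjugate (\<Sum>b\<in>Basis. inner c b *\<^sub>R b)) x"
      by (simp add: euclidean_representation)
    also have "\<dots> = (\<Sum>b\<in>Basis. inner c b *\<^sub>R scaleK (conjugate b) x)"
      by (simp add: conjugate_sum conjugate_scaleR scale_sum_left scale_scaleR_left)
    finally have "\<phi> (scaleK (conjugate c) x) = (\<Sum>b\<in>Basis. inner c b * \<phi> (scaleK (conjugate b) x))"
      by (simp add: linear_sum[OF \<phi>] linear_cmul[OF \<phi>])
    then show ?thesis
      unfolding f_def inner_sum_left inner_scaleR_left by (simp add: inner_commute mult.commute)
  qed
  show ?thesis
  proof (rule that)
    show "f (x + y) = f x + f y" for x y
      by (simp add: f_def scale_right_distrib linear_add[OF \<phi>] scaleR_add_left sum.distrib)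
    show "f (scaleK c x) = c * f x" for c x
    proof -
      have "inner (f (scaleK c x)) d = inner (c * f x) d" for d
        unfolding inner inner_mult_conjugate by (simp add: conjugate_mult conjugate_conjugate mult.commute)
      then show ?thesis using vector_eq_rdot by blast
    qed
    show "norm (f x) \<le> M * norm x" for x
    proof (cases "f x = 0")
      case True
      have "0 \<le> M * norm x" using bound[of x] bound[of "- x"] by (simp add: linear_neg[OF \<phi>])
      then show ?thesis using True by simp
    next
      case False
      have "norm (f x) * norm (f x) = \<phi> (scaleK (conjugate (f x)) x)"
        using inner[of x "f x"] by (simp flip: power2_norm_eq_inner power2_eq_square)
      also have "\<dots> \<le> M * norm (scaleK (conjugate (f x)) x)" by (rule bound)
      also have "\<dots> = norm (f x) * (M * norm x)" by (simp add: norm_scale norm_conjugate)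
      finally show ?thesis using False by simp
    qed
  qed (rule inner)
qed

text \<open>Extend the real part \<open>inner (f0 x) 1\<close> as a real functional and rebuild a
  functional over 'k from it. The two agree on \<open>G\<close> because there
  \<open>inner (f x) c\<close> is the real part of \<open>f0\<close> at the multiple of x by
  \<open>conjugate c\<close>.\<close>

theorem hahn_banach:
  fixes f0 :: "'a \<Rightarrow> 'k"
  assumes G: "subspace G" and M: "0 \<le> M"
    and add: "\<And>x y. x \<in> G \<Longrightarrow> y \<in> G \<Longrightarrow> f0 (x + y) = f0 x + f0 y"
    and scale: "\<And>c x. x \<in> G \<Longrightarrow> f0 (scaleK c x) = c * f0 x"
    and bound: "\<And>x. x \<in> G \<Longrightarrow> norm (f0 x) \<le> M * norm x"
  obtains f where "\<And>x y. f (x + y) = f x + f y" "\<And>c x. f (scaleK c x) = c * f x"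
    and "\<And>x. norm (f x) \<le> M * norm x" "\<And>x. x \<in> G \<Longrightarrow> f x = f0 x"
proof -
  have scaleR: "r *\<^sub>R x = scaleK (of_real r) x" for r x by (simp add: scale_of_real)
  have "sublinear (\<lambda>x :: 'a. M * norm x)"
    unfolding sublinear_def using M by (auto simp: distrib_left[symmetric] norm_triangle_ineq mult_left_mono)
  moreover have "Real_Vector_Spaces.subspace G"
    unfolding real_vector.subspace_def scaleR using G unfolding subspace_def by blast
  moreover have "inner (f0 (x + y)) 1 = inner (f0 x) 1 + inner (f0 y) 1" if "x \<in> G" "y \<in> G" for x y
    using that by (simp add: add inner_add_left)
  moreover have "inner (f0 (c *\<^sub>R x)) 1 = c * inner (f0 x) 1" if "x \<in> G" for c x
    using scale[OF that, of "of_real c"] by (simp add: scaleR flip: scaleR_conv_of_real)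
  moreover have "inner (f0 x) 1 \<le> M * norm x" if "x \<in> G" for x
    using norm_cauchy_schwarz[of "f0 x" 1] bound[OF that] by simp
  ultimately obtain \<phi> where \<phi>: "linear \<phi>" "\<And>x. \<phi> x \<le> M * norm x" "\<And>x. x \<in> G \<Longrightarrow> \<phi> x = inner (f0 x) 1"
    by (rule hahn_banach_real) (assumption+, rule that)
  obtain f :: "'a \<Rightarrow> 'k" where f: "\<And>x y. f (x + y) = f x + f y" "\<And>c x. f (scaleK c x) = c * f x"
    "\<And>x. norm (f x) \<le> M * norm x" "\<And>x c. inner (f x) c = \<phi> (scaleK (conjugate c) x)"
    by (rule functional_of_real_functional[OF \<phi>(1,2)]) (rule that)
  have "f x = f0 x" if x: "x \<in> G" for x
  proof -
    have "inner (f x) c = inner (f0 x) c" for c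
      unfolding f(4) using x subspace_scale[OF G x]
      by (simp add: \<phi>(3) scale inner_mult_conjugate conjugate_conjugate)
    then show ?thesis using vector_eq_rdot by blast
  qed
  with f(1-3) show ?thesis by (rule that)
qed

section \<open>Finite-dimensional spans over the scalar field\<close>

lemma infdist_span_le: "y \<in> span B \<Longrightarrow> norm c * infdist b (span B) \<le> norm (scaleK c b + y)"
proof (cases "c = 0")
  case False
  assume y: "y \<in> span B"
  have "infdist b (span B) \<le> dist b (scaleK (- (1 / c)) y)"
    using y by (intro infdist_le span_scale)
  also have "\<dots> = norm (scaleK (1 / c) (scaleK c b + y))"
    using False by (simp add: dist_norm scale_right_distrib)
  also have "\<dots> = norm (scaleK c b + y) / norm c" by (simp add: norm_scale norm_divide)
  finally show ?thesis using False by (simp add: field_simps)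
qed simp

text \<open>By induction the new vector has positive distance from the old span, and this distance
  controls its coefficient. The coefficients along a convergent sequence are therefore Cauchy, and
  the scalar field is complete.\<close>

lemma closed_span: "finite B \<Longrightarrow> closed (span B)"
proof (induction B rule: finite_induct)
  case (insert b B)
  show ?case
  proof (cases "b \<in> span B")
    case True
    then show ?thesis using insert.IH by (simp add: span_redundant)
  next
    case False
    define d where "d = infdist b (span B)"
    have "span B \<noteq> {}" using span_zero by blast
    then have d: "0 < d"
      unfolding d_def using False insert.IH infdist_nonneg[of b "span B"] in_closed_iff_infdist_zero[of "span B" b]
      by (simp add: less_le)
    show ?thesis
      unfolding closed_sequential_limits
    proof (intro allI impI, elim conjE)
      fix x l assume x: "\<forall>n. x n \<in> span (insert b B)" and l: "x \<longlonglongrightarrow> l"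
      then obtain c where c: "\<And>n. x n - scaleK (c n) b \<in> span B" unfolding span_breakdown_eq by metis
      have cd: "norm (c m - c n) * d \<le> norm (x m - x n)" for m n
      proof -
        have "(x m - scaleK (c m) b) - (x n - scaleK (c n) b) \<in> span B" by (rule span_diff[OF c c])
        from infdist_span_le[OF this, of "c m - c n" b] show ?thesis
          by (simp add: d_def scale_left_diff_distrib algebra_simps)
      qed
      have "Cauchy c"
      proof (rule metric_CauchyI)
        fix e :: real assume "0 < e"
        then have "0 < e * d" using d by simp
        then obtain N where N: "\<And>m n. m \<ge> N \<Longrightarrow> n \<ge> N \<Longrightarrow> dist (x m) (x n) < e * d"
          using metric_CauchyD[OF LIMSEQ_imp_Cauchy[OF l]] by blast
        have "dist (c m) (c n) < e" if "m \<ge> N" "n \<ge> N" for m n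
        proof -
          have "norm (c m - c n) * d < e * d" using cd[of m n] N[OF that] by (simp add: dist_norm)
          then show ?thesis using d by (simp add: dist_norm)
        qed
        then show "\<exists>N. \<forall>m\<ge>N. \<forall>n\<ge>N. dist (c m) (c n) < e" by blast
      qed
      then obtain c0 where c0: "c \<longlonglongrightarrow> c0" using Cauchy_convergent convergent_def by blast
      have "(\<lambda>n. scaleK (c n) b) \<longlonglongrightarrow> scaleK c0 b"
      proof (rule LIM_zero_cancel, rule tendsto_norm_zero_cancel)
        have "(\<lambda>n. norm (c n - c0) * norm b) \<longlonglongrightarrow> 0"
          using tendsto_mult_left_zero[OF tendsto_norm_zero[OF LIM_zero[OF c0]]] .
        then show "(\<lambda>n. norm (scaleK (c n) b - scaleK c0 b)) \<longlonglongrightarrow> 0"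
          by (simp add: norm_scale flip: scale_left_diff_distrib)
      qed
      with l have "(\<lambda>n. x n - scaleK (c n) b) \<longlonglongrightarrow> l - scaleK c0 b" by (intro tendsto_diff)
      with insert.IH c have "l - scaleK c0 b \<in> span B" by (rule closed_sequentially)
      then show "l \<in> span (insert b B)" unfolding span_breakdown_eq by blast
    qed
  qed
qed simp

text \<open>The coefficient at \<open>b\<close> is at most \<open>norm y\<close> divided by the
  distance of \<open>b\<close> from the span of the other basis vectors, which is positive because
  that span is closed.\<close>

lemma representation_bounded:
  assumes B: "finite B" "independent B"
  obtains C where "0 \<le> C" "\<And>y b. y \<in> span B \<Longrightarrow> b \<in> B \<Longrightarrow> norm (representation B y b) \<le> C * norm y"
proof -
  define d where "d b = infdist b (span (B - {b}))" for b
  have d: "0 < d b" if "b \<in> B" for b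
  proof -
    have "b \<notin> span (B - {b})" using that B(2) unfolding dependent_def by blast
    moreover have "closed (span (B - {b}))" using B(1) by (intro closed_span) simp
    moreover have "span (B - {b}) \<noteq> {}" using span_zero by blast
    ultimately have "d b \<noteq> 0" unfolding d_def using in_closed_iff_infdist_zero by blast
    then show ?thesis using infdist_nonneg[of b "span (B - {b})"] unfolding d_def by linarith
  qed
  define C where "C = (\<Sum>b\<in>B. 1 / d b)"
  show ?thesis
  proof (rule that)
    show "0 \<le> C" unfolding C_def using d by (intro sum_nonneg) (simp add: less_imp_le)
    fix y b assume y: "y \<in> span B" and b: "b \<in> B"
    let ?r = "representation B y"
    have "y = (\<Sum>a\<in>B. scaleK (?r a) a)" using B y by (simp add: sum_representation_eq)
    also have "\<dots> = scaleK (?r b) b + (\<Sum>a\<in>B - {b}. scaleK (?r a) a)"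
      using B(1) b by (rule sum.remove)
    finally have yb: "y = scaleK (?r b) b + (\<Sum>a\<in>B - {b}. scaleK (?r a) a)" .
    have "norm (?r b) * d b \<le> norm y"
      unfolding d_def by (subst (2) yb, rule infdist_span_le) (intro span_sum span_scale span_base)
    then have "norm (?r b) \<le> 1 / d b * norm y" using d[OF b] by (simp add: field_simps)
    also have "1 / d b \<le> C"
      unfolding C_def using b B(1) d by (intro member_le_sum) (auto simp: less_imp_le)
    finally show "norm (?r b) \<le> C * norm y" by (simp add: mult_right_mono)
  qed
qed

text \<open>Coordinates with respect to an independent subset identify the unit ball of the span
  with a set \<open>U\<close>, to which \<open>auerbach_coordinates\<close> applies; Hahn-Banach
  then extends the dual functionals with the same bound. The reproducing identity stands in for
  biorthogonality, since it is what a projection needs.\<close>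

lemma auerbach_system:
  assumes "finite B"
  obtains n :: nat and x and f :: "nat \<Rightarrow> 'a \<Rightarrow> 'k" where "n \<le> card B"
    and "\<And>i. i < n \<Longrightarrow> x i \<in> span B" "\<And>i. i < n \<Longrightarrow> norm (x i) \<le> 1"
    and "\<And>i y z. i < n \<Longrightarrow> f i (y + z) = f i y + f i z"
    and "\<And>i c y. i < n \<Longrightarrow> f i (scaleK c y) = c * f i y"
    and "\<And>i y. i < n \<Longrightarrow> norm (f i y) \<le> 2 * norm y"
    and "\<And>y. y \<in> span B \<Longrightarrow> (\<Sum>i<n. scaleK (f i y) (x i)) = y"
proof -
  obtain B' where B': "B' \<subseteq> B" "independent B'" "B \<subseteq> span B'" by (rule maximal_independent_subset)
  have fin: "finite B'" using B'(1) assms by (rule finite_subset)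
  have sp: "span B' = span B" using B' by (metis span_mono span_span subset_antisym)
  define n where "n = card B'"
  obtain b where b: "bij_betw b {..<n} B'"
    using ex_bij_betw_nat_finite[OF fin] unfolding n_def atLeast0LessThan by blast
  then have bB: "b i \<in> B'" if "i < n" for i using that unfolding bij_betw_def by auto
  have b_eq: "b i = b j \<longleftrightarrow> i = j" if "i < n" "j < n" for i j
    using b that unfolding bij_betw_def inj_on_def by auto
  define g where "g y i = representation B' y (b i)" for y i
  have g_sum: "(\<Sum>i<n. scaleK (g y i) (b i)) = y" if "y \<in> span B" for y
  proof -
    have "(\<Sum>i<n. scaleK (g y i) (b i)) = (\<Sum>a\<in>B'. scaleK (representation B' y a) a)"
      unfolding g_def using b by (rule sum.reindex_bij_betw)
    also have "\<dots> = y" using B'(2) fin that sp by (simp add: sum_representation_eq)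
    finally show ?thesis .
  qed
  have g_add: "g (y + z) i = g y i + g z i" if "y \<in> span B" "z \<in> span B" for y z i
    using that B'(2) sp by (simp add: g_def representation_add)
  have g_scale: "g (scaleK c y) i = c * g y i" if "y \<in> span B" for c y i
    using that B'(2) sp by (simp add: g_def representation_scale)
  have g_b: "g (b j) i = (if i = j then 1 else 0)" if "i < n" "j < n" for i j
    using that B'(2) bB b_eq by (simp add: g_def representation_basis)
  obtain C where C: "0 \<le> C" "\<And>y i. y \<in> span B \<Longrightarrow> i < n \<Longrightarrow> norm (g y i) \<le> C * norm y"
    using representation_bounded[OF fin B'(2)] bB sp unfolding g_def by metis
  define U where "U = g ` {y \<in> span B. norm y \<le> 1}"
  \<comment> \<open>Small enough that each basis vector times \<open>s\<close> lies in the unit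
    ball, which supplies the points on the axes.\<close>
  define s where "s = 1 / (1 + (\<Sum>a\<in>B'. norm a))"
  have "0 \<le> (\<Sum>a\<in>B'. norm a)" by (intro sum_nonneg) auto
  then have s: "0 < s" "s * (\<Sum>a\<in>B'. norm a) \<le> 1" by (auto simp: s_def field_simps)
  define r :: 'k where "r = of_real s"
  obtain u h where u: "\<And>j. j < n \<Longrightarrow> u j \<in> U"
    and dual: "\<And>w l. l < n \<Longrightarrow> (\<Sum>j<n. u j l * (\<Sum>m<n. h j m * w m)) = w l"
    and le: "\<And>w i. w \<in> U \<Longrightarrow> i < n \<Longrightarrow> norm (\<Sum>m<n. h i m * w m) \<le> 2"
  proof (rule auerbach_coordinates[of U n C r])
    show "norm (w i) \<le> C" if w: "w \<in> U" and i: "i < n" for w i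
    proof -
      obtain y where y: "y \<in> span B" "norm y \<le> 1" "w = g y" using w unfolding U_def by auto
      have "norm (g y i) \<le> C * norm y" using C(2) y(1) i by blast
      also have "\<dots> \<le> C * 1" using C(1) y(2) by (rule mult_left_mono[rotated])
      finally show ?thesis using y by simp
    qed
    show "r \<noteq> 0" using s by (simp add: r_def)
    show "\<exists>w\<in>U. \<forall>i<n. w i = (if i = j then r else 0)" if j: "j < n" for j
    proof -
      have "b j \<in> span B" using bB[OF j] B'(1) by (auto intro: span_base)
      moreover have "norm (scaleK r (b j)) \<le> 1"
      proof -
        have "norm (b j) \<le> (\<Sum>a\<in>B'. norm a)" using bB[OF j] fin by (intro member_le_sum) auto
        then have "s * norm (b j) \<le> 1" using s by (meson mult_left_mono less_imp_le order_trans)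
        then show ?thesis using s by (simp add: r_def norm_scale)
      qed
      ultimately show ?thesis
        using j by (intro bexI[of _ "g (scaleK r (b j))"]) (auto simp: U_def g_scale g_b intro: span_scale)
    qed
  qed (rule that)
  have "\<exists>y. y \<in> span B \<and> norm y \<le> 1 \<and> u j = g y" if "j < n" for j using u[OF that] unfolding U_def by auto
  then obtain x where x: "\<And>j. j < n \<Longrightarrow> x j \<in> span B" "\<And>j. j < n \<Longrightarrow> norm (x j) \<le> 1"
      "\<And>j. j < n \<Longrightarrow> u j = g (x j)" by metis
  define f0 where "f0 i y = (\<Sum>m<n. h i m * g y m)" for i y
  have f0_add: "f0 i (y + z) = f0 i y + f0 i z" if "y \<in> span B" "z \<in> span B" for i y z
    using that by (simp add: f0_def g_add distrib_left sum.distrib)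
  have f0_scale: "f0 i (scaleK c y) = c * f0 i y" if "y \<in> span B" for i c y
    using that by (simp add: f0_def g_scale sum_distrib_left mult_ac)
  have f0_le: "norm (f0 i y) \<le> 2 * norm y" if y: "y \<in> span B" and i: "i < n" for i y
  proof (cases "y = 0")
    case True
    then show ?thesis using f0_scale[OF y, of i 0] by simp
  next
    case False
    define c :: 'k where "c = of_real (1 / norm y)"
    have "norm (scaleK c y) \<le> 1" using False by (simp add: c_def norm_scale norm_divide)
    then have "g (scaleK c y) \<in> U" using y by (auto simp: U_def intro: span_scale)
    from le[OF this i] have "norm (c * f0 i y) \<le> 2"
      unfolding f0_scale[OF y, symmetric] by (simp add: f0_def)
    then show ?thesis using False by (simp add: c_def norm_mult norm_divide field_simps)
  qed
  have "\<exists>f. (\<forall>y z. f (y + z) = f y + f z) \<and> (\<forall>c y. f (scaleK c y) = c * f y)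
      \<and> (\<forall>y. norm (f y) \<le> 2 * norm y) \<and> (\<forall>y\<in>span B. f y = f0 i y)" if i: "i < n" for i
  proof (rule hahn_banach[of "span B" 2 "f0 i"])
    fix f assume "\<And>y z. f (y + z) = f y + f z" "\<And>c y. f (scaleK c y) = c * f y"
      "\<And>y. norm (f y) \<le> 2 * norm y" "\<And>y. y \<in> span B \<Longrightarrow> f y = f0 i y"
    then show ?thesis by blast
  qed (use f0_add f0_scale f0_le i in auto)
  then obtain f where f: "\<And>i y z. i < n \<Longrightarrow> f i (y + z) = f i y + f i z"
    "\<And>i c y. i < n \<Longrightarrow> f i (scaleK c y) = c * f i y"
    "\<And>i y. i < n \<Longrightarrow> norm (f i y) \<le> 2 * norm y" "\<And>i y. i < n \<Longrightarrow> y \<in> span B \<Longrightarrow> f i y = f0 i y"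
    by metis
  have id: "(\<Sum>i<n. scaleK (f i y) (x i)) = y" if y: "y \<in> span B" for y
  proof -
    have "(\<Sum>i<n. scaleK (f i y) (x i)) = (\<Sum>i<n. scaleK (f0 i y) (\<Sum>l<n. scaleK (u i l) (b l)))"
      using x y by (intro sum.cong) (auto simp: f(4) g_sum)
    also have "\<dots> = (\<Sum>l<n. \<Sum>i<n. scaleK (u i l * f0 i y) (b l))"
      by (subst sum.swap) (simp add: scale_sum_right mult.commute)
    also have "\<dots> = (\<Sum>l<n. scaleK (g y l) (b l))"
      by (intro sum.cong) (auto simp: f0_def dual simp flip: scale_sum_left)
    also have "\<dots> = y" by (rule g_sum[OF y])
    finally show ?thesis .
  qed
  have "n \<le> card B" unfolding n_def using assms B'(1) by (rule card_mono)
  from that[OF this x(1,2) f(1-3) id] show ?thesis .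
qed

end

section \<open>Approximation by finite rank operators\<close>

context banach_over
begin

section \<open>Linear operators and finite rank over the scalar field\<close>

lemma bounded_ops_apply: "L \<in> bounded_ops scaleK \<Longrightarrow> blinfun_apply L (scaleK c x) = scaleK c (blinfun_apply L x)"
  by (simp add: bounded_ops_def)

lemma bounded_ops_zero: "0 \<in> bounded_ops scaleK"
  by (simp add: bounded_ops_def)

lemma bounded_ops_id: "id_blinfun \<in> bounded_ops scaleK"
  by (simp add: bounded_ops_def)

lemma bounded_ops_diff: "L \<in> bounded_ops scaleK \<Longrightarrow> M \<in> bounded_ops scaleK \<Longrightarrow> L - M \<in> bounded_ops scaleK"
  by (simp add: bounded_ops_def blinfun.diff_left scale_right_diff_distrib)

lemma bounded_ops_compose: "L \<in> bounded_ops scaleK \<Longrightarrow> M \<in> bounded_ops scaleK \<Longrightarrow> L o\<^sub>L M \<in> bounded_ops scaleK"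
  by (simp add: bounded_ops_def)

lemma op_products_bounded_ops: "A \<subseteq> bounded_ops scaleK \<Longrightarrow> op_products A n \<subseteq> bounded_ops scaleK"
  by (induction n) (auto intro: bounded_ops_id bounded_ops_compose)

lemma bounded_ops_span:
  assumes L: "L \<in> bounded_ops scaleK" and "y \<in> span B"
  shows "blinfun_apply L y \<in> span (blinfun_apply L ` B)"
  using assms(2)
proof (induction rule: span_induct_alt)
  case base
  show ?case by (simp add: blinfun.zero_right span_zero)
next
  case (step c x y)
  then show ?case
    unfolding blinfun.add_right bounded_ops_apply[OF L] by (intro span_add span_scale) (auto intro: span_base)
qed

lemma finite_rankI: "finite B \<Longrightarrow> (\<And>x. blinfun_apply K x \<in> span B) \<Longrightarrow> finite_rank scaleK K"
  unfolding finite_rank_def by blast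

lemma finite_rankE:
  assumes "finite_rank scaleK K"
  obtains B where "finite B" "\<And>x. blinfun_apply K x \<in> span B"
  using assms unfolding finite_rank_def by blast

lemma finite_rank_zero: "finite_rank scaleK 0"
  by (rule finite_rankI[of "{}"]) auto

lemma finite_rank_diff:
  assumes "finite_rank scaleK K" "finite_rank scaleK L"
  shows "finite_rank scaleK (K - L)"
proof -
  obtain B C where B: "finite B" "\<And>x. blinfun_apply K x \<in> span B"
    and C: "finite C" "\<And>x. blinfun_apply L x \<in> span C" using assms by (meson finite_rankE)
  have "span B \<subseteq> span (B \<union> C)" "span C \<subseteq> span (B \<union> C)" by (auto intro!: span_mono)
  then show ?thesis using B C
    by (intro finite_rankI[of "B \<union> C"]) (auto simp: blinfun.diff_left intro!: span_diff)
qed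

lemma finite_rank_compose_left: "finite_rank scaleK K \<Longrightarrow> finite_rank scaleK (K o\<^sub>L L)"
  by (erule finite_rankE) (auto intro: finite_rankI)

lemma finite_rank_compose_right:
  "L \<in> bounded_ops scaleK \<Longrightarrow> finite_rank scaleK K \<Longrightarrow> finite_rank scaleK (L o\<^sub>L K)"
  by (erule finite_rankE) (auto intro!: finite_rankI[of "blinfun_apply L ` _"] bounded_ops_span)

lemma projection_onto_span:
  assumes "finite B"
  obtains \<pi> where "\<pi> \<in> bounded_ops scaleK" "finite_rank scaleK \<pi>"
    "\<And>y. y \<in> span B \<Longrightarrow> blinfun_apply \<pi> y = y" "norm \<pi> \<le> 2 * card B"
proof (rule auerbach_system[OF assms])
  fix n x and f :: "nat \<Rightarrow> 'a \<Rightarrow> 'k"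
  assume n: "n \<le> card B" and x: "\<And>i. i < n \<Longrightarrow> x i \<in> span B" "\<And>i. i < n \<Longrightarrow> norm (x i) \<le> 1"
    and f: "\<And>i y z. i < n \<Longrightarrow> f i (y + z) = f i y + f i z"
      "\<And>i c y. i < n \<Longrightarrow> f i (scaleK c y) = c * f i y"
      "\<And>i y. i < n \<Longrightarrow> norm (f i y) \<le> 2 * norm y"
    and id: "\<And>y. y \<in> span B \<Longrightarrow> (\<Sum>i<n. scaleK (f i y) (x i)) = y"
  define p where "p y = (\<Sum>i<n. scaleK (f i y) (x i))" for y
  have p_add: "p (y + z) = p y + p z" for y z
    unfolding p_def sum.distrib[symmetric] by (intro sum.cong) (auto simp: f(1) scale_left_distrib)
  have p_scale: "p (scaleK c y) = scaleK c (p y)" for c y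
    unfolding p_def scale_sum_right by (intro sum.cong) (auto simp: f(2))
  have p_norm: "norm (p y) \<le> norm y * (2 * real n)" for y
  proof -
    have "norm (p y) \<le> (\<Sum>i<n. 2 * norm y)"
      unfolding p_def
    proof (rule sum_norm_le)
      fix i assume "i \<in> {..<n}"
      then have i: "i < n" by simp
      have "norm (f i y) * norm (x i) \<le> norm (f i y) * 1" using x(2)[OF i] by (rule mult_left_mono) simp
      then show "norm (scaleK (f i y) (x i)) \<le> 2 * norm y" using f(3)[OF i, of y] by (simp add: norm_scale)
    qed
    then show ?thesis by (simp add: mult_ac)
  qed
  have "p (r *\<^sub>R y) = r *\<^sub>R p y" for r y using p_scale[of "of_real r" y] by (simp add: scale_of_real)
  with p_add p_norm have bl: "bounded_linear p" by (intro bounded_linear_intro) auto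
  define \<pi> where "\<pi> = Blinfun p"
  have \<pi>: "blinfun_apply \<pi> = p" unfolding \<pi>_def using bl by (rule bounded_linear_Blinfun_apply)
  show thesis
  proof (rule that)
    show "\<pi> \<in> bounded_ops scaleK" by (simp add: bounded_ops_def \<pi> p_scale)
    show "finite_rank scaleK \<pi>"
      using assms by (rule finite_rankI) (auto simp: \<pi> p_def intro!: span_sum span_scale x(1))
    show "blinfun_apply \<pi> y = y" if "y \<in> span B" for y using id[OF that] by (simp add: \<pi> p_def)
    show "norm \<pi> \<le> 2 * card B"
    proof (rule norm_blinfun_bound)
      fix y :: 'a
      have "norm y * (2 * real n) \<le> norm y * (2 * real (card B))" using n by (intro mult_left_mono) auto
      then show "norm (blinfun_apply \<pi> y) \<le> 2 * card B * norm y"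
        using p_norm[of y] by (simp add: \<pi> mult_ac)
    qed simp
  qed
qed

text \<open>Replaces compactness of bounded closed sets in a finite-dimensional space: a sum of
  images of compact balls of scalars.\<close>

lemma compact_combinations:
  fixes n :: nat
  shows "compact {\<Sum>i<n. scaleK (c i) (x i) | c. \<forall>i<n. norm (c i) \<le> R}"
proof (induction n)
  case (Suc n)
  let ?S = "{\<Sum>i<n. scaleK (c i) (x i) | c. \<forall>i<n. norm (c i) \<le> R}"
  let ?T = "(\<lambda>c. scaleK c (x n)) ` cball 0 R"
  have "{\<Sum>i<Suc n. scaleK (c i) (x i) | c. \<forall>i<Suc n. norm (c i) \<le> R} = {y + z | y z. y \<in> ?S \<and> z \<in> ?T}"
  proof (intro equalityI subsetI)
    fix w assume "w \<in> {\<Sum>i<Suc n. scaleK (c i) (x i) | c. \<forall>i<Suc n. norm (c i) \<le> R}"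
    then obtain c where "w = (\<Sum>i<n. scaleK (c i) (x i)) + scaleK (c n) (x n)" "\<forall>i<Suc n. norm (c i) \<le> R"
      by auto
    then show "w \<in> {y + z | y z. y \<in> ?S \<and> z \<in> ?T}" by fastforce
  next
    fix w assume "w \<in> {y + z | y z. y \<in> ?S \<and> z \<in> ?T}"
    then obtain c d where w: "w = (\<Sum>i<n. scaleK (c i) (x i)) + scaleK d (x n)" "\<forall>i<n. norm (c i) \<le> R" "norm d \<le> R"
      by auto
    have "w = (\<Sum>i<Suc n. scaleK ((c(n := d)) i) (x i))" using w(1) by simp
    moreover have "\<forall>i<Suc n. norm ((c(n := d)) i) \<le> R" using w(2,3) by (simp add: less_Suc_eq)
    ultimately show "w \<in> {\<Sum>i<Suc n. scaleK (c i) (x i) | c. \<forall>i<Suc n. norm (c i) \<le> R}" by blast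
  qed
  moreover have "compact ?T"
  proof (rule compact_continuous_image)
    have "bounded_linear (\<lambda>c. scaleK c (x n))"
      by (rule bounded_linear_intro[of _ "norm (x n)"]) (auto simp: scale_left_distrib scale_scaleR_left norm_scale)
    then show "continuous_on (cball 0 R) (\<lambda>c. scaleK c (x n))"
      by (rule bounded_linear.continuous_on) (rule continuous_on_id)
  qed simp
  ultimately show ?case using compact_sums[OF Suc.IH] by simp
qed simp

text \<open>The Auerbach functionals bound the coefficients of the image of the unit ball, which
  thus lies in a compact set of combinations.\<close>

lemma norm_chi_finite_rank:
  assumes "finite_rank scaleK K"
  shows "norm_chi K = 0"
proof -
  obtain B where B: "finite B" "\<And>x. blinfun_apply K x \<in> span B" using assms by (rule finite_rankE) blast
  have "norm_chi K \<le> e" if e: "0 < e" for e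
  proof (rule auerbach_system[OF B(1)])
    fix n x and f :: "nat \<Rightarrow> 'a \<Rightarrow> 'k"
    assume f: "\<And>i y. i < n \<Longrightarrow> norm (f i y) \<le> 2 * norm y"
      and id: "\<And>y. y \<in> span B \<Longrightarrow> (\<Sum>i<n. scaleK (f i y) (x i)) = y"
    define S where "S = {\<Sum>i<n. scaleK (c i) (x i) | c. \<forall>i<n. norm (c i) \<le> 2 * norm K}"
    have "compact S" unfolding S_def by (rule compact_combinations)
    then obtain F where F: "finite F" "S \<subseteq> (\<Union>y\<in>F. ball y e)"
      using compactE_image[of S S "\<lambda>y. ball y e"] e by (metis UN_I centre_in_ball open_ball subsetI)
    have "blinfun_apply K u \<in> S" if "norm u \<le> 1" for u
    proof -
      have "norm (blinfun_apply K u) \<le> norm K" using norm_blinfun[of K u] mult_left_mono[OF that, of "norm K"] by simp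
      then have "\<forall>i<n. norm (f i (blinfun_apply K u)) \<le> 2 * norm K" using f[of _ "blinfun_apply K u"] by fastforce
      moreover have "blinfun_apply K u = (\<Sum>i<n. scaleK (f i (blinfun_apply K u)) (x i))" using id[OF B(2)] by simp
      ultimately show ?thesis
        unfolding S_def by (intro CollectI exI[of _ "\<lambda>i. f i (blinfun_apply K u)"] conjI)
    qed
    then have "blinfun_apply K ` cball 0 1 \<subseteq> S" by auto
    also have "\<dots> \<subseteq> (\<Union>y\<in>F. cball y e)" using F(2) ball_subset_cball by blast
    finally show "norm_chi K \<le> e" by (intro norm_chi_le[OF e F(1)])
  qed
  then have "norm_chi K \<le> 0" using field_le_epsilon[of "norm_chi K" 0] by simp
  then show ?thesis using norm_chi_nonneg[of K] by linarith
qed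

lemma norm_f_le:
  assumes "K \<in> bounded_ops scaleK" "finite_rank scaleK K"
  shows "norm_f scaleK L \<le> norm (L - K)"
  unfolding norm_f_def using assms by (intro cInf_lower bdd_belowI[of _ 0]) auto

lemma norm_f_lessD:
  assumes "norm_f scaleK L < t"
  obtains K where "K \<in> bounded_ops scaleK" "finite_rank scaleK K" "norm (L - K) < t"
proof -
  let ?X = "{norm (L - K) | K. K \<in> bounded_ops scaleK \<and> finite_rank scaleK K}"
  have "?X \<noteq> {}" using bounded_ops_zero finite_rank_zero by blast
  then obtain y where "y \<in> ?X" "y < t" using assms unfolding norm_f_def by (meson cInf_lessD)
  then show ?thesis using that by blast
qed

lemma norm_f_nonneg: "0 \<le> norm_f scaleK L"
  unfolding norm_f_def using bounded_ops_zero finite_rank_zero by (intro cInf_greatest) auto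

lemma norm_f_le_norm: "norm_f scaleK L \<le> norm L"
  using norm_f_le[OF bounded_ops_zero finite_rank_zero, of L] by simp

lemma norm_chi_le_norm_f: "norm_chi L \<le> norm_f scaleK L"
proof (rule field_le_epsilon)
  fix e :: real assume "0 < e"
  then obtain K where K: "finite_rank scaleK K" "norm (L - K) < norm_f scaleK L + e"
    using norm_f_lessD[of L "norm_f scaleK L + e"] by auto
  have "norm_chi L \<le> norm_chi K + norm (L - K)" using norm_chi_le_norm_add[of K "L - K"] by simp
  then show "norm_chi L \<le> norm_f scaleK L + e" using norm_chi_finite_rank[OF K(1)] K(2) by linarith
qed

lemma norm_f_compose:
  assumes L: "L \<in> bounded_ops scaleK" and M: "M \<in> bounded_ops scaleK"
  shows "norm_f scaleK (L o\<^sub>L M) \<le> norm_f scaleK L * norm_f scaleK M"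
proof -
  have main: "norm_f scaleK (L o\<^sub>L M) \<le> (norm_f scaleK L + e) * (norm_f scaleK M + e)" if e: "0 < e" for e
  proof -
    obtain K where K: "K \<in> bounded_ops scaleK" "finite_rank scaleK K" "norm (L - K) < norm_f scaleK L + e"
      using e by (auto intro: norm_f_lessD[of L "norm_f scaleK L + e"])
    obtain J where J: "J \<in> bounded_ops scaleK" "finite_rank scaleK J" "norm (M - J) < norm_f scaleK M + e"
      using e by (auto intro: norm_f_lessD[of M "norm_f scaleK M + e"])
    \<comment> \<open>This is K M + L J - K J, of finite rank term by term, and chosen so that L M -
      H factors as (L - K)(M - J).\<close>
    define H where "H = (K o\<^sub>L M) - ((K - L) o\<^sub>L J)"
    have H: "(L o\<^sub>L M) - H = (L - K) o\<^sub>L (M - J)"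
      unfolding H_def by (auto intro!: blinfun_eqI simp: blinfun.diff_left blinfun.diff_right)
    have "norm_f scaleK (L o\<^sub>L M) \<le> norm ((L o\<^sub>L M) - H)"
      unfolding H_def
      by (intro norm_f_le bounded_ops_diff bounded_ops_compose finite_rank_diff finite_rank_compose_left
          finite_rank_compose_right K J L M)
    also have "\<dots> \<le> norm (L - K) * norm (M - J)" unfolding H by (rule norm_blinfun_compose)
    also have "\<dots> \<le> (norm_f scaleK L + e) * (norm_f scaleK M + e)"
      using K(3) J(3) norm_f_nonneg[of L] e by (intro mult_mono) auto
    finally show ?thesis .
  qed
  have "((\<lambda>e. (norm_f scaleK L + e) * (norm_f scaleK M + e))
      \<longlongrightarrow> (norm_f scaleK L + 0) * (norm_f scaleK M + 0)) (at_right 0)"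
    by (intro tendsto_intros)
  then have "norm_f scaleK (L o\<^sub>L M) \<le> (norm_f scaleK L + 0) * (norm_f scaleK M + 0)"
    by (rule tendsto_lowerbound) (use main in \<open>auto simp: eventually_at_filter\<close>)
  then show ?thesis by simp
qed

text \<open>The net is applied to the error left by the previous factors, not to the vector itself.
  So the errors multiply, while the dimension grows only by \<open>card F\<close> per
  factor.\<close>

lemma op_products_near_span:
  assumes S: "S \<subseteq> bounded_ops scaleK" and F: "finite F"
    and net: "\<And>L. L \<in> S \<Longrightarrow> blinfun_apply L ` cball 0 1 \<subseteq> (\<Union>y\<in>F. cball y d)" and d: "0 \<le> d"
    and P: "P \<in> op_products S n"
  shows "\<exists>B. finite B \<and> card B \<le> n * card F
    \<and> (\<forall>x. \<exists>g\<in>span B. norm (blinfun_apply P x - g) \<le> d ^ n * norm x)"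
  using P
proof (induction n arbitrary: P)
  case 0
  then show ?case by (intro exI[of _ "{}"]) auto
next
  case (Suc n)
  then obtain L M where LM: "P = L o\<^sub>L M" "L \<in> S" "M \<in> op_products S n" by auto
  from Suc.IH[OF LM(3)] obtain B where B: "finite B" "card B \<le> n * card F"
    "\<And>x. \<exists>g\<in>span B. norm (blinfun_apply M x - g) \<le> d ^ n * norm x" by blast
  let ?L = "blinfun_apply L"
  define B' where "B' = ?L ` B \<union> F"
  have "card B' \<le> card (?L ` B) + card F" unfolding B'_def by (rule card_Un_le)
  also have "card (?L ` B) \<le> card B" using B(1) by (rule card_image_le)
  finally have card: "card B' \<le> Suc n * card F" using B(2) by simp
  have "\<exists>g\<in>span B'. norm (blinfun_apply P x - g) \<le> d ^ Suc n * norm x" for x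
  proof -
    obtain g where g: "g \<in> span B" "norm (blinfun_apply M x - g) \<le> d ^ n * norm x" using B(3) by blast
    define c where "c = d ^ n * norm x"
    have c: "0 \<le> c" using d by (simp add: c_def)
    define h where "h = blinfun_apply M x - g"
    have "h \<in> cball 0 c" using g by (simp add: h_def c_def)
    then have "?L h \<in> (\<Union>y\<in>(\<lambda>y. c *\<^sub>R y) ` F. cball y (c * d))"
      using net_scale[OF net[OF LM(2)] c] by blast
    then obtain y where y: "y \<in> F" "norm (?L h - c *\<^sub>R y) \<le> c * d"
      by (auto simp: dist_norm norm_minus_commute)
    have "?L g \<in> span B'"
      using bounded_ops_span[OF _ g(1), of L] S LM(2) span_mono[of "?L ` B" B'] unfolding B'_def by auto
    moreover have "c *\<^sub>R y \<in> span B'"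
      using y(1) unfolding scale_of_real[symmetric] B'_def by (intro span_scale span_base) simp
    ultimately have "?L g + c *\<^sub>R y \<in> span B'" by (rule span_add)
    moreover have "blinfun_apply P x - (?L g + c *\<^sub>R y) = ?L h - c *\<^sub>R y"
      by (simp add: LM(1) h_def blinfun.diff_right)
    with y(2) have "norm (blinfun_apply P x - (?L g + c *\<^sub>R y)) \<le> d ^ Suc n * norm x"
      by (simp only: c_def power_Suc mult_ac)
    ultimately show ?thesis by blast
  qed
  with B(1) F card show ?case by (intro exI[of _ B']) (auto simp: B'_def)
qed

lemma norm_f_op_products_le:
  fixes d :: real
  assumes S: "S \<subseteq> bounded_ops scaleK" and F: "finite F"
    and net: "\<And>L. L \<in> S \<Longrightarrow> blinfun_apply L ` cball 0 1 \<subseteq> (\<Union>y\<in>F. cball y d)" and d: "0 \<le> d"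
    and P: "P \<in> op_products S n"
  shows "norm_f scaleK P \<le> (1 + 2 * (n * card F)) * d ^ n"
proof -
  obtain B where B: "finite B" "card B \<le> n * card F"
    "\<And>x. \<exists>g\<in>span B. norm (blinfun_apply P x - g) \<le> d ^ n * norm x"
    using op_products_near_span[OF S F net d P] by blast
  obtain \<pi> where \<pi>: "\<pi> \<in> bounded_ops scaleK" "finite_rank scaleK \<pi>"
    "\<And>y. y \<in> span B \<Longrightarrow> blinfun_apply \<pi> y = y" "norm \<pi> \<le> 2 * card B"
    by (rule projection_onto_span[OF B(1)]) (rule that)
  have P_in: "P \<in> bounded_ops scaleK" using op_products_bounded_ops[OF S] P by blast
  have "norm_f scaleK P \<le> norm (P - (\<pi> o\<^sub>L P))"
    by (intro norm_f_le bounded_ops_compose finite_rank_compose_left \<pi> P_in)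
  also have "\<dots> \<le> (1 + 2 * (n * card F)) * d ^ n"
  proof (rule norm_blinfun_bound)
    fix x :: 'a
    obtain g where g: "g \<in> span B" "norm (blinfun_apply P x - g) \<le> d ^ n * norm x" using B(3) by blast
    define h where "h = blinfun_apply P x - g"
    \<comment> \<open>The projection fixes \<open>g\<close>, so only the small vector
      \<open>h\<close> is affected by it.\<close>
    have "blinfun_apply (P - (\<pi> o\<^sub>L P)) x = h - blinfun_apply \<pi> h"
      using \<pi>(3)[OF g(1)] by (simp add: h_def blinfun.diff_left blinfun.diff_right)
    then have "norm (blinfun_apply (P - (\<pi> o\<^sub>L P)) x) \<le> norm h + norm (blinfun_apply \<pi> h)"
      by (simp add: norm_triangle_ineq4)
    also have "\<dots> \<le> (1 + norm \<pi>) * norm h" using norm_blinfun[of \<pi> h] by (simp add: distrib_right)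
    also have "\<dots> \<le> (1 + 2 * (n * card F)) * (d ^ n * norm x)"
    proof (rule mult_mono)
      have "real (card B) \<le> real (n * card F)" using B(2) by (simp only: of_nat_le_iff)
      then show "1 + norm \<pi> \<le> 1 + 2 * (n * card F)" using \<pi>(4) by simp
      show "norm h \<le> d ^ n * norm x" using g(2) by (simp add: h_def)
    qed auto
    finally show "norm (blinfun_apply (P - (\<pi> o\<^sub>L P)) x) \<le> (1 + 2 * (n * card F)) * d ^ n * norm x"
      by (simp add: mult_ac)
  qed (use d in auto)
  finally show ?thesis .
qed

theorem radius_chi_eq_radius_f:
  assumes AK: "A \<subseteq> bounded_ops scaleK" and A: "compact (closure A)" and ne: "A \<noteq> {}"
  shows "radius_chi A = radius_f scaleK A"
proof -
  have bdd: "bounded A" using compact_imp_bounded[OF A] closure_subset by (rule bounded_subset)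
  obtain X where X: "0 \<le> X" "radius_chi A = ereal X"
    "(\<lambda>n. SUP L\<in>op_products A n. ereal (root n (norm_chi L))) \<longlonglongrightarrow> ereal X"
    "\<And>t. X < t \<Longrightarrow> \<forall>\<^sub>F n in sequentially. \<forall>L\<in>op_products A n. norm_chi L < t ^ n"
    by (rule radius_chi_real[OF ne bdd]) (rule that)
  have sub: "norm_f scaleK (L o\<^sub>L M) \<le> norm_f scaleK L * norm_f scaleK M"
    if "L \<in> op_products A m" "M \<in> op_products A n" for L M m n
    using that op_products_bounded_ops[OF AK] by (intro norm_f_compose) blast+
  obtain R where R: "0 \<le> R"
    "(\<lambda>n. SUP L\<in>op_products A n. ereal (root n (norm_f scaleK L))) \<longlonglongrightarrow> ereal R"
    "\<And>t n. 0 \<le> t \<Longrightarrow> t < R \<Longrightarrow> n \<ge> 1 \<Longrightarrow> \<exists>L\<in>op_products A n. t ^ n < norm_f scaleK L"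
    by (rule submultiplicative_growth[where \<nu> = "norm_f scaleK", OF ne bdd norm_f_nonneg norm_f_le_norm sub])
      (assumption+, rule that)
  have f: "radius_f scaleK A = ereal R" unfolding radius_f_def using R(2) by (rule limI)
  have root_le: "root n x \<le> root n y" if "x \<le> y" for n and x y :: real
    using that by (cases "n = 0") auto
  have "X \<le> R"
  proof -
    have "ereal X \<le> ereal R"
      using X(3) R(2) by (rule LIMSEQ_le) (auto intro!: SUP_mono' root_le norm_chi_le_norm_f)
    then show ?thesis by simp
  qed
  moreover have "\<not> X < R"
  proof
    assume "X < R"
    \<comment> \<open>Rates X < u < v < t < R: \<open>u\<close> bounds \<open>norm_chi\<close> on
      \<open>k\<close>-fold products, \<open>v ^ k\<close> is the radius of their common net, and
      \<open>t\<close> is exceeded by \<open>norm_f\<close> at every positive length. The factor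
      linear in n from the projections cannot make up for (v / t)^(k n).\<close>
    then obtain u where u: "X < u" "u < R" using dense by blast
    then obtain t where t: "u < t" "t < R" using dense by blast
    have pos: "0 < u" "0 < t" using X u t by auto
    obtain k0 where k0: "\<And>n L. n \<ge> k0 \<Longrightarrow> L \<in> op_products A n \<Longrightarrow> norm_chi L < u ^ n"
      using X(4)[OF u(1)] unfolding eventually_sequentially by blast
    define k where "k = Suc k0"
    obtain v where v: "u < v" "v < t" using t dense by blast
    have "u ^ k < v ^ k" using v pos by (intro power_strict_mono) (auto simp: k_def)
    then obtain F where F: "finite F"
      "\<And>L. L \<in> op_products A k \<Longrightarrow> blinfun_apply L ` cball 0 1 \<subseteq> (\<Union>y\<in>F. cball y (v ^ k))"
      using precompact_uniform_net[OF precompact_op_products[OF A], of k "u ^ k" "v ^ k"] k0[of k]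
      unfolding k_def by (metis le_SucI order_refl)
    define c where "c = (v / t) ^ k"
    have "0 < v / t" "v / t < 1" using v pos by auto
    then have c: "0 \<le> c" "c < 1" unfolding c_def k_def by (auto intro: power_Suc_less_one simp del: power_Suc simp: less_imp_le)
    have "1 \<le> (1 + 2 * (real n * card F)) * c ^ n" if n: "n \<ge> 1" for n
    proof -
      have "k * n \<ge> 1" using n by (simp add: k_def)
      then obtain P where P: "P \<in> op_products A (k * n)" "t ^ (k * n) < norm_f scaleK P"
        using R(3)[of t "k * n"] pos t by auto
      have "norm_f scaleK P \<le> (1 + 2 * (n * card F)) * (v ^ k) ^ n"
        using P(1) v pos unfolding op_products_op_products[symmetric]
        by (intro norm_f_op_products_le[OF op_products_bounded_ops[OF AK] F]) auto
      then have "t ^ (k * n) \<le> (1 + 2 * (real n * card F)) * v ^ (k * n)" using P(2) by (simp add: power_mult)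
      then have "1 \<le> (1 + 2 * (real n * card F)) * (v ^ (k * n) / t ^ (k * n))" using pos by (simp add: field_simps)
      then show ?thesis by (simp add: c_def power_divide power_mult)
    qed
    moreover have "(\<lambda>n. (1 + 2 * (real n * card F)) * c ^ n) \<longlonglongrightarrow> 0"
    proof -
      have "(\<lambda>n. real n * c ^ n) \<longlonglongrightarrow> 0" using c by (intro powser_times_n_limit_0) simp
      from tendsto_add[OF LIMSEQ_power_zero tendsto_mult_right_zero[OF this, of "2 * real (card F)"], of c]
      show ?thesis using c by (simp add: algebra_simps)
    qed
    then have "\<forall>\<^sub>F n in sequentially. (1 + 2 * (real n * card F)) * c ^ n < 1" by (rule order_tendstoD) simp
    then obtain n where "n \<ge> 1" "(1 + 2 * (real n * card F)) * c ^ n < 1"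
      unfolding eventually_sequentially by (metis nle_le)
    ultimately show False by force
  qed
  ultimately show ?thesis by (simp add: X f)
qed

end

theorem theorem1p3:
  fixes scaleK :: "'k::{real_normed_field, euclidean_space} \<Rightarrow> 'a::banach \<Rightarrow> 'a"
    and A :: "('a \<Rightarrow>\<^sub>L 'a) set"
  assumes "banach_over scaleK"
    and "A \<subseteq> bounded_ops scaleK"
    and "compact (closure A)"
    and "A \<noteq> {}"
  shows "joint_radius A = max (radius_chi A) (radius_r A) \<and> radius_chi A = radius_f scaleK A"
  using joint_radius_eq_max[OF assms(4,3)] banach_over.radius_chi_eq_radius_f[OF assms] by blast

end
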